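(* Let $\tau\in[0,1)$ and let $p_1,p_2\ge0$ be integers with $p_1+p_2$ even. As $N\to\infty$: (i) $$\frac{M^{\rm H,\mathbb C}_{p_1,p_2,N}}{N^{\frac{p_1+p_2}2+1}}=C_1(p_1,p_2)+\frac{C_2(p_1,p_2)}N+O(N^{-2});$$ (ii) $$\frac{M^{\rm H,\mathbb H}_{p_1,p_2,N}}{2^{\frac{p_1+p_2}2}N^{\frac{p_1+p_2}2+1}}=C_1(p_1,p_2)+\frac{C_2'(p_1,p_2)}N+O(N^{-2}).$$
   Context: $M^{\rm H,\mathbb C}_{p_1,p_2,N}$ and $M^{\rm H,\mathbb H}_{p_1,p_2,N}$ are $\mathbb E[\sum_{j=1}^Nz_j^{p_1}\bar z_j^{p_2}]$ under the densities on $\mathbb C^N$ proportional to $\prod_{j<k}|z_j-z_k|^2\prod_j\omega^{\rm H}(z_j)dA(z_j)$ and $\prod_{j<k}|z_j-z_k|^2|z_j-\bar z_k|^2\prod_j|z_j-\bar z_j|^2\omega^{\rm H}(z_j)dA(z_j)$ respectively, with $dA=d^2z/\pi$ and $\omega^{\rm H}(z)=\exp(-\frac{|z|^2-\tau\operatorname{Re}z^2}{1-\tau^2})$. $\mathcal I_p=\{-p,-p+2,\dots,p\}$; $\binom nk=0$ unless $k\in\{0,\dots,n\}$ is an integer; $0^0=1$. $$C_1(p_1,p_2)=\frac1{\frac{p_1+p_2}2+1}\sum_{r\in\mathcal I_{p_1\wedge p_2}}\tau^{\frac{p_1+p_2}2+r}\binom{p_1}{\frac{p_1+r}2}\binom{p_2}{\frac{p_2+r}2},\qquad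 C_2(p_1,p_2)=-\sum_{r\in\mathcal I_{p_1\wedge p_2}}\tau^{\frac{p_1+p_2}2+r}\binom{p_1}{\frac{p_1+r}2}\binom{p_2}{\frac{p_2+r}2}\frac r2,$$ $$C_2'(p_1,p_2)=\frac12C_2(p_1,p_2)+\frac{1-\tau^2}2\frac{p_1p_2}{p_1+p_2}C_1(p_1-1,p_2-1)-\frac12\sum_{r\in\mathcal I_{p_1\vee p_2}}\sum_{s=1}^{p_1\vee p_2}\tau^{\frac{p_1+p_2}2+r-s}\Big[\frac{p_1}{p_1+p_2}\binom{p_1}{\frac{p_1+r}2-s}\binom{p_2}{\frac{p_2+r}2}+\frac{p_2}{p_1+p_2}\binom{p_1}{\frac{p_1+r}2}\binom{p_2}{\frac{p_2+r}2-s}\Big]$$ (for $p_1=p_2=0$, $C_2'$ is understood with the last two terms equal to $0$, and the $C_1(p_1-1,p_2-1)$ term is $0$ whenever $p_1p_2=0$). *)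

theory Defs
  imports "HOL-Analysis.Analysis"
begin

definition dA :: "complex measure" where
  "dA = density lborel (\<lambda>_. ennreal (1 / pi))"

definition omegaH :: "real \<Rightarrow> complex \<Rightarrow> real" where
  "omegaH \<tau> z = exp (- ((cmod z)\<^sup>2 - \<tau> * Re (z\<^sup>2)) / (1 - \<tau>\<^sup>2))"

definition densC :: "real \<Rightarrow> nat \<Rightarrow> (nat \<Rightarrow> complex) \<Rightarrow> real" where
  "densC \<tau> N z = (\<Prod>j<N. \<Prod>k\<in>{j<..<N}. (cmod (z j - z k))\<^sup>2) * (\<Prod>j<N. omegaH \<tau> (z j))"

definition densH :: "real \<Rightarrow> nat \<Rightarrow> (nat \<Rightarrow> complex) \<Rightarrow> real" where
  "densH \<tau> N z = (\<Prod>j<N. \<Prod>k\<in>{j<..<N}. (cmod (z j - z k))\<^sup>2 * (cmod (z j - cnj (z k)))\<^sup>2)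
      * (\<Prod>j<N. (cmod (z j - cnj (z j)))\<^sup>2 * omegaH \<tau> (z j))"

definition moment :: "((nat \<Rightarrow> complex) \<Rightarrow> real) \<Rightarrow> nat \<Rightarrow> nat \<Rightarrow> nat \<Rightarrow> complex" where
  "moment dens p1 p2 N =
     (\<integral>z. complex_of_real (dens z) * (\<Sum>j<N. z j ^ p1 * cnj (z j) ^ p2) \<partial>(PiM {..<N} (\<lambda>_. dA)))
     / complex_of_real (\<integral>z. dens z \<partial>(PiM {..<N} (\<lambda>_. dA)))"

definition MC :: "real \<Rightarrow> nat \<Rightarrow> nat \<Rightarrow> nat \<Rightarrow> complex" where
  "MC \<tau> p1 p2 N = moment (densC \<tau> N) p1 p2 N"

definition MH :: "real \<Rightarrow> nat \<Rightarrow> nat \<Rightarrow> nat \<Rightarrow> complex" where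
  "MH \<tau> p1 p2 N = moment (densH \<tau> N) p1 p2 N"

definition Iset :: "nat \<Rightarrow> int set" where
  "Iset p = {r. - int p \<le> r \<and> r \<le> int p \<and> even (r + int p)}"

definition binomZ :: "nat \<Rightarrow> int \<Rightarrow> real" where
  "binomZ n k = (if 0 \<le> k \<and> k \<le> int n then real (n choose nat k) else 0)"

definition C1 :: "real \<Rightarrow> nat \<Rightarrow> nat \<Rightarrow> real" where
  "C1 \<tau> p1 p2 = 1 / (real (p1 + p2) / 2 + 1) *
     (\<Sum>r\<in>Iset (min p1 p2). \<tau> powi ((int p1 + int p2) div 2 + r)
        * binomZ p1 ((int p1 + r) div 2) * binomZ p2 ((int p2 + r) div 2))"

definition C2 :: "real \<Rightarrow> nat \<Rightarrow> nat \<Rightarrow> real" where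
  "C2 \<tau> p1 p2 = - (\<Sum>r\<in>Iset (min p1 p2). \<tau> powi ((int p1 + int p2) div 2 + r)
        * binomZ p1 ((int p1 + r) div 2) * binomZ p2 ((int p2 + r) div 2) * (real_of_int r / 2))"

definition C2' :: "real \<Rightarrow> nat \<Rightarrow> nat \<Rightarrow> real" where
  "C2' \<tau> p1 p2 =
     (if p1 = 0 \<and> p2 = 0 then C2 \<tau> p1 p2 / 2
      else C2 \<tau> p1 p2 / 2
        + (if p1 * p2 = 0 then 0
           else (1 - \<tau>\<^sup>2) / 2 * (real (p1 * p2) / real (p1 + p2)) * C1 \<tau> (p1 - 1) (p2 - 1))
        - 1 / 2 * (\<Sum>r\<in>Iset (max p1 p2). \<Sum>s\<in>{1..max p1 p2}.
             \<tau> powi ((int p1 + int p2) div 2 + r - int s) *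
             (real p1 / real (p1 + p2) * binomZ p1 ((int p1 + r) div 2 - int s) * binomZ p2 ((int p2 + r) div 2)
              + real p2 / real (p1 + p2) * binomZ p1 ((int p1 + r) div 2) * binomZ p2 ((int p2 + r) div 2 - int s))))"

end

theory Submission
  imports Defs "HOL-Probability.Distributions" "Jordan_Normal_Form.Determinant"
begin

hide_const (open) Module.smult

text \<open>Expanding Vandermonde determinants turns both integrals into sums over permutations. For the first one, the monic Hermite
  polynomials \<open>hp n\<close> are orthogonal with norms proportional to \<open>n!\<close>, so the moment is the truncated
  trace of a polynomial in ladder operators, and a lattice path expansion shows that its summands are
  polynomials in the level. For the second one, \<open>z - cnj z\<close> acts on Hermite polynomials
  as a multiple of the first order operator \<open>dop\<close>, and commuting \<open>dop\<close> past powers of \<open>z\<close> in two ways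
  expresses the \<open>(p1, p2)\<close> moment of \<open>N\<close> points by half of the moment of \<open>2N\<close> points under the first density, a boundary
  term at level \<open>2N\<close>, and the \<open>(p1 - 1, p2 - 1)\<close> moment.\<close>

section \<open>Gaussian moments\<close>

text \<open>With the points listed in conjugate pairs, the second density is one Vandermonde product
  in \<open>2 * N\<close> variables times one leftover factor \<open>z - cnj z\<close> per point. It
  is therefore governed by an alternating form, and levels run up to \<open>2 * N\<close>. With
  \<open>d = (p1 + p2) / 2\<close>, half of a sum over \<open>2 * N\<close> levels is of size
  \<open>2 ^ d * N ^ (d + 1)\<close>: this explains the power of 2 in (ii), the unchanged
  \<open>C1\<close> and the half of \<open>C2\<close> in \<open>C2'\<close>. The obstacle is that
  commuting \<open>dop\<close> past \<open>z ^ p1\<close> leaves correction sums over all pairs of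
  levels. Weighting the two versions of the identity by \<open>p2\<close> and \<open>p1\<close>
  groups these sums into a \<open>(p1 - 1, p2 - 1)\<close> moment, and the weights
  \<open>p1 / (p1 + p2)\<close> and \<open>p2 / (p1 + p2)\<close> of \<open>C2'\<close> come from
  there. The boundary term pairs level \<open>2 * N\<close> with a skew-orthogonal polynomial spread
  over all lower even levels; only the nearest \<open>d\<close> of them are within reach, and all of
  these contribute at the same order, which yields the sum over \<open>s\<close> in
  \<open>C2'\<close>.\<close>

definition gauss_moment :: "real \<Rightarrow> nat \<Rightarrow> real" where
  "gauss_moment s n = (\<integral>x. x ^ n * exp (- (x\<^sup>2 / s)) \<partial>lborel)"

text \<open>Up to a constant the integrand is a power times the centred normal density of variance
  \<open>s / 2\<close>, so everything is read off the even and odd normal moments. The recursion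
  later serves as integration by parts; at \<open>n = 0\<close> the truncated \<open>n - 1\<close>
  is multiplied by 0.\<close>

lemma
  assumes s: "s > 0"
  shows integrable_gauss: "integrable lborel (\<lambda>x::real. x ^ n * exp (- (x\<^sup>2 / s)))" (is ?A)
    and gauss_moment_Suc: "gauss_moment s (Suc n) = s / 2 * real n * gauss_moment s (n - 1)" (is ?B)
    and gauss_moment_0: "gauss_moment s 0 > 0" (is ?C)
proof -
  define \<sigma> where "\<sigma> = sqrt (s / 2)"
  have \<sigma>: "\<sigma> > 0" and \<sigma>2: "2 * \<sigma>\<^sup>2 = s" using s by (auto simp: \<sigma>_def)
  define c where "c = sqrt (pi * s)"
  have c: "c > 0" using s by (simp add: c_def)
  have e: "2 * pi * \<sigma>\<^sup>2 = pi * s" using \<sigma>2 by simp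
  have dens: "x ^ n * exp (- (x\<^sup>2 / s)) = c * (normal_density 0 \<sigma> x * (x - 0) ^ n)" for x n
    using s unfolding normal_density_def e \<sigma>2 by (simp add: c_def)
  have even: "has_bochner_integral lborel (\<lambda>x. x ^ (2 * k) * exp (- (x\<^sup>2 / s)))
      (c * (fact (2 * k) / ((2 / \<sigma>\<^sup>2) ^ k * fact k)))" for k
    unfolding dens using normal_moment_even[OF \<sigma>, of 0 k] by (intro has_bochner_integral_mult_right) auto
  have odd: "has_bochner_integral lborel (\<lambda>x. x ^ (2 * k + 1) * exp (- (x\<^sup>2 / s))) 0" for k
    unfolding dens using has_bochner_integral_mult_right[of c, OF normal_moment_odd[OF \<sigma>, of 0 k]] by simp
  have cases: "\<exists>k. n = 2 * k \<or> n = 2 * k + 1" for n :: nat by presburger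
  obtain k where "n = 2 * k \<or> n = 2 * k + 1" using cases by blast
  then show ?A
    using integrable.intros[OF even[of k]] integrable.intros[OF odd[of k]] by (elim disjE) simp_all
  have ge: "gauss_moment s (2 * k) = c * (fact (2 * k) / ((2 / \<sigma>\<^sup>2) ^ k * fact k))" for k
    unfolding gauss_moment_def by (rule has_bochner_integral_integral_eq[OF even])
  have go: "gauss_moment s (2 * k + 1) = 0" for k
    unfolding gauss_moment_def by (rule has_bochner_integral_integral_eq[OF odd])
  show ?C using ge[of 0] c by simp
  show ?B
  proof (cases "even n")
    case True
    then obtain k where n: "n = 2 * k" by (elim evenE)
    show ?thesis
    proof (cases k)
      case 0
      then show ?thesis using go[of 0] n by simp
    next
      case (Suc j)
      then have "n - 1 = 2 * j + 1" using n by simp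
      then show ?thesis using go[of k] go[of j] n by simp
    qed
  next
    case False
    then obtain k where n: "n = 2 * k + 1" by (elim oddE)
    have S: "Suc n = 2 * Suc k" "n - 1 = 2 * k" using n by auto
    have "gauss_moment s (Suc n) = c * (fact (2 * Suc k) / ((2 / \<sigma>\<^sup>2) ^ Suc k * fact (Suc k)))"
      unfolding S ge ..
    also have "\<dots> = \<sigma>\<^sup>2 * real (2 * k + 1) * (c * (fact (2 * k) / ((2 / \<sigma>\<^sup>2) ^ k * fact k)))"
    proof -
      have "fact (2 * Suc k) = 2 * real (Suc k) * real (2 * k + 1) * fact (2 * k)" by simp
      moreover have "fact (Suc k) = real (Suc k) * fact k" by simp
      ultimately show ?thesis using \<sigma> by (simp add: field_simps del: of_nat_Suc fact_Suc)
    qed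
    also have "\<dots> = s / 2 * real n * gauss_moment s (n - 1)"
      unfolding S(2) ge by (simp add: n \<sigma>2[symmetric])
    finally show ?thesis .
  qed
qed

text \<open>\<open>lborel\<close> on \<open>complex\<close> is the image of a product measure
  indexed by \<open>Basis\<close>, here \<open>{1, \<i>}\<close>, so this is Fubini once the
  integrand is written as a product over the two basis vectors.\<close>

lemma
  fixes f g :: "real \<Rightarrow> 'b :: {real_normed_field, banach, second_countable_topology}"
  assumes f: "integrable lborel f" and g: "integrable lborel g"
  shows integrable_complex_prod: "integrable lborel (\<lambda>z. f (Re z) * g (Im z))" (is ?A)
    and integral_complex_prod:
      "(\<integral>z. f (Re z) * g (Im z) \<partial>lborel) = (\<integral>x. f x \<partial>lborel) * (\<integral>y. g y \<partial>lborel)" (is ?B)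
proof -
  interpret product_sigma_finite "\<lambda>b::complex. interval_measure (\<lambda>x. x)"
    unfolding lborel_eq_real[symmetric] by unfold_locales
  define T :: "(complex \<Rightarrow> real) \<Rightarrow> complex" where "T = (\<lambda>h. \<Sum>b\<in>Basis. h b *\<^sub>R b)"
  define P where "P = (\<Pi>\<^sub>M b\<in>(Basis::complex set). interval_measure (\<lambda>x. x))"
  have lb: "lborel = distr P borel T" unfolding P_def T_def lborel_def ..
  have T[measurable]: "T \<in> measurable P borel"
    unfolding P_def T_def by measurable
  define h where "h = (\<lambda>b::complex. if b = 1 then f else g)"
  have B: "Basis = {1, \<i>}" "finite (Basis :: complex set)" by (auto simp: Basis_complex_def)
  have eq: "f (Re (T x)) * g (Im (T x)) = (\<Prod>b\<in>Basis. h b (x b))" for x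
    by (simp add: T_def B h_def Basis_complex_def)
  have int: "integrable (interval_measure (\<lambda>x. x)) (h b)" for b
    using f g by (simp add: h_def lborel_eq_real[symmetric])
  have [measurable]: "f \<in> borel_measurable borel" "g \<in> borel_measurable borel"
    using f g by auto
  show ?A unfolding lb
    by (subst integrable_distr_eq) (use T in \<open>auto simp: eq P_def intro!: product_integrable_prod int\<close>)
  show ?B unfolding lb
    by (subst integral_distr)
       (use T in \<open>auto simp: eq P_def product_integral_prod int\<close>, simp add: Basis_complex_def h_def lborel_eq_real)
qed

text \<open>\<open>rpoly f fx fy\<close>: \<open>f\<close> is a polynomial in \<open>Re z\<close> and \<open>Im z\<close> with partial derivatives \<open>fx\<close> and \<open>fy\<close>.\<close>

inductive rpoly :: "(complex \<Rightarrow> complex) \<Rightarrow> (complex \<Rightarrow> complex) \<Rightarrow> (complex \<Rightarrow> complex) \<Rightarrow> bool" where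
  mono: "rpoly (\<lambda>z. of_real (Re z ^ i * Im z ^ j))
     (\<lambda>z. of_nat i * of_real (Re z ^ (i - 1) * Im z ^ j))
     (\<lambda>z. of_nat j * of_real (Re z ^ i * Im z ^ (j - 1)))"
| lin: "rpoly f fx fy \<Longrightarrow> rpoly g gx gy \<Longrightarrow>
     rpoly (\<lambda>z. f z + c * g z) (\<lambda>z. fx z + c * gx z) (\<lambda>z. fy z + c * gy z)"

lemma rpoly_cong:
  "rpoly f fx fy \<Longrightarrow> (\<And>z. f z = g z) \<Longrightarrow> (\<And>z. fx z = gx z) \<Longrightarrow> (\<And>z. fy z = gy z) \<Longrightarrow> rpoly g gx gy"
  by (metis (full_types) ext)

text \<open>The instances \<open>c = \<i>\<close> and \<open>c = - \<i>\<close> are multiplication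
  by \<open>z\<close> and by \<open>cnj z\<close>, from which all \<open>z ^ a * cnj z ^ b\<close>
  are built.\<close>

lemma rpoly_linear_factor:
  assumes "rpoly f fx fy"
  shows "rpoly (\<lambda>z. (of_real (Re z) + c * of_real (Im z)) * f z)
     (\<lambda>z. f z + (of_real (Re z) + c * of_real (Im z)) * fx z)
     (\<lambda>z. c * f z + (of_real (Re z) + c * of_real (Im z)) * fy z)"
  using assms
proof induction
  case (mono i j)
  have e1: "(\<lambda>z. (of_real (Re z) + c * of_real (Im z)) * of_real (Re z ^ i * Im z ^ j))
     = (\<lambda>z. of_real (Re z ^ Suc i * Im z ^ j) + c * of_real (Re z ^ i * Im z ^ Suc j))"
    by (simp add: fun_eq_iff algebra_simps)
  have e2: "(\<lambda>z. of_real (Re z ^ i * Im z ^ j)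
         + (of_real (Re z) + c * of_real (Im z)) * (of_nat i * of_real (Re z ^ (i - 1) * Im z ^ j)))
     = (\<lambda>z. of_nat (Suc i) * of_real (Re z ^ (Suc i - 1) * Im z ^ j)
         + c * (of_nat i * of_real (Re z ^ (i - 1) * Im z ^ Suc j)))"
    by (cases i) (simp_all add: fun_eq_iff algebra_simps)
  have e3: "(\<lambda>z. c * of_real (Re z ^ i * Im z ^ j)
         + (of_real (Re z) + c * of_real (Im z)) * (of_nat j * of_real (Re z ^ i * Im z ^ (j - 1))))
     = (\<lambda>z. of_nat j * of_real (Re z ^ Suc i * Im z ^ (j - 1))
         + c * (of_nat (Suc j) * of_real (Re z ^ i * Im z ^ (Suc j - 1))))"
    by (cases j) (simp_all add: fun_eq_iff algebra_simps)
  show ?case unfolding e1 e2 e3 by (rule rpoly.lin[OF rpoly.mono rpoly.mono])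
next
  case (lin f fx fy g gx gy d)
  show ?case
    by (rule rpoly_cong[OF rpoly.lin[OF lin.IH, of d]]) (simp_all add: algebra_simps)
qed

text \<open>The Wirtinger rules: the derivative along \<open>Re z\<close> is the sum of those in
  \<open>z\<close> and \<open>cnj z\<close>, and the derivative along \<open>Im z\<close> is
  \<open>\<i>\<close> times their difference.\<close>

lemma rpoly_power_cnj_power:
  "rpoly (\<lambda>z. z ^ a * cnj z ^ b)
     (\<lambda>z. of_nat a * (z ^ (a - 1) * cnj z ^ b) + of_nat b * (z ^ a * cnj z ^ (b - 1)))
     (\<lambda>z. \<i> * (of_nat a * (z ^ (a - 1) * cnj z ^ b) - of_nat b * (z ^ a * cnj z ^ (b - 1))))"
proof (induction a)
  case 0
  show ?case
  proof (induction b)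
    case 0
    show ?case using rpoly.mono[of 0 0] by simp
  next
    case (Suc b)
    have cn: "complex_of_real (Re z) - \<i> * complex_of_real (Im z) = cnj z" for z
      by (simp add: complex_eq_iff)
    show ?case
      by (rule rpoly_cong[OF rpoly_linear_factor[OF Suc, of "- \<i>"]]; cases b)
         (simp_all add: cn algebra_simps)
  qed
next
  case (Suc a)
  have cn: "complex_of_real (Re z) + \<i> * complex_of_real (Im z) = z" for z
    by (simp add: complex_eq_iff)
  show ?case
    by (rule rpoly_cong[OF rpoly_linear_factor[OF Suc, of "\<i>"]]; cases a)
       (simp_all add: cn algebra_simps)
qed

lemma sigma_finite_dA: "sigma_finite_measure dA"
  unfolding dA_def by (subst sigma_finite_measure.sigma_finite_iff_density_finite[OF sigma_finite_lborel]) auto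

lemma sets_dA[measurable_cong, simp]: "sets dA = sets borel"
  by (simp add: dA_def)

lemma integrable_dA: "integrable lborel f \<Longrightarrow> integrable dA f" for f :: "complex \<Rightarrow> complex"
  unfolding dA_def by (subst integrable_density) auto

lemma integral_dA: "f \<in> borel_measurable borel \<Longrightarrow> integral\<^sup>L dA f = integral\<^sup>L lborel f / pi"
  for f :: "complex \<Rightarrow> complex"
  unfolding dA_def by (subst integral_density) (auto simp: scaleR_conv_of_real)

section \<open>The elliptic Gaussian weight and its mixed moments\<close>

locale elliptic_weight =
  fixes \<tau> :: real
  assumes tau_nonneg: "0 \<le> \<tau>" and tau_less_1: "\<tau> < 1"
begin

definition wint :: "(complex \<Rightarrow> complex) \<Rightarrow> complex" where
  "wint f = (\<integral>z. f z * of_real (omegaH \<tau> z) \<partial>dA)"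

definition wintegrable :: "(complex \<Rightarrow> complex) \<Rightarrow> bool" where
  "wintegrable f \<longleftrightarrow> integrable dA (\<lambda>z. f z * of_real (omegaH \<tau> z))"

text \<open>Since \<open>1 - \<tau>\<^sup>2 = (1 + \<tau>) * (1 - \<tau>)\<close>, real and
  imaginary part decouple, with variances \<open>(1 + \<tau>) / 2\<close> and
  \<open>(1 - \<tau>) / 2\<close>.\<close>

lemma omegaH_eq: "omegaH \<tau> z = exp (- ((Re z)\<^sup>2 / (1 + \<tau>))) * exp (- ((Im z)\<^sup>2 / (1 - \<tau>)))"
proof -
  have "1 - \<tau>\<^sup>2 = (1 + \<tau>) * (1 - \<tau>)" "1 + \<tau> \<noteq> 0" "1 - \<tau> \<noteq> 0"
    using tau_nonneg tau_less_1 by (auto simp: power2_eq_square algebra_simps)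
  then have "- ((cmod z)\<^sup>2 - \<tau> * Re (z\<^sup>2)) / (1 - \<tau>\<^sup>2) = - ((Re z)\<^sup>2 / (1 + \<tau>)) + - ((Im z)\<^sup>2 / (1 - \<tau>))"
    by (simp add: divide_simps cmod_power2) (simp add: algebra_simps power2_eq_square)
  then show ?thesis unfolding omegaH_def exp_add[symmetric] by simp
qed

lemma
  shows wintegrable_mono: "wintegrable (\<lambda>z. of_real (Re z ^ i * Im z ^ j))"
    and wint_mono: "wint (\<lambda>z. of_real (Re z ^ i * Im z ^ j))
          = of_real (gauss_moment (1 + \<tau>) i * gauss_moment (1 - \<tau>) j / pi)"
proof -
  have s: "1 + \<tau> > 0" "1 - \<tau> > 0" using tau_nonneg tau_less_1 by auto
  note i = integrable_gauss[OF s(1), of i] integrable_gauss[OF s(2), of j]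
  have eq: "(\<lambda>z. complex_of_real (Re z ^ i * Im z ^ j) * of_real (omegaH \<tau> z))
     = (\<lambda>z. of_real ((Re z ^ i * exp (- ((Re z)\<^sup>2 / (1 + \<tau>)))) * (Im z ^ j * exp (- ((Im z)\<^sup>2 / (1 - \<tau>))))))"
    by (simp add: fun_eq_iff omegaH_eq)
  note A = integrable_complex_prod[OF i] integral_complex_prod[OF i]
  show "wintegrable (\<lambda>z. of_real (Re z ^ i * Im z ^ j))"
    unfolding wintegrable_def eq by (rule integrable_dA[OF integrable_of_real[OF A(1)]])
  show "wint (\<lambda>z. of_real (Re z ^ i * Im z ^ j))
          = of_real (gauss_moment (1 + \<tau>) i * gauss_moment (1 - \<tau>) j / pi)"
    unfolding wint_def eq
    by (subst integral_dA, measurable)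
       (simp only: integral_of_real[OF A(1)] A(2) gauss_moment_def of_real_divide)
qed

lemma wint_add: "wintegrable f \<Longrightarrow> wintegrable g \<Longrightarrow> wint (\<lambda>z. f z + g z) = wint f + wint g"
  unfolding wint_def wintegrable_def distrib_right by (rule Bochner_Integration.integral_add)

lemma wintegrable_add: "wintegrable f \<Longrightarrow> wintegrable g \<Longrightarrow> wintegrable (\<lambda>z. f z + g z)"
  unfolding wint_def wintegrable_def distrib_right by (rule Bochner_Integration.integrable_add)

lemma wint_cmult: "wint (\<lambda>z. c * f z) = c * wint f"
  unfolding wint_def mult.assoc by (cases "c = 0") auto

lemma wintegrable_cmult: "wintegrable f \<Longrightarrow> wintegrable (\<lambda>z. c * f z)"
  unfolding wintegrable_def mult.assoc by auto

text \<open>Gaussian integration by parts in each coordinate. On monomials it is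
  \<open>gauss_moment_Suc\<close>, and it extends linearly; the integrability claims ride along
  because additivity of \<open>wint\<close> asks for them.\<close>

lemma rpoly_weight:
  assumes "rpoly f fx fy"
  shows "wintegrable f \<and> wintegrable fx \<and> wintegrable fy
    \<and> wintegrable (\<lambda>z. of_real (Re z) * f z) \<and> wintegrable (\<lambda>z. of_real (Im z) * f z)
    \<and> wint (\<lambda>z. of_real (Re z) * f z) = (1 + \<tau>) / 2 * wint fx
    \<and> wint (\<lambda>z. of_real (Im z) * f z) = (1 - \<tau>) / 2 * wint fy"
  using assms
proof induction
  case (mono i j)
  have s: "1 + \<tau> > 0" "1 - \<tau> > 0" using tau_nonneg tau_less_1 by auto
  have e: "(\<lambda>z. of_real (Re z) * complex_of_real (Re z ^ i * Im z ^ j)) = (\<lambda>z. of_real (Re z ^ Suc i * Im z ^ j))"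
    "(\<lambda>z. of_real (Im z) * complex_of_real (Re z ^ i * Im z ^ j)) = (\<lambda>z. of_real (Re z ^ i * Im z ^ Suc j))"
    by (auto simp: fun_eq_iff)
  show ?case unfolding e wint_cmult wint_mono
    by (intro conjI wintegrable_cmult wintegrable_mono)
       (simp_all add: gauss_moment_Suc[OF s(1)] gauss_moment_Suc[OF s(2)])
next
  case (lin f fx fy g gx gy c)
  have e: "(\<lambda>z. of_real (Re z) * (f z + c * g z)) = (\<lambda>z. of_real (Re z) * f z + c * (of_real (Re z) * g z))"
    "(\<lambda>z. of_real (Im z) * (f z + c * g z)) = (\<lambda>z. of_real (Im z) * f z + c * (of_real (Im z) * g z))"
    by (auto simp: fun_eq_iff algebra_simps)
  show ?case unfolding e using lin.IH
    by (simp only: wint_add wint_cmult wintegrable_add wintegrable_cmult) (simp add: distrib_left mult.left_commute)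
qed

definition mom :: "nat \<Rightarrow> nat \<Rightarrow> complex" where
  "mom a b = wint (\<lambda>z. z ^ a * cnj z ^ b)"

lemma wintegrable_power_cnj_power: "wintegrable (\<lambda>z. z ^ a * cnj z ^ b)"
  using rpoly_weight[OF rpoly_power_cnj_power] by blast

text \<open>Integration by parts for \<open>z\<close> and for \<open>cnj z\<close>. For
  \<open>z\<close>, the derivative in \<open>z\<close> receives
  \<open>(1 + \<tau>) / 2 - (1 - \<tau>) / 2 = \<tau>\<close> and the one in \<open>cnj z\<close>
  receives \<open>(1 + \<tau>) / 2 + (1 - \<tau>) / 2 = 1\<close>; for \<open>cnj z\<close> the
  roles are exchanged.\<close>

lemma
  shows mom_Suc_left: "mom (Suc a) b = of_nat b * mom a (b - 1) + of_real \<tau> * of_nat a * mom (a - 1) b"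
    and mom_Suc_right: "mom a (Suc b) = of_nat a * mom (a - 1) b + of_real \<tau> * of_nat b * mom a (b - 1)"
proof -
  let ?f = "\<lambda>z. z ^ a * cnj z ^ b"
  note R = rpoly_weight[OF rpoly_power_cnj_power[of a b]]
  have ce: "complex_of_real (Re z) + c * of_real (Im z) = (if c = \<i> then z else cnj z)" if "c = \<i> \<or> c = - \<i>" for c z
    using that by (auto simp: complex_eq_iff)
  have x: "wint (\<lambda>z. of_real (Re z) * ?f z) = (1 + \<tau>) / 2 * (of_nat a * mom (a - 1) b + of_nat b * mom a (b - 1))"
    using R wintegrable_power_cnj_power
    by (simp add: wint_add wint_cmult mom_def wintegrable_cmult)
  have "wint (\<lambda>z. \<i> * (of_nat a * (z ^ (a - 1) * cnj z ^ b) - of_nat b * (z ^ a * cnj z ^ (b - 1))))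
      = \<i> * wint (\<lambda>z. of_nat a * (z ^ (a - 1) * cnj z ^ b) + (- of_nat b) * (z ^ a * cnj z ^ (b - 1)))"
    by (simp add: wint_cmult)
  also have "\<dots> = \<i> * (of_nat a * mom (a - 1) b - of_nat b * mom a (b - 1))"
    by (subst wint_add; (simp only: wint_cmult wintegrable_cmult wintegrable_power_cnj_power mom_def)?) simp
  finally have y: "wint (\<lambda>z. of_real (Im z) * ?f z) = (1 - \<tau>) / 2 * (\<i> * (of_nat a * mom (a - 1) b - of_nat b * mom a (b - 1)))"
    using R by simp
  have c: "wint (\<lambda>z. (of_real (Re z) + c * of_real (Im z)) * ?f z)
      = wint (\<lambda>z. of_real (Re z) * ?f z) + c * wint (\<lambda>z. of_real (Im z) * ?f z)" for c
  proof -
    have "wint (\<lambda>z. (of_real (Re z) + c * of_real (Im z)) * ?f z)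
       = wint (\<lambda>z. of_real (Re z) * ?f z + c * (of_real (Im z) * ?f z))"
      by (simp add: algebra_simps)
    also have "\<dots> = wint (\<lambda>z. of_real (Re z) * ?f z) + c * wint (\<lambda>z. of_real (Im z) * ?f z)"
      using R by (subst wint_add) (auto simp: wint_cmult intro!: wintegrable_cmult)
    finally show ?thesis .
  qed
  show "mom (Suc a) b = of_nat b * mom a (b - 1) + of_real \<tau> * of_nat a * mom (a - 1) b"
    using c[of \<i>] unfolding x y by (simp add: ce mom_def[of "Suc a"] mult.assoc) (simp add: field_simps)
  show "mom a (Suc b) = of_nat a * mom (a - 1) b + of_real \<tau> * of_nat b * mom a (b - 1)"
    using c[of "- \<i>"] ce[of "- \<i>"] unfolding x y
    by (simp add: mom_def[of a "Suc b"] mult_ac) (simp add: field_simps)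
qed

lemma mom_0_nonzero: "mom 0 0 \<noteq> 0"
proof -
  have s: "1 + \<tau> > 0" "1 - \<tau> > 0" using tau_nonneg tau_less_1 by auto
  show ?thesis using wint_mono[of 0 0] gauss_moment_0[OF s(1)] gauss_moment_0[OF s(2)]
    by (simp add: mom_def)
qed

end

section \<open>Hermite polynomials and skew-orthogonality\<close>

lemma poly_additive_induct [case_names add monom]:
  assumes add: "\<And>p q. P p \<Longrightarrow> P q \<Longrightarrow> P (p + q)" and monom: "\<And>c n. P (monom c n)"
  shows "P (p :: 'a :: comm_monoid_add poly)"
proof -
  have "P (\<Sum>i\<le>m. monom (coeff p i) i)" for m
    by (induction m) (auto intro: add monom)
  then show ?thesis using poly_as_sum_of_monoms[of p] by metis
qed

definition XX :: "complex poly" where "XX = [:0, 1:]"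

lemma pderiv_XX [simp]: "pderiv XX = 1"
  by (simp add: XX_def pderiv_pCons)

lemma poly_XX [simp]: "poly XX z = z"
  by (simp add: XX_def)

lemma degree_XX [simp]: "degree XX = 1" and XX_neq_0 [simp]: "XX \<noteq> 0"
  and coeff_XX [simp]: "coeff XX (Suc 0) = 1"
  by (simp_all add: XX_def)

lemma coeff_XX_mult: "coeff (XX * p) (Suc n) = coeff p n"
  by (simp add: XX_def)

context elliptic_weight
begin

lemma wintegrable_monoms: "wintegrable (\<lambda>z. poly (monom c a) z * poly (monom d b) (cnj z))"
proof -
  have "(\<lambda>z. poly (monom c a) z * poly (monom d b) (cnj z)) = (\<lambda>z. (c * d) * (z ^ a * cnj z ^ b))"
    by (simp add: poly_monom fun_eq_iff)
  then show ?thesis using wintegrable_cmult[OF wintegrable_power_cnj_power] by metis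
qed

lemma wintegrable_polys: "wintegrable (\<lambda>z. poly u z * poly v (cnj z))"
proof (induction u rule: poly_additive_induct)
  case (add p q)
  then show ?case using wintegrable_add[OF add] by (simp add: distrib_right)
next
  case (monom c n)
  show ?case
  proof (induction v rule: poly_additive_induct)
    case (add p q)
    then show ?case using wintegrable_add[OF add] by (simp add: distrib_left)
  next
    case (monom d m)
    show ?case by (rule wintegrable_monoms)
  qed
qed

text \<open>The second argument is evaluated at \<open>cnj z\<close> without conjugating its
  coefficients, so the form is bilinear and, by \<open>ip_commute\<close>, symmetric. Dividing by
  \<open>mom 0 0\<close> makes \<open>ip 1 1 = 1\<close>.\<close>

definition ip :: "complex poly \<Rightarrow> complex poly \<Rightarrow> complex" where
  "ip u v = wint (\<lambda>z. poly u z * poly v (cnj z)) / mom 0 0"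

lemma ip_add_left: "ip (u + u') v = ip u v + ip u' v"
  using wint_add[OF wintegrable_polys[of u v] wintegrable_polys[of u' v]]
  by (simp add: ip_def distrib_right add_divide_distrib)

lemma ip_add_right: "ip u (v + v') = ip u v + ip u v'"
  using wint_add[OF wintegrable_polys[of u v] wintegrable_polys[of u v']]
  by (simp add: ip_def distrib_left add_divide_distrib)

lemma ip_smult_left: "ip (smult c u) v = c * ip u v"
  using wint_cmult[of c "\<lambda>z. poly u z * poly v (cnj z)"] by (simp add: ip_def mult.assoc)

lemma ip_smult_right: "ip u (smult c v) = c * ip u v"
  using wint_cmult[of c "\<lambda>z. poly u z * poly v (cnj z)"] by (simp add: ip_def mult.assoc mult.left_commute)

lemma ip_minus_left: "ip (- u) v = - ip u v"
  using ip_smult_left[of "-1" u v] by simp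

lemma ip_minus_right: "ip u (- v) = - ip u v"
  using ip_smult_right[of u "-1" v] by simp

lemma ip_diff_left: "ip (u - u') v = ip u v - ip u' v"
  using ip_add_left[of u "- u'" v] by (simp add: ip_minus_left)

lemma ip_diff_right: "ip u (v - v') = ip u v - ip u v'"
  using ip_add_right[of u v "- v'"] by (simp add: ip_minus_right)

lemma ip_0_left [simp]: "ip 0 v = 0"
  using ip_smult_left[of 0 0 v] by simp

lemma ip_0_right [simp]: "ip u 0 = 0"
  using ip_smult_right[of u 0 0] by simp

lemma ip_sum_left: "ip (\<Sum>i\<in>A. f i) v = (\<Sum>i\<in>A. ip (f i) v)"
  by (induction A rule: infinite_finite_induct) (auto simp: ip_add_left)

lemma ip_sum_right: "ip u (\<Sum>i\<in>A. f i) = (\<Sum>i\<in>A. ip u (f i))"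
  by (induction A rule: infinite_finite_induct) (auto simp: ip_add_right)

lemmas ip_linear = ip_add_left ip_add_right ip_smult_left ip_smult_right
  ip_diff_left ip_diff_right ip_minus_left ip_minus_right

lemma ip_monom: "ip (monom c a) (monom d b) = c * d * mom a b / mom 0 0"
proof -
  have "(\<lambda>z. poly (monom c a) z * poly (monom d b) (cnj z)) = (\<lambda>z. (c * d) * (z ^ a * cnj z ^ b))"
    by (simp add: poly_monom fun_eq_iff)
  then show ?thesis by (simp add: ip_def mom_def wint_cmult)
qed

lemma mom_commute: "mom a b = mom b a"
proof (induction "a + b" arbitrary: a b rule: less_induct)
  case less
  show ?case
  proof (cases a)
    case 0
    show ?thesis
    proof (cases b)
      case (Suc b')
      then show ?thesis using less[of 0 "b' - 1"] 0
        unfolding Suc 0 mom_Suc_left[of b' 0] mom_Suc_right[of 0 b'] by simp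
    qed (simp add: 0)
  next
    case (Suc a')
    then show ?thesis using less[of a' "b - 1"] less[of "a' - 1" b]
      unfolding Suc mom_Suc_left mom_Suc_right by simp
  qed
qed

lemma ip_commute: "ip u v = ip v u"
proof (induction u rule: poly_additive_induct)
  case (monom c n)
  show ?case
    by (induction v rule: poly_additive_induct) (auto simp: ip_linear ip_monom mom_commute)
qed (simp add: ip_linear)

text \<open>The adjoint of multiplication by \<open>cnj z\<close>: eliminating the
  \<open>mom n (m - 1)\<close> terms between the two moment recursions leaves \<open>\<tau>\<close>
  times multiplication by \<open>z\<close> plus \<open>1 - \<tau>\<^sup>2\<close> times the
  derivative.\<close>

lemma ip_mult_XX_right:
  "ip u (XX * v) = ip (smult (of_real \<tau>) (XX * u) + smult (of_real (1 - \<tau>\<^sup>2)) (pderiv u)) v"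
proof (induction u rule: poly_additive_induct)
  case (add p q)
  then show ?case by (simp add: ip_linear pderiv_add distrib_left)
next
  case (monom c n)
  show ?case
  proof (induction v rule: poly_additive_induct)
    case (add p q)
    then show ?case by (simp add: ip_linear distrib_left)
  next
    case (monom d m)
    have X: "XX * monom c n = monom c (Suc n)" for c n
      by (simp add: monom_Suc XX_def)
    have e: "mom n (Suc m) = of_real \<tau> * mom (Suc n) m + of_real (1 - \<tau>\<^sup>2) * of_nat n * mom (n - 1) m"
      unfolding mom_Suc_left mom_Suc_right by (simp add: algebra_simps power2_eq_square)
    show ?case unfolding X pderiv_monom ip_linear ip_monom e
      by (simp add: algebra_simps add_divide_distrib diff_divide_distrib)
  qed
qed

text \<open>For \<open>\<tau> > 0\<close> these are the probabilists' Hermite polynomials He_n at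
  \<open>x / sqrt \<tau>\<close>, rescaled by \<open>\<tau>\<close> to the power
  \<open>n / 2\<close>. The recurrence also covers \<open>\<tau> = 0\<close>, where they are the
  monomials.\<close>

fun hp :: "nat \<Rightarrow> complex poly" where
  "hp 0 = 1"
| "hp (Suc 0) = XX"
| "hp (Suc (Suc n)) = XX * hp (Suc n) - smult (of_real \<tau> * of_nat (Suc n)) (hp n)"

lemma XX_mult_hp: "XX * hp n = hp (Suc n) + smult (of_real \<tau> * of_nat n) (hp (n - 1))"
  by (cases n) simp_all

lemma pderiv_hp: "pderiv (hp n) = smult (of_nat n) (hp (n - 1))"
proof (induction n rule: hp.induct)
  case (3 n)
  have "pderiv (hp (Suc (Suc n))) = hp (Suc n) + smult (of_nat (Suc n)) (XX * hp n)
      - smult (of_real \<tau> * of_nat (Suc n) * of_nat n) (hp (n - 1))"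
    using 3 by (simp add: pderiv_diff pderiv_mult pderiv_smult del: of_nat_Suc)
  also have "\<dots> = smult (of_nat (Suc (Suc n))) (hp (Suc n))"
    unfolding XX_mult_hp by (rule poly_eqI) (simp add: algebra_simps del: hp.simps)
  finally show ?case by simp
qed simp_all

lemma hp_monic: "degree (hp n) = n \<and> lead_coeff (hp n) = 1"
proof (induction n rule: hp.induct)
  case (3 n)
  have d: "degree (XX * hp (Suc n)) = Suc (Suc n)"
    using 3 by (subst degree_mult_eq) auto
  have "degree (smult (of_real \<tau> * of_nat (Suc n)) (hp n)) < degree (XX * hp (Suc n))"
    unfolding d using degree_smult_le[of "of_real \<tau> * of_nat (Suc n)" "hp n"] 3 by simp
  then have "degree (hp (Suc (Suc n))) = Suc (Suc n)"
    unfolding hp.simps diff_conv_add_uminus by (subst degree_add_eq_left) (auto simp: d)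
  moreover have "coeff (hp (Suc n)) (Suc n) = 1" using 3(1) by metis
  then have "coeff (hp (Suc (Suc n))) (Suc (Suc n)) = 1"
    using 3 coeff_eq_0[of "hp n" "Suc (Suc n)"] by (simp add: coeff_XX_mult)
  ultimately show ?case by simp
qed auto

text \<open>In the Hermite basis the adjoint relation becomes the recursion \<open>r1\<close>, which
  determines column \<open>k\<close> of \<open>G\<close> from columns \<open>k - 1\<close> and
  \<open>k - 2\<close>. Column 0 is settled separately in \<open>z\<close>.\<close>

lemma ip_hp: "ip (hp j) (hp k) = (if j = k then fact k else 0)"
proof -
  define G where "G j k = ip (hp j) (hp k)" for j k
  have r1: "G j (Suc k) + of_real \<tau> * of_nat k * G j (k - 1)
      = of_real \<tau> * G (Suc j) k + of_nat j * G (j - 1) k" for j k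
    using ip_mult_XX_right[of "hp j" "hp k"] unfolding XX_mult_hp pderiv_hp ip_linear G_def[symmetric]
    by (simp add: algebra_simps power2_eq_square del: hp.simps)
  have sym: "G j k = G k j" for j k unfolding G_def by (rule ip_commute)
  \<comment> \<open>Two instances of \<open>r1\<close> and the symmetry of \<open>G\<close> give
    \<open>G (Suc j) 0 = \<tau>\<^sup>2 * G (Suc j) 0\<close>.\<close>
  have z: "G (Suc j) 0 = 0" for j
  proof -
    have "G j (Suc 0) = of_real \<tau> * G (Suc j) 0 + of_nat j * G (j - 1) 0"
      using r1[of j 0] by simp
    moreover have "G (Suc j) 0 + of_real \<tau> * of_nat j * G (j - 1) 0 = of_real \<tau> * G j (Suc 0)"
      using r1[of 0 j] by (simp add: sym[of 0] sym[of "Suc 0"])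
    ultimately have "of_real (1 - \<tau>\<^sup>2) * G (Suc j) 0 = 0"
      by (simp add: algebra_simps power2_eq_square)
    moreover have "1 - \<tau>\<^sup>2 \<noteq> 0" using tau_nonneg tau_less_1 by (simp add: power2_eq_1_iff)
    ultimately show ?thesis by (metis mult_eq_0_iff of_real_eq_0_iff)
  qed
  have "G j k = (if j = k then fact k else 0)" for j
  proof (induction k arbitrary: j rule: less_induct)
    case (less k)
    show ?case
    proof (cases k)
      case 0
      have "G 0 0 = 1" using ip_monom[of 1 0 1 0] mom_0_nonzero by (simp add: G_def monom_0 one_pCons)
      then show ?thesis using z by (cases j) (auto simp: 0)
    next
      case (Suc l)
      have "G j k = of_real \<tau> * G (Suc j) l + of_nat j * G (j - 1) l - of_real \<tau> * of_nat l * G j (l - 1)"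
        using r1[of j l] by (simp add: Suc algebra_simps)
      also have "\<dots> = (if j = k then fact k else 0)"
      proof (cases l)
        case 0
        then show ?thesis using Suc less[of l] by (cases j) auto
      next
        case (Suc m)
        then have "G i l = (if i = l then fact l else 0)" "G i m = (if i = m then fact m else 0)" for i
          using less[of l] less[of m] \<open>k = Suc l\<close> by auto
        then show ?thesis using \<open>k = Suc l\<close> Suc by (cases j) (auto simp: algebra_simps)
      qed
      finally show ?thesis .
    qed
  qed
  then show ?thesis by (simp add: G_def)
qed

section \<open>The alternating form and its skew-orthogonal polynomials\<close>

definition dop :: "complex poly \<Rightarrow> complex poly" where
  "dop u = smult (of_real (1 + \<tau>)) (pderiv u) - XX * u"

text \<open>Up to the factor \<open>- mom 0 0\<close>, this is integration against the extra factor
  \<open>z - cnj z\<close> that the second density leaves over; see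
  \<open>wint_bform\<close>.\<close>

definition bform :: "complex poly \<Rightarrow> complex poly \<Rightarrow> complex" where
  "bform u v = ip u (XX * v) - ip (XX * u) v"

text \<open>By the adjoint relation the two multiplications combine to
  \<open>1 - \<tau>\<^sup>2\<close> times the derivative minus \<open>1 - \<tau>\<close> times
  \<open>XX * u\<close>; pulling out \<open>1 - \<tau>\<close> leaves \<open>dop\<close>.\<close>

lemma bform_eq_dop: "bform u v = of_real (1 - \<tau>) * ip (dop u) v"
  unfolding bform_def ip_mult_XX_right dop_def ip_linear
  by (simp add: algebra_simps power2_eq_square)

lemma bform_antisym: "bform u v = - bform v u"
  unfolding bform_def by (simp add: ip_commute)

lemma dop_linear: "dop (u + v) = dop u + dop v" "dop (smult c u) = smult c (dop u)"
  by (auto simp: dop_def pderiv_add pderiv_smult smult_add_right algebra_simps smult_diff_right)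

text \<open>The \<open>\<tau>\<close> contributions of derivative and multiplication cancel, so the
  action on Hermite polynomials is free of \<open>\<tau>\<close>.\<close>

lemma dop_hp: "dop (hp n) = smult (of_nat n) (hp (n - 1)) - hp (Suc n)"
  unfolding dop_def pderiv_hp XX_mult_hp
  by (simp add: algebra_simps smult_add_left del: hp.simps)

lemma dop_XX_power: "dop (XX ^ p * u) = XX ^ p * dop u + smult (of_real (1 + \<tau>) * of_nat p) (XX ^ (p - 1) * u)"
  unfolding dop_def
  by (simp add: pderiv_mult pderiv_power smult_add_right smult_add_left algebra_simps)

text \<open>The monic even polynomials that are skew-orthogonal for \<open>bform\<close>; \<open>dop\<close> maps them to
  single Hermite polynomials because the sum defining them telescopes.\<close>

fun skp :: "nat \<Rightarrow> complex poly" where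
  "skp 0 = 1"
| "skp (Suc k) = hp (2 * Suc k) + smult (of_nat (2 * Suc k)) (skp k)"

lemma dop_skp: "dop (skp k) = - hp (Suc (2 * k))"
proof (induction k)
  case 0
  then show ?case using dop_hp[of 0] by simp
next
  case (Suc k)
  have e: "2 * Suc k - 1 = Suc (2 * k)" by simp
  show ?case unfolding skp.simps dop_linear dop_hp e Suc by simp
qed

lemma skp_monic: "degree (skp k) = 2 * k \<and> lead_coeff (skp k) = 1"
proof (induction k)
  case (Suc k)
  have l: "degree (smult (of_nat (2 * Suc k)) (skp k)) < degree (hp (2 * Suc k))"
    using Suc hp_monic[of "2 * Suc k"] by simp
  then show ?case using hp_monic[of "2 * Suc k"] coeff_eq_0[of "skp k" "2 * Suc k"] Suc unfolding skp.simps
    by (auto simp: degree_add_eq_left simp del: hp.simps mult_Suc_right)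
qed auto

definition skq :: "nat \<Rightarrow> complex poly" where
  "skq n = (if even n then skp (n div 2) else hp n)"

lemma skq_simps [simp]: "skq (2 * k) = skp k" "skq (Suc (2 * k)) = hp (Suc (2 * k))"
  by (auto simp: skq_def)

lemma skq_monic: "degree (skq n) = n \<and> lead_coeff (skq n) = 1"
  using skp_monic[of "n div 2"] hp_monic[of n] by (auto simp: skq_def)

lemma ip_hp_odd_skp: "ip (hp (Suc (2 * k))) (skp l) = 0"
proof (induction l)
  case 0
  show ?case using ip_hp[of "Suc (2 * k)" 0] by simp
next
  case (Suc l)
  have "Suc (2 * k) \<noteq> 2 * Suc l" by presburger
  then show ?case unfolding skp.simps ip_linear ip_hp Suc by simp
qed

lemma bform_skp_hp: "bform (skp k) (hp (Suc (2 * l))) = (if k = l then - (of_real (1 - \<tau>) * fact (Suc (2 * k))) else 0)"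
  unfolding bform_eq_dop dop_skp ip_linear ip_hp by auto

lemma bform_skp_skp: "bform (skp k) (skp l) = 0"
  unfolding bform_eq_dop dop_skp ip_linear ip_hp_odd_skp by auto

lemma bform_hp_hp_odd: "bform (hp (Suc (2 * k))) (hp (Suc (2 * l))) = 0"
proof -
  have "2 * k \<noteq> Suc (2 * l)" "Suc (Suc (2 * k)) \<noteq> Suc (2 * l)" by presburger+
  then show ?thesis unfolding bform_eq_dop dop_hp ip_linear ip_hp by auto
qed

lemma bform_skq_eq_0: "a div 2 \<noteq> b div 2 \<or> a = b \<Longrightarrow> bform (skq a) (skq b) = 0"
proof -
  assume h: "a div 2 \<noteq> b div 2 \<or> a = b"
  obtain k where a: "a = 2 * k \<or> a = Suc (2 * k)" by (metis oddE Suc_eq_plus1 evenE)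
  obtain l where b: "b = 2 * l \<or> b = Suc (2 * l)" by (metis oddE Suc_eq_plus1 evenE)
  from a b h show ?thesis
    using bform_skp_hp bform_skp_skp bform_hp_hp_odd
       bform_antisym[of "hp (Suc (2 * k))" "skp l"]
    by (auto simp del: hp.simps)
qed

lemma bform_skq_nz: "bform (skq (2 * k)) (skq (Suc (2 * k))) \<noteq> 0"
  using tau_less_1 by (simp add: bform_skp_hp del: hp.simps fact_Suc)

section \<open>Skew moments and their recursion\<close>

definition level_moment :: "nat \<Rightarrow> nat \<Rightarrow> nat \<Rightarrow> complex" where
  "level_moment p1 p2 k = ip (XX ^ p1 * hp k) (XX ^ p2 * hp k) / fact k"

definition Fform :: "nat \<Rightarrow> nat \<Rightarrow> complex poly \<Rightarrow> complex poly \<Rightarrow> complex" where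
  "Fform p1 p2 u v = bform (XX ^ p1 * u) (XX ^ p2 * v)"

text \<open>The moment of the second ensemble (\<open>MH_eq\<close>), written as a trace over blocks
  \<open>{2 * k, Suc (2 * k)}\<close> of \<open>Fform\<close> antisymmetrised, relative to
  \<open>bform\<close>.\<close>

definition skew_moment :: "nat \<Rightarrow> nat \<Rightarrow> nat \<Rightarrow> complex" where
  "skew_moment p1 p2 N = (\<Sum>k<N. (Fform p1 p2 (skq (2 * k)) (skq (Suc (2 * k))) - Fform p1 p2 (skq (Suc (2 * k))) (skq (2 * k)))
     / (2 * bform (skq (2 * k)) (skq (Suc (2 * k)))))"

text \<open>Couples level \<open>2 * Suc k\<close> to the skew-orthogonal polynomial just below it;
  this is the end that survives the telescoping in \<open>skew_moment_telescoped\<close>.\<close>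

definition boundary_term :: "nat \<Rightarrow> nat \<Rightarrow> nat \<Rightarrow> complex" where
  "boundary_term p1 p2 k = ip (XX ^ p1 * hp (2 * Suc k)) (XX ^ p2 * skp k) / fact (Suc (2 * k))"

definition skew_diff_sum :: "nat \<Rightarrow> nat \<Rightarrow> nat \<Rightarrow> complex" where
  "skew_diff_sum a b N = (\<Sum>k<N. (ip (XX ^ a * skp k) (XX ^ b * hp (Suc (2 * k))) - ip (XX ^ a * hp (Suc (2 * k))) (XX ^ b * skp k))
     / fact (Suc (2 * k)))"

lemma Fform_eq: "Fform p1 p2 u v = of_real (1 - \<tau>) *
    (ip (XX ^ p1 * dop u) (XX ^ p2 * v) + of_real (1 + \<tau>) * of_nat p1 * ip (XX ^ (p1 - 1) * u) (XX ^ p2 * v))"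
  unfolding Fform_def bform_eq_dop dop_XX_power ip_linear ..

lemma skew_moment_commute: "skew_moment p1 p2 N = skew_moment p2 p1 N"
  unfolding skew_moment_def Fform_def
  by (intro sum.cong refl arg_cong2[of _ _ _ _ "(/)"])
     (simp add: bform_antisym[of "XX ^ p1 * _"])

lemma skew_diff_sum_commute: "skew_diff_sum a b N = - skew_diff_sum b a N"
  unfolding skew_diff_sum_def sum_negf[symmetric]
  by (intro sum.cong refl) (simp add: ip_commute[of "XX ^ a * _"] divide_simps)

lemma level_moment_commute: "level_moment p1 p2 k = level_moment p2 p1 k"
  unfolding level_moment_def by (simp add: ip_commute)

text \<open>In each block \<open>dop\<close> sends \<open>skp k\<close> to
  \<open>- hp (Suc (2 * k))\<close>, which gives the diagonal element at the odd level, and sends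
  \<open>hp (Suc (2 * k))\<close> to a multiple of \<open>hp (2 * k)\<close> minus
  \<open>hp (2 * Suc k)\<close>, which gives \<open>U k - boundary_term p1 p2 k\<close>. As
  \<open>U k\<close> contains the boundary term of the previous block, only the last one remains.
  The \<open>skew_diff_sum\<close> collects the commutators of \<open>dop\<close> with
  \<open>XX ^ p1\<close>.\<close>

lemma skew_moment_telescoped:
  "2 * skew_moment p1 p2 N = (\<Sum>k<2 * N. level_moment p1 p2 k) - (if N = 0 then 0 else boundary_term p1 p2 (N - 1))
     - of_real (1 + \<tau>) * of_nat p1 * skew_diff_sum (p1 - 1) p2 N"
proof -
  define U where "U k = ip (XX ^ p1 * hp (2 * k)) (XX ^ p2 * skp k) / fact (2 * k)" for k
  \<comment> \<open>The recursion of \<open>skp\<close> and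
    \<open>fact (2 * k) = 2 * k * fact (2 * k - 1)\<close> split off the diagonal element at the
    even level and leave the boundary term one block lower.\<close>
  have U: "U k = level_moment p1 p2 (2 * k) + (if k = 0 then 0 else boundary_term p1 p2 (k - 1))" for k
  proof (cases k)
    case (Suc l)
    have "ip (XX ^ p1 * hp (2 * k)) (XX ^ p2 * skp k) = ip (XX ^ p1 * hp (2 * k)) (XX ^ p2 * hp (2 * k))
       + of_nat (2 * k) * ip (XX ^ p1 * hp (2 * k)) (XX ^ p2 * skp l)"
      unfolding Suc skp.simps by (simp add: distrib_left ip_linear del: hp.simps mult_Suc_right of_nat_Suc of_nat_mult)
    moreover have "fact (2 * k) = of_nat (2 * k) * (fact (Suc (2 * l)) :: complex)"
      unfolding Suc by simp
    moreover have "of_nat (2 * k) \<noteq> (0::complex)" unfolding of_nat_eq_0_iff using Suc by simp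
    ultimately show ?thesis unfolding U_def level_moment_def boundary_term_def
      by (simp add: add_divide_distrib Suc del: hp.simps mult_Suc_right of_nat_Suc of_nat_mult fact_Suc)
  qed (simp add: U_def level_moment_def)
  have fact2: "fact (Suc (2 * k)) = of_nat (Suc (2 * k)) * (fact (2 * k) :: complex)" for k by simp
  have summand: "(Fform p1 p2 (skq (2 * k)) (skq (Suc (2 * k))) - Fform p1 p2 (skq (Suc (2 * k))) (skq (2 * k)))
     / bform (skq (2 * k)) (skq (Suc (2 * k)))
     = level_moment p1 p2 (Suc (2 * k)) + U k - boundary_term p1 p2 k
       - of_real (1 + \<tau>) * of_nat p1 * ((ip (XX ^ (p1 - 1) * skp k) (XX ^ p2 * hp (Suc (2 * k)))
          - ip (XX ^ (p1 - 1) * hp (Suc (2 * k))) (XX ^ p2 * skp k)) / fact (Suc (2 * k)))" for k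
  proof -
    have h: "hp (Suc (2 * k) - 1) = hp (2 * k)" "Suc (Suc (2 * k)) = 2 * Suc k" by auto
    have nz: "fact (Suc (2 * k)) \<noteq> (0::complex)" "of_nat (Suc (2 * k)) \<noteq> (0::complex)" "fact (2 * k) \<noteq> (0::complex)"
       "of_real (1 - \<tau>) \<noteq> (0::complex)" using tau_less_1 by (simp_all del: of_nat_Suc)
    have e: "ip (XX ^ p1 * dop (hp (Suc (2 * k)))) (XX ^ p2 * skp k) / fact (Suc (2 * k)) = U k - boundary_term p1 p2 k"
      unfolding dop_hp h U_def boundary_term_def level_moment_def right_diff_distrib mult_smult_right ip_linear fact2
      using nz by (simp add: diff_divide_distrib del: hp.simps mult_Suc_right of_nat_Suc)
    have "(Fform p1 p2 (skq (2 * k)) (skq (Suc (2 * k))) - Fform p1 p2 (skq (Suc (2 * k))) (skq (2 * k)))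
     / bform (skq (2 * k)) (skq (Suc (2 * k))) =
      - (ip (XX ^ p1 * dop (skp k)) (XX ^ p2 * hp (Suc (2 * k))) + of_real (1 + \<tau>) * of_nat p1 * ip (XX ^ (p1 - 1) * skp k) (XX ^ p2 * hp (Suc (2 * k)))
        - ip (XX ^ p1 * dop (hp (Suc (2 * k)))) (XX ^ p2 * skp k) - of_real (1 + \<tau>) * of_nat p1 * ip (XX ^ (p1 - 1) * hp (Suc (2 * k))) (XX ^ p2 * skp k))
       / fact (Suc (2 * k))"
      unfolding Fform_eq skq_simps bform_skp_hp using nz
      by (simp add: divide_simps del: hp.simps of_nat_Suc fact_Suc of_real_diff of_real_add) (simp add: algebra_simps del: hp.simps of_nat_Suc fact_Suc of_real_diff of_real_add)
    also have "\<dots> = - ip (XX ^ p1 * dop (skp k)) (XX ^ p2 * hp (Suc (2 * k))) / fact (Suc (2 * k))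
        + ip (XX ^ p1 * dop (hp (Suc (2 * k)))) (XX ^ p2 * skp k) / fact (Suc (2 * k))
        - of_real (1 + \<tau>) * of_nat p1 * ((ip (XX ^ (p1 - 1) * skp k) (XX ^ p2 * hp (Suc (2 * k)))
          - ip (XX ^ (p1 - 1) * hp (Suc (2 * k))) (XX ^ p2 * skp k)) / fact (Suc (2 * k)))"
      using nz(1) by (simp add: divide_simps del: hp.simps of_nat_Suc fact_Suc of_real_diff of_real_add) (simp add: algebra_simps del: hp.simps of_nat_Suc fact_Suc of_real_diff of_real_add)
    also have "- ip (XX ^ p1 * dop (skp k)) (XX ^ p2 * hp (Suc (2 * k))) / fact (Suc (2 * k)) = level_moment p1 p2 (Suc (2 * k))"
      unfolding dop_skp level_moment_def by (simp add: ip_linear del: hp.simps fact_Suc)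
    finally show ?thesis unfolding e by simp
  qed
  have tel: "(\<Sum>k<N. level_moment p1 p2 (Suc (2 * k)) + U k - boundary_term p1 p2 k)
      = (\<Sum>k<2 * N. level_moment p1 p2 k) - (if N = 0 then 0 else boundary_term p1 p2 (N - 1))"
    by (induction N) (simp_all add: U)
  have "2 * skew_moment p1 p2 N = (\<Sum>k<N. (Fform p1 p2 (skq (2 * k)) (skq (Suc (2 * k))) - Fform p1 p2 (skq (Suc (2 * k))) (skq (2 * k)))
     / bform (skq (2 * k)) (skq (Suc (2 * k))))"
  proof -
    have "2 * (x / (2 * y)) = x / y" for x y :: complex by simp
    then show ?thesis unfolding skew_moment_def sum_distrib_left by (simp only:)
  qed
  also have "\<dots> = (\<Sum>k<N. level_moment p1 p2 (Suc (2 * k)) + U k - boundary_term p1 p2 k) - of_real (1 + \<tau>) * of_nat p1 * skew_diff_sum (p1 - 1) p2 N"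
    unfolding summand sum_subtractf skew_diff_sum_def sum_distrib_left ..
  finally show ?thesis unfolding tel .
qed

text \<open>\<open>skew_moment_telescoped\<close> holds for \<open>(p1, p2)\<close> and
  \<open>(p2, p1)\<close> with the same left side. Weights \<open>p2\<close> and \<open>p1\<close>
  give both correction sums the common factor \<open>p1 * p2\<close>, and their sum is a lower skew
  moment.\<close>

theorem skew_moment_recursion:
  assumes N: "N > 0" and p: "p1 + p2 > 0"
  shows "skew_moment p1 p2 N = (\<Sum>k<2 * N. level_moment p1 p2 k) / 2
     - (of_nat p2 * boundary_term p1 p2 (N - 1) + of_nat p1 * boundary_term p2 p1 (N - 1)) / (2 * of_nat (p1 + p2))
     + of_real (1 - \<tau>\<^sup>2) * (of_nat (p1 * p2) / of_nat (p1 + p2)) * skew_moment (p1 - 1) (p2 - 1) N"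
proof -
  \<comment> \<open>After antisymmetry the two sums differ by moving one factor \<open>XX\<close>
    from one argument to the other, and such a difference is a \<open>bform\<close>.\<close>
  have S: "of_nat (p1 * p2) * (skew_diff_sum (p1 - 1) p2 N + skew_diff_sum (p2 - 1) p1 N)
      = - (of_nat (p1 * p2) * (of_real (1 - \<tau>) * (2 * skew_moment (p1 - 1) (p2 - 1) N)))"
  proof (cases "p1 = 0 \<or> p2 = 0")
    case False
    then obtain a b where ab: "p1 = Suc a" "p2 = Suc b" by (metis not0_implies_Suc)
    have X: "XX ^ Suc a * u = XX * (XX ^ a * u)" for a u by (simp only: power_Suc mult.assoc)
    have nz: "of_real (1 - \<tau>) \<noteq> (0::complex)" using tau_less_1 by simp
    have "skew_diff_sum a (Suc b) N + skew_diff_sum b (Suc a) N = skew_diff_sum a (Suc b) N - skew_diff_sum (Suc a) b N"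
      using skew_diff_sum_commute[of b "Suc a"] by simp
    also have "\<dots> = - (of_real (1 - \<tau>) * (2 * skew_moment a b N))"
      unfolding skew_diff_sum_def skew_moment_def sum_subtractf[symmetric] sum_distrib_left sum_negf[symmetric]
    proof (intro sum.cong refl)
      fix k
      let ?u = "skp k" and ?v = "hp (Suc (2 * k))"
      have F: "Fform a b x y = ip (XX ^ a * x) (XX ^ Suc b * y) - ip (XX ^ Suc a * x) (XX ^ b * y)" for x y
        unfolding Fform_def bform_def X ..
      show "(ip (XX ^ a * ?u) (XX ^ Suc b * ?v) - ip (XX ^ a * ?v) (XX ^ Suc b * ?u)) / fact (Suc (2 * k))
        - (ip (XX ^ Suc a * ?u) (XX ^ b * ?v) - ip (XX ^ Suc a * ?v) (XX ^ b * ?u)) / fact (Suc (2 * k))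
        = - (of_real (1 - \<tau>) * (2 * ((Fform a b (skq (2 * k)) (skq (Suc (2 * k))) - Fform a b (skq (Suc (2 * k))) (skq (2 * k)))
           / (2 * bform (skq (2 * k)) (skq (Suc (2 * k)))))))"
        unfolding skq_simps F bform_skp_hp using nz
        by (simp add: divide_simps del: hp.simps of_nat_Suc fact_Suc of_real_diff power_Suc)
    qed
    finally show ?thesis unfolding ab by simp
  qed auto
  define M where "M = skew_moment p1 p2 N"
  define Wt where "Wt = (\<Sum>k<2 * N. level_moment p1 p2 k)"
  define R where "R = skew_moment (p1 - 1) (p2 - 1) N"
  have 1: "2 * M = Wt - boundary_term p1 p2 (N - 1) - of_real (1 + \<tau>) * of_nat p1 * skew_diff_sum (p1 - 1) p2 N"
    using skew_moment_telescoped[of p1 p2 N] N by (simp add: M_def Wt_def)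
  have 2: "2 * M = Wt - boundary_term p2 p1 (N - 1) - of_real (1 + \<tau>) * of_nat p2 * skew_diff_sum (p2 - 1) p1 N"
    using skew_moment_telescoped[of p2 p1 N] N skew_moment_commute[of p1 p2 N] level_moment_commute[of p1 p2] by (simp add: M_def Wt_def)
  have "of_nat (p1 + p2) * (2 * M) = of_nat p2 * (2 * M) + of_nat p1 * (2 * M)"
    by (simp add: algebra_simps)
  also have "\<dots> = of_nat p2 * (Wt - boundary_term p1 p2 (N - 1) - of_real (1 + \<tau>) * of_nat p1 * skew_diff_sum (p1 - 1) p2 N)
     + of_nat p1 * (Wt - boundary_term p2 p1 (N - 1) - of_real (1 + \<tau>) * of_nat p2 * skew_diff_sum (p2 - 1) p1 N)"
    unfolding 1[symmetric] 2[symmetric] ..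
  also have "\<dots> = of_nat (p1 + p2) * Wt - (of_nat p2 * boundary_term p1 p2 (N - 1) + of_nat p1 * boundary_term p2 p1 (N - 1))
     - of_real (1 + \<tau>) * (of_nat (p1 * p2) * (skew_diff_sum (p1 - 1) p2 N + skew_diff_sum (p2 - 1) p1 N))"
    by (simp add: algebra_simps)
  also have "\<dots> = of_nat (p1 + p2) * Wt - (of_nat p2 * boundary_term p1 p2 (N - 1) + of_nat p1 * boundary_term p2 p1 (N - 1))
     + of_real (1 - \<tau>\<^sup>2) * of_nat (p1 * p2) * (2 * R)"
    unfolding S R_def by (simp add: algebra_simps power2_eq_square)
  finally have "of_nat (p1 + p2) * (2 * M) = \<dots>" .
  moreover have "M = Wt / 2 - Q / (2 * T) + c * (P / T) * R"
    if "T * (2 * M) = T * Wt - Q + c * P * (2 * R)" "T \<noteq> 0" for M Wt Q T c P R :: complex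
    using that by (simp add: divide_simps) (simp add: algebra_simps)
  moreover have "of_nat (p1 + p2) \<noteq> (0::complex)" using p by (metis of_nat_eq_0_iff less_numeral_extra(3))
  ultimately show ?thesis unfolding M_def[symmetric] Wt_def[symmetric] R_def[symmetric]
    by metis
qed

end

section \<open>Vandermonde determinants and permutation sums\<close>

text \<open>Induction on the number of points: expansion along the last row is a polynomial
  \<open>p\<close> in the last point, to be compared with the expected product \<open>r\<close>.
  Both have degree at most \<open>n\<close>, the same coefficient at \<open>n\<close>, and the
  \<open>n\<close> earlier points as roots.\<close>

lemma det_monic_vandermonde:
  fixes q :: "nat \<Rightarrow> 'a :: field poly"
  assumes q: "\<And>n. degree (q n) = n" "\<And>n. lead_coeff (q n) = 1"
  shows "det (mat n n (\<lambda>(i, j). poly (q j) (w i))) = (\<Prod>b<n. \<Prod>a<b. w b - w a)"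
proof (induction n)
  case 0
  show ?case by simp
next
  case (Suc n)
  define A where "A = mat (Suc n) (Suc n) (\<lambda>(i, j). poly (q j) (w i))"
  define p where "p = (\<Sum>j<Suc n. smult (cofactor A n j) (q j))"
  define r where "r = smult (det (mat n n (\<lambda>(i, j). poly (q j) (w i)))) (\<Prod>a<n. [:- w a, 1:])"
  have A: "A \<in> carrier_mat (Suc n) (Suc n)" by (simp add: A_def)
  have detA: "det A = poly p (w n)"
    unfolding laplace_expansion_row[OF A lessI] p_def
    by (auto simp: poly_sum A_def mult.commute intro!: sum.cong)
  have "mat_delete A n n = mat n n (\<lambda>(i, j). poly (q j) (w i))"
    by (rule eq_matI) (auto simp: mat_delete_def A_def)
  then have cof: "cofactor A n n = det (mat n n (\<lambda>(i, j). poly (q j) (w i)))"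
    by (simp add: cofactor_def)
  have root: "poly p (w a) = 0" if a: "a < n" for a
  proof -
    \<comment> \<open>Placing the last point at \<open>w a\<close> duplicates row \<open>a\<close>
      without touching the cofactors of the last row.\<close>
    define B where "B = mat (Suc n) (Suc n) (\<lambda>(i, j). poly (q j) (if i = n then w a else w i))"
    have B: "B \<in> carrier_mat (Suc n) (Suc n)" by (simp add: B_def)
    have "cofactor B n j = cofactor A n j" if "j < Suc n" for j
    proof -
      have "mat_delete B n j = mat_delete A n j"
        by (rule eq_matI) (auto simp: mat_delete_def A_def B_def)
      then show ?thesis by (simp add: cofactor_def)
    qed
    then have "det B = poly p (w a)"
      unfolding laplace_expansion_row[OF B lessI] p_def
      by (auto simp: poly_sum B_def mult.commute intro!: sum.cong)
    moreover have "det B = 0"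
      by (rule det_identical_rows[OF B, of a n]) (use a in \<open>auto simp: B_def intro!: eq_vecI\<close>)
    ultimately show ?thesis by simp
  qed
  have deg_prod: "degree (\<Prod>a<n. [:- w a, 1:]) = n"
    by (subst degree_prod_eq_sum_degree) auto
  have lead_prod: "coeff (\<Prod>a<n. [:- w a, 1:]) n = 1"
    using lead_coeff_prod[of "\<lambda>a. [:- w a, 1:]" "{..<n}"] by (simp add: deg_prod)
  have "poly p (w n) = poly r (w n)"
  \<comment> \<open>Counting roots requires distinct points; if two of the earlier points coincide,
    both sides vanish.\<close>
  proof (cases "inj_on w {..<n}")
    case True
    have "degree p \<le> n" unfolding p_def
      by (rule degree_sum_le) (auto intro: order_trans[OF degree_smult_le] simp: q)
    have "degree r \<le> n" unfolding r_def using degree_smult_le deg_prod by metis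
    have "coeff p n = cofactor A n n"
    proof -
      have "coeff (q j) n = (if j = n then 1 else 0)" if "j \<le> n" for j
        using that q[of j] coeff_eq_0[of "q j" n] by auto
      then have "coeff p n = (\<Sum>j<Suc n. if j = n then cofactor A n j else 0)"
        unfolding p_def coeff_sum by (intro sum.cong) auto
      then show ?thesis by simp
    qed
    then have top: "coeff (p - r) n = 0" by (simp add: r_def lead_prod cof)
    have "p - r = 0"
    proof (rule ccontr)
      assume nz: "p - r \<noteq> 0"
      have "degree (p - r) \<le> n" using \<open>degree p \<le> n\<close> \<open>degree r \<le> n\<close> by (rule degree_diff_le)
      moreover have "degree (p - r) \<noteq> n" using top nz by (metis leading_coeff_0_iff)
      ultimately have "degree (p - r) < n" by simp
      moreover have "w ` {..<n} \<subseteq> {x. poly (p - r) x = 0}"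
        using root by (auto simp: r_def poly_prod)
      then have "card (w ` {..<n}) \<le> card {x. poly (p - r) x = 0}"
        by (intro card_mono poly_roots_finite nz)
      then have "n \<le> degree (p - r)"
        using card_image[OF True] card_poly_roots_bound[OF nz] by simp
      ultimately show False by simp
    qed
    then show ?thesis by simp
  next
    case False
    then obtain a b where ab: "a < b" "b < n" "w a = w b"
      by (auto simp: inj_on_def) (metis linorder_neqE_nat)
    have "(\<Prod>a<b. w b - w a) = 0"
      using ab by (intro prod_zero bexI[of _ a]) auto
    moreover have "b \<in> {..<n}" using ab by simp
    ultimately have "det (mat n n (\<lambda>(i, j). poly (q j) (w i))) = 0"
      unfolding Suc.IH by (rule prod_zero[OF finite_lessThan bexI])
    then have "r = 0" by (simp add: r_def)
    moreover have "det A = 0"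
      by (rule det_identical_rows[OF A, of a b]) (use ab in \<open>auto simp: A_def intro!: eq_vecI\<close>)
    ultimately show ?thesis using detA by simp
  qed
  then show ?case unfolding A_def[symmetric] detA
    by (simp add: r_def poly_prod Suc.IH)
qed

lemma vandermonde_monic:
  fixes q :: "nat \<Rightarrow> 'a :: field poly"
  assumes q: "\<And>n. degree (q n) = n" "\<And>n. lead_coeff (q n) = 1"
  shows "(\<Prod>b<n. \<Prod>a<b. w b - w a)
    = (\<Sum>\<sigma> | \<sigma> permutes {..<n}. of_int (sign \<sigma>) * (\<Prod>a<n. poly (q (\<sigma> a)) (w a)))"
proof -
  have "det (mat n n (\<lambda>(i, j). poly (q j) (w i)))
     = (\<Sum>\<sigma> | \<sigma> permutes {0..<n}. of_int (sign \<sigma>) * (\<Prod>a=0..<n. poly (q (\<sigma> a)) (w a)))"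
    by (subst det_def'[of _ n], simp)
       (intro sum.cong refl arg_cong2[of _ _ _ _ "(*)"] prod.cong, auto simp: permutes_in_image)
  then show ?thesis using det_monic_vandermonde[OF q, of n w] by (simp add: lessThan_atLeast0)
qed

lemma prod_triangle_swap:
  fixes f :: "nat \<Rightarrow> nat \<Rightarrow> 'a :: comm_monoid_mult"
  shows "(\<Prod>j<N. \<Prod>k\<in>{j<..<N}. f j k) = (\<Prod>k<N. \<Prod>j<k. f j k)"
proof (induction N)
  case (Suc N)
  have "{j<..<Suc N} = insert N {j<..<N}" if "j < N" for j using that by auto
  then have "(\<Prod>k\<in>{j<..<Suc N}. f j k) = f j N * (\<Prod>k\<in>{j<..<N}. f j k)" if "j < N" for j
    using that by simp
  moreover have "{N<..<Suc N} = {}" by auto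
  ultimately show ?case using Suc by (simp add: prod.distrib mult.commute)
qed simp

lemma prod_double:
  fixes f :: "nat \<Rightarrow> 'a :: comm_monoid_mult"
  shows "(\<Prod>a<2 * N. f a) = (\<Prod>j<N. f (2 * j) * f (Suc (2 * j)))"
  by (induction N) (simp_all add: mult_ac)

lemma prod_mult_indicator:
  fixes c A :: "nat \<Rightarrow> 'a :: comm_monoid_mult"
  assumes "j0 < N"
  shows "(\<Prod>j<N. (if j = j0 then c j else 1) * A j) = c j0 * (\<Prod>j<N. A j)"
  using assms by (simp add: prod.distrib prod.delta)

text \<open>Two permutations of a finite set that agree off one point agree there too. So one factor
  \<open>h\<close> without any orthogonality still lets only \<open>\<pi> = \<sigma>\<close>
  survive, and there the signs square to 1.\<close>

lemma sum_permutes_orthogonal: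
  fixes g :: "nat \<Rightarrow> nat \<Rightarrow> complex"
  assumes \<sigma>: "\<sigma> permutes {..<N}" and j0: "j0 < N"
    and orth: "\<And>a b. a \<noteq> b \<Longrightarrow> g a b = 0"
  shows "(\<Sum>\<pi> | \<pi> permutes {..<N}. of_int (sign \<sigma>) * of_int (sign \<pi>) *
      (\<Prod>j<N. if j = j0 then h (\<sigma> j) (\<pi> j) else g (\<sigma> j) (\<pi> j)))
    = (\<Prod>j<N. if j = j0 then h (\<sigma> j) (\<sigma> j) else g (\<sigma> j) (\<sigma> j))"
proof -
  have z: "(\<Prod>j<N. if j = j0 then h (\<sigma> j) (\<pi> j) else g (\<sigma> j) (\<pi> j)) = 0"
    if \<pi>: "\<pi> permutes {..<N}" and ne: "\<pi> \<noteq> \<sigma>" for \<pi>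
  proof -
    have "\<exists>j<N. j \<noteq> j0 \<and> \<sigma> j \<noteq> \<pi> j"
    proof (rule ccontr)
      assume "\<not> ?thesis"
      then have eq: "\<sigma> j = \<pi> j" if "j < N" "j \<noteq> j0" for j using that by blast
      have "\<sigma> j0 = \<pi> j0"
      proof (rule ccontr)
        assume ne0: "\<sigma> j0 \<noteq> \<pi> j0"
        have "\<pi> j0 \<in> {..<N}" using permutes_in_image[OF \<pi>] j0 by auto
        then obtain i where i: "i < N" "\<sigma> i = \<pi> j0"
          using permutes_image[OF \<sigma>] by (metis imageE lessThan_iff)
        then have "i \<noteq> j0" using ne0 by auto
        then have "\<pi> i = \<pi> j0" using eq i by metis
        then show False using \<open>i \<noteq> j0\<close> permutes_inj[OF \<pi>] by (auto dest: injD)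
      qed
      then have "\<sigma> j = \<pi> j" for j
        using eq[of j] permutes_not_in[OF \<sigma>, of j] permutes_not_in[OF \<pi>, of j]
        by (cases "j < N"; cases "j = j0") auto
      then show False using ne by auto
    qed
    then show ?thesis using orth by (auto simp: prod_zero_iff)
  qed
  have "finite {\<pi>. \<pi> permutes {..<N}}" by (simp add: finite_permutations)
  then have "(\<Sum>\<pi> | \<pi> permutes {..<N}. of_int (sign \<sigma>) * of_int (sign \<pi>) *
      (\<Prod>j<N. if j = j0 then h (\<sigma> j) (\<pi> j) else g (\<sigma> j) (\<pi> j)))
    = (\<Sum>\<pi>\<in>{\<sigma>}. of_int (sign \<sigma>) * of_int (sign \<pi>) *
      (\<Prod>j<N. if j = j0 then h (\<sigma> j) (\<pi> j) else g (\<sigma> j) (\<pi> j)))"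
    using \<sigma> z by (intro sum.mono_neutral_right) auto
  moreover have "of_int (sign \<sigma>) * of_int (sign \<sigma>) = (1 :: complex)"
    by (simp add: sign_def)
  ultimately show ?thesis by simp
qed

text \<open>Only permutations mapping every pair \<open>{2j, 2j+1}\<close> onto such a pair contribute; transposing
  \<open>2 j0\<close> and \<open>2 j0 + 1\<close> then antisymmetrises \<open>F\<close>.\<close>

lemma sum_permutes_skew_orthogonal:
  fixes B F :: "nat \<Rightarrow> nat \<Rightarrow> complex"
  assumes anti: "\<And>a b. B a b = - B b a"
    and skew: "\<And>a b. a div 2 \<noteq> b div 2 \<or> a = b \<Longrightarrow> B a b = 0"
    and nz: "\<And>k. B (2 * k) (Suc (2 * k)) \<noteq> 0"
  shows "(\<Sum>j0<N. \<Sum>\<sigma> | \<sigma> permutes {..<2 * N}. of_int (sign \<sigma>) *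
      (\<Prod>j<N. if j = j0 then F (\<sigma> (2 * j)) (\<sigma> (Suc (2 * j))) else B (\<sigma> (2 * j)) (\<sigma> (Suc (2 * j)))))
    = (\<Sum>k<N. (F (2 * k) (Suc (2 * k)) - F (Suc (2 * k)) (2 * k)) / (2 * B (2 * k) (Suc (2 * k))))
      * (\<Sum>\<sigma> | \<sigma> permutes {..<2 * N}. of_int (sign \<sigma>) * (\<Prod>j<N. B (\<sigma> (2 * j)) (\<sigma> (Suc (2 * j)))))"
proof -
  let ?S = "{\<sigma>. \<sigma> permutes {..<2 * N}}"
  have finS: "finite ?S" by (simp add: finite_permutations)
  define \<rho> where "\<rho> k = (F (2 * k) (Suc (2 * k)) - F (Suc (2 * k)) (2 * k)) / (2 * B (2 * k) (Suc (2 * k)))" for k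
  define P where "P \<sigma> j0 = (\<Prod>j\<in>{..<N} - {j0}. B (\<sigma> (2 * j)) (\<sigma> (Suc (2 * j))))" for \<sigma> j0
  define Q where "Q \<sigma> = (\<Prod>j<N. B (\<sigma> (2 * j)) (\<sigma> (Suc (2 * j))))" for \<sigma>
  have Q: "Q \<sigma> = B (\<sigma> (2 * j0)) (\<sigma> (Suc (2 * j0))) * P \<sigma> j0" if "j0 < N" for \<sigma> j0
    unfolding Q_def P_def using that by (simp add: prod.remove[of _ j0])
  \<comment> \<open>A block \<open>{2 * m, 2 * m + 1}\<close> has only two elements.\<close>
  have three: "x = y \<or> x = z" if "x div 2 = y div 2" "y div 2 = z div 2" "y \<noteq> z" for x y z :: nat
  proof -
    have eqI: "a = b" if "a div 2 = b div 2" "even a \<longleftrightarrow> even b" for a b :: nat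
      using that by (metis even_two_times_div_two odd_two_times_div_two_succ)
    have "even x = even y \<or> even x = even z" using eqI[of y z] that by blast
    then show ?thesis using eqI[of x y] eqI[of x z] that by auto
  qed
  have ne: "\<sigma> (2 * j) \<noteq> \<sigma> (Suc (2 * i))" if "\<sigma> permutes {..<2 * N}" for \<sigma> i j
    using injD[OF permutes_inj[OF that], of "2 * j" "Suc (2 * i)"] by presburger
  have pair: "\<sigma> (2 * j0) div 2 = \<sigma> (Suc (2 * j0)) div 2"
    if \<sigma>: "\<sigma> permutes {..<2 * N}" and j0: "j0 < N" and P: "P \<sigma> j0 \<noteq> 0" for \<sigma> j0
  proof -
    have inj: "\<sigma> x = \<sigma> y \<longleftrightarrow> x = y" for x y using permutes_inj[OF \<sigma>] by (auto dest: injD)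
    define a where "a = \<sigma> (2 * j0)"
    \<comment> \<open>The other element of the block of \<open>a\<close>, attained at some
      \<open>c\<close>. If \<open>c\<close> belonged to a block other than that of
      \<open>j0\<close>, the nonzero factor there would make the images of that block fill the block
      of \<open>a\<close>, leaving no place for \<open>a = \<sigma> (2 * j0)\<close>.\<close>
    define a' where "a' = (if even a then Suc a else a - 1)"
    have "a < 2 * N" using permutes_in_image[OF \<sigma>, of "2 * j0"] j0 by (simp add: a_def)
    then have "a' < 2 * N" "a' div 2 = a div 2" "a' \<noteq> a" unfolding a'_def by presburger+
    then obtain c where c: "c < 2 * N" "\<sigma> c = a'"
      using permutes_image[OF \<sigma>] by (metis imageE lessThan_iff)
    define j where "j = c div 2"
    have cj: "c = 2 * j \<or> c = Suc (2 * j)" unfolding j_def by presburger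
    have jN: "j < N" using c(1) by (simp add: j_def)
    have "j = j0"
    proof (rule ccontr)
      assume "j \<noteq> j0"
      then have "B (\<sigma> (2 * j)) (\<sigma> (Suc (2 * j))) \<noteq> 0"
        using P jN by (auto simp: P_def prod_zero_iff)
      then have eq: "\<sigma> (2 * j) div 2 = \<sigma> (Suc (2 * j)) div 2" using skew by blast
      have "a div 2 = \<sigma> (2 * j) div 2" using cj c \<open>a' div 2 = a div 2\<close> eq by auto
      then have "a = \<sigma> (2 * j) \<or> a = \<sigma> (Suc (2 * j))" using three[OF _ eq ne[OF \<sigma>]] by blast
      then show False using \<open>j \<noteq> j0\<close> unfolding a_def inj by presburger
    qed
    then have "c = Suc (2 * j0)" using cj c \<open>a' \<noteq> a\<close> by (auto simp: a_def)
    then show ?thesis using c \<open>a' div 2 = a div 2\<close> by (simp add: a_def)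
  qed
  \<comment> \<open>On a block the antisymmetrised \<open>F\<close> is a multiple of
    \<open>B\<close>, and the factor does not depend on the order of the two elements.\<close>
  have \<rho>: "F a b - F b a = 2 * \<rho> (a div 2) * B a b" if "a div 2 = b div 2" "a \<noteq> b" for a b
  proof -
    define k where "k = a div 2"
    have "a = 2 * k \<and> b = Suc (2 * k) \<or> a = Suc (2 * k) \<and> b = 2 * k"
      using that unfolding k_def by (cases "even a"; cases "even b") (auto elim!: evenE oddE)
    then show ?thesis using nz[of k] anti[of "Suc (2 * k)" "2 * k"] by (auto simp: \<rho>_def field_simps)
  qed
  have j0_sum: "(\<Sum>\<sigma>\<in>?S. of_int (sign \<sigma>) *
      (\<Prod>j<N. if j = j0 then F (\<sigma> (2 * j)) (\<sigma> (Suc (2 * j))) else B (\<sigma> (2 * j)) (\<sigma> (Suc (2 * j)))))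
     = (\<Sum>\<sigma>\<in>?S. of_int (sign \<sigma>) * (\<rho> (\<sigma> (2 * j0) div 2) * Q \<sigma>))" if j0: "j0 < N" for j0
  proof -
    let ?t = "Transposition.transpose (2 * j0) (Suc (2 * j0))"
    have t: "?t permutes {..<2 * N}" using j0 by (intro permutes_swap_id) auto
    have prodP: "(\<Prod>j<N. if j = j0 then F (\<sigma> (2 * j)) (\<sigma> (Suc (2 * j))) else B (\<sigma> (2 * j)) (\<sigma> (Suc (2 * j))))
       = F (\<sigma> (2 * j0)) (\<sigma> (Suc (2 * j0))) * P \<sigma> j0" for \<sigma>
      using j0 by (simp add: prod.remove[of _ j0] P_def)
    define T where "T = (\<Sum>\<sigma>\<in>?S. of_int (sign \<sigma>) * (F (\<sigma> (2 * j0)) (\<sigma> (Suc (2 * j0))) * P \<sigma> j0))"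
    have "T = (\<Sum>\<sigma>\<in>?S. of_int (sign (\<sigma> \<circ> ?t)) * (F ((\<sigma> \<circ> ?t) (2 * j0)) ((\<sigma> \<circ> ?t) (Suc (2 * j0))) * P (\<sigma> \<circ> ?t) j0))"
      unfolding T_def by (rule sum_permutations_compose_right[OF t])
    also have "\<dots> = (\<Sum>\<sigma>\<in>?S. - (of_int (sign \<sigma>) * (F (\<sigma> (Suc (2 * j0))) (\<sigma> (2 * j0)) * P \<sigma> j0)))"
    proof (intro sum.cong refl)
      fix \<sigma> assume "\<sigma> \<in> ?S"
      then have p: "permutation \<sigma>" using permutation_permutes by blast
      have "sign (\<sigma> \<circ> ?t) = - sign \<sigma>"
        using sign_compose[OF p permutation_swap_id[of "2 * j0" "Suc (2 * j0)"]] by (simp add: sign_swap_id)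
      moreover have "P (\<sigma> \<circ> ?t) j0 = P \<sigma> j0"
      proof -
        have "?t (2 * j) = 2 * j" "?t (Suc (2 * j)) = Suc (2 * j)" if "j \<noteq> j0" for j
          using that by (auto simp: Transposition.transpose_def)
        then show ?thesis unfolding P_def by (intro prod.cong) auto
      qed
      ultimately show "of_int (sign (\<sigma> \<circ> ?t)) * (F ((\<sigma> \<circ> ?t) (2 * j0)) ((\<sigma> \<circ> ?t) (Suc (2 * j0))) * P (\<sigma> \<circ> ?t) j0)
        = - (of_int (sign \<sigma>) * (F (\<sigma> (Suc (2 * j0))) (\<sigma> (2 * j0)) * P \<sigma> j0))"
        by simp
    qed
    finally have "2 * T = T + (\<Sum>\<sigma>\<in>?S. - (of_int (sign \<sigma>) * (F (\<sigma> (Suc (2 * j0))) (\<sigma> (2 * j0)) * P \<sigma> j0)))"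
      by (metis mult_2)
    also have "\<dots> = (\<Sum>\<sigma>\<in>?S. of_int (sign \<sigma>) * ((F (\<sigma> (2 * j0)) (\<sigma> (Suc (2 * j0))) - F (\<sigma> (Suc (2 * j0))) (\<sigma> (2 * j0))) * P \<sigma> j0))"
      unfolding T_def sum.distrib[symmetric] by (intro sum.cong refl) (simp add: ring_distribs)
    also have "\<dots> = (\<Sum>\<sigma>\<in>?S. 2 * (of_int (sign \<sigma>) * (\<rho> (\<sigma> (2 * j0) div 2) * Q \<sigma>)))"
    proof (intro sum.cong refl)
      fix \<sigma> assume "\<sigma> \<in> ?S"
      then have \<sigma>: "\<sigma> permutes {..<2 * N}" by simp
      show "of_int (sign \<sigma>) * ((F (\<sigma> (2 * j0)) (\<sigma> (Suc (2 * j0))) - F (\<sigma> (Suc (2 * j0))) (\<sigma> (2 * j0))) * P \<sigma> j0)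
         = 2 * (of_int (sign \<sigma>) * (\<rho> (\<sigma> (2 * j0) div 2) * Q \<sigma>))"
        using \<rho>[OF pair[OF \<sigma> j0] ne[OF \<sigma>]] by (cases "P \<sigma> j0 = 0") (simp_all add: Q[OF j0])
    qed
    finally show ?thesis unfolding prodP T_def[symmetric] by (simp add: sum_distrib_left[symmetric])
  qed
  \<comment> \<open>If \<open>Q \<sigma>\<close> is nonzero, \<open>\<sigma>\<close> permutes the
    blocks, so the sum over \<open>j0\<close> is a reindexed sum over all blocks.\<close>
  have \<sigma>_sum: "(\<Sum>j0<N. \<rho> (\<sigma> (2 * j0) div 2)) * Q \<sigma> = (\<Sum>k<N. \<rho> k) * Q \<sigma>" if "\<sigma> \<in> ?S" for \<sigma>
  proof (cases "Q \<sigma> = 0")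
    case False
    from that have \<sigma>: "\<sigma> permutes {..<2 * N}" by simp
    have inj: "\<sigma> x = \<sigma> y \<longleftrightarrow> x = y" for x y using permutes_inj[OF \<sigma>] by (auto dest: injD)
    have eq: "\<sigma> (2 * j) div 2 = \<sigma> (Suc (2 * j)) div 2" if "j < N" for j
      using pair[OF \<sigma> that] Q[OF that] False by auto
    have "inj_on (\<lambda>j. \<sigma> (2 * j) div 2) {..<N}"
    proof (rule inj_onI)
      fix i j assume ij: "i \<in> {..<N}" "j \<in> {..<N}" "\<sigma> (2 * i) div 2 = \<sigma> (2 * j) div 2"
      then have "\<sigma> (2 * i) = \<sigma> (2 * j) \<or> \<sigma> (2 * i) = \<sigma> (Suc (2 * j))"
        using three[OF ij(3) eq ne[OF \<sigma>]] by auto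
      then show "i = j" unfolding inj by presburger
    qed
    moreover have "(\<lambda>j. \<sigma> (2 * j) div 2) ` {..<N} \<subseteq> {..<N}"
    proof (rule image_subsetI)
      fix j assume "j \<in> {..<N}"
      then have "\<sigma> (2 * j) < 2 * N" using permutes_in_image[OF \<sigma>, of "2 * j"] by simp
      then show "\<sigma> (2 * j) div 2 \<in> {..<N}" by auto
    qed
    ultimately have "bij_betw (\<lambda>j. \<sigma> (2 * j) div 2) {..<N} {..<N}"
      by (simp add: bij_betw_def endo_inj_surj)
    then show ?thesis using sum.reindex_bij_betw[of _ _ _ \<rho>] by metis
  qed simp
  have "(\<Sum>j0<N. \<Sum>\<sigma>\<in>?S. of_int (sign \<sigma>) *
      (\<Prod>j<N. if j = j0 then F (\<sigma> (2 * j)) (\<sigma> (Suc (2 * j))) else B (\<sigma> (2 * j)) (\<sigma> (Suc (2 * j)))))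
    = (\<Sum>j0<N. \<Sum>\<sigma>\<in>?S. of_int (sign \<sigma>) * (\<rho> (\<sigma> (2 * j0) div 2) * Q \<sigma>))"
    by (rule sum.cong[OF refl], rule j0_sum) simp
  also have "\<dots> = (\<Sum>\<sigma>\<in>?S. \<Sum>j0<N. of_int (sign \<sigma>) * (\<rho> (\<sigma> (2 * j0) div 2) * Q \<sigma>))"
    by (rule sum.swap)
  also have "\<dots> = (\<Sum>\<sigma>\<in>?S. of_int (sign \<sigma>) * ((\<Sum>j0<N. \<rho> (\<sigma> (2 * j0) div 2)) * Q \<sigma>))"
    by (simp add: sum_distrib_left sum_distrib_right)
  also have "\<dots> = (\<Sum>\<sigma>\<in>?S. of_int (sign \<sigma>) * ((\<Sum>k<N. \<rho> k) * Q \<sigma>))"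
    by (rule sum.cong[OF refl]) (simp only: \<sigma>_sum)
  also have "\<dots> = (\<Sum>k<N. \<rho> k) * (\<Sum>\<sigma>\<in>?S. of_int (sign \<sigma>) * Q \<sigma>)"
    by (simp add: sum_distrib_left mult.left_commute)
  finally show ?thesis unfolding \<rho>_def Q_def .
qed

section \<open>The first density integrated term by term\<close>

context elliptic_weight
begin

lemma
  fixes f :: "nat \<Rightarrow> complex \<Rightarrow> complex"
  assumes "\<And>j. j < N \<Longrightarrow> wintegrable (f j)"
  shows integrable_PiM_weight: "integrable (PiM {..<N} (\<lambda>_. dA)) (\<lambda>z. \<Prod>j<N. f j (z j) * of_real (omegaH \<tau> (z j)))"
    and integral_PiM_weight: "(\<integral>z. (\<Prod>j<N. f j (z j) * of_real (omegaH \<tau> (z j))) \<partial>PiM {..<N} (\<lambda>_. dA)) = (\<Prod>j<N. wint (f j))"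
proof -
  interpret product_sigma_finite "\<lambda>_::nat. dA"
    unfolding product_sigma_finite_def using sigma_finite_dA by blast
  show "integrable (PiM {..<N} (\<lambda>_. dA)) (\<lambda>z. \<Prod>j<N. f j (z j) * of_real (omegaH \<tau> (z j)))"
    using assms
    by (intro product_integrable_prod[of "{..<N}" "\<lambda>j x. f j x * of_real (omegaH \<tau> x)"]) (auto simp: wintegrable_def)
  show "(\<integral>z. (\<Prod>j<N. f j (z j) * of_real (omegaH \<tau> (z j))) \<partial>PiM {..<N} (\<lambda>_. dA)) = (\<Prod>j<N. wint (f j))"
    using assms
    by (subst product_integral_prod[of "{..<N}" "\<lambda>j x. f j x * of_real (omegaH \<tau> x)"])
       (auto simp: wintegrable_def wint_def)
qed

lemma wint_polys: "wint (\<lambda>z. poly u z * poly v (cnj z)) = mom 0 0 * ip u v"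
  using mom_0_nonzero by (simp add: ip_def)

text \<open>Each squared distance splits into a factor in \<open>z\<close> and one in
  \<open>cnj z\<close>, giving two Vandermonde products and hence two permutations. The powers of
  \<open>z j0\<close> and its conjugate are absorbed into the polynomials at \<open>j0\<close>, so
  each term stays a product over points.\<close>

lemma densC_expansion:
  "of_real (densC \<tau> N z) * (\<Sum>j<N. z j ^ p1 * cnj (z j) ^ p2)
   = (\<Sum>j0<N. \<Sum>\<sigma> | \<sigma> permutes {..<N}. \<Sum>\<pi> | \<pi> permutes {..<N}. of_int (sign \<sigma>) * of_int (sign \<pi>) *
       (\<Prod>j<N. (poly (XX ^ (if j = j0 then p1 else 0) * hp (\<sigma> j)) (z j)
          * poly (XX ^ (if j = j0 then p2 else 0) * hp (\<pi> j)) (cnj (z j))) * of_real (omegaH \<tau> (z j))))"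
proof -
  have V: "(\<Prod>b<N. \<Prod>a<b. w b - w a)
    = (\<Sum>\<sigma> | \<sigma> permutes {..<N}. of_int (sign \<sigma>) * (\<Prod>a<N. poly (hp (\<sigma> a)) (w a)))" for w
    by (intro vandermonde_monic conjunct1[OF hp_monic] conjunct2[OF hp_monic])
  have sq: "complex_of_real ((cmod (x - y))\<^sup>2) = (y - x) * (cnj y - cnj x)" for x y
    unfolding complex_norm_square by (simp add: algebra_simps)
  have d: "complex_of_real (densC \<tau> N z) = (\<Prod>b<N. \<Prod>a<b. z b - z a) * (\<Prod>b<N. \<Prod>a<b. cnj (z b) - cnj (z a))
     * (\<Prod>j<N. of_real (omegaH \<tau> (z j)))"
    unfolding densC_def prod_triangle_swap of_real_mult of_real_prod sq prod.distrib ..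
  have t: "(\<Prod>j<N. (poly (XX ^ (if j = j0 then p1 else 0) * hp (\<sigma> j)) (z j)
          * poly (XX ^ (if j = j0 then p2 else 0) * hp (\<pi> j)) (cnj (z j))) * complex_of_real (omegaH \<tau> (z j)))
      = (z j0 ^ p1 * cnj (z j0) ^ p2) * ((\<Prod>a<N. poly (hp (\<sigma> a)) (z a)) * (\<Prod>a<N. poly (hp (\<pi> a)) (cnj (z a)))
        * (\<Prod>j<N. of_real (omegaH \<tau> (z j))))" if "j0 < N" for j0 \<sigma> \<pi>
  proof -
    have "(\<Prod>j<N. (poly (XX ^ (if j = j0 then p1 else 0) * hp (\<sigma> j)) (z j)
          * poly (XX ^ (if j = j0 then p2 else 0) * hp (\<pi> j)) (cnj (z j))) * complex_of_real (omegaH \<tau> (z j)))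
      = (\<Prod>j<N. (if j = j0 then z j ^ p1 * cnj (z j) ^ p2 else 1) *
         (poly (hp (\<sigma> j)) (z j) * poly (hp (\<pi> j)) (cnj (z j)) * of_real (omegaH \<tau> (z j))))"
      by (intro prod.cong refl) (auto simp: mult_ac)
    also have "\<dots> = (z j0 ^ p1 * cnj (z j0) ^ p2) *
       (\<Prod>j<N. poly (hp (\<sigma> j)) (z j) * poly (hp (\<pi> j)) (cnj (z j)) * of_real (omegaH \<tau> (z j)))"
      by (rule prod_mult_indicator[OF that])
    finally show ?thesis by (simp add: prod.distrib)
  qed
  show ?thesis unfolding d sum_distrib_left
  proof (intro sum.cong refl)
    fix j0 assume "j0 \<in> {..<N}"
    then have j0: "j0 < N" by simp
    show "(\<Prod>b<N. \<Prod>a<b. z b - z a) * (\<Prod>b<N. \<Prod>a<b. cnj (z b) - cnj (z a)) *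
      (\<Prod>j<N. of_real (omegaH \<tau> (z j))) * (z j0 ^ p1 * cnj (z j0) ^ p2)
     = (\<Sum>\<sigma> | \<sigma> permutes {..<N}. \<Sum>\<pi> | \<pi> permutes {..<N}. of_int (sign \<sigma>) * of_int (sign \<pi>) *
       (\<Prod>j<N. (poly (XX ^ (if j = j0 then p1 else 0) * hp (\<sigma> j)) (z j)
          * poly (XX ^ (if j = j0 then p2 else 0) * hp (\<pi> j)) (cnj (z j))) * complex_of_real (omegaH \<tau> (z j))))"
      unfolding t[OF j0] V sum_product unfolding sum_distrib_right
      by (intro sum.cong refl) (simp only: mult_ac)
  qed
qed

text \<open>For each \<open>\<sigma>\<close> only \<open>\<pi> = \<sigma>\<close> survives, and the
  product of the norms is the same for every \<open>\<sigma>\<close>. Summing over \<open>j0\<close>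
  makes the moment factor independent of \<open>\<sigma>\<close> too, so the outer sum merely counts
  \<open>fact N\<close> permutations.\<close>

lemma integral_densC:
  "(\<integral>z. of_real (densC \<tau> N z) * (\<Sum>j<N. z j ^ p1 * cnj (z j) ^ p2) \<partial>PiM {..<N} (\<lambda>_. dA))
   = (\<Sum>k<N. level_moment p1 p2 k) * (fact N * mom 0 0 ^ N * (\<Prod>k<N. fact k))"
proof -
  let ?G = "\<lambda>j0 \<sigma> \<pi> j x. poly (XX ^ (if j = j0 then p1 else 0) * hp (\<sigma> j)) x
          * poly (XX ^ (if j = j0 then p2 else 0) * hp (\<pi> j)) (cnj x)"
  have fact_perm: "(\<Prod>j<N. fact (\<sigma> j)) = (\<Prod>k<N. fact k :: complex)" if "\<sigma> permutes {..<N}" for \<sigma>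
    using prod.permute[OF that, of "fact :: nat \<Rightarrow> complex"] by (simp add: comp_def)
  have inner: "(\<Sum>\<pi> | \<pi> permutes {..<N}. of_int (sign \<sigma>) * of_int (sign \<pi>) * (\<Prod>j<N. wint (?G j0 \<sigma> \<pi> j)))
     = level_moment p1 p2 (\<sigma> j0) * (mom 0 0 ^ N * (\<Prod>k<N. fact k))"
    if \<sigma>: "\<sigma> permutes {..<N}" and j0: "j0 < N" for \<sigma> j0
  proof -
    have "(\<Sum>\<pi> | \<pi> permutes {..<N}. of_int (sign \<sigma>) * of_int (sign \<pi>) * (\<Prod>j<N. wint (?G j0 \<sigma> \<pi> j)))
      = (\<Sum>\<pi> | \<pi> permutes {..<N}. mom 0 0 ^ N * (of_int (sign \<sigma>) * of_int (sign \<pi>) *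
         (\<Prod>j<N. if j = j0 then ip (XX ^ p1 * hp (\<sigma> j)) (XX ^ p2 * hp (\<pi> j)) else ip (hp (\<sigma> j)) (hp (\<pi> j)))))"
    proof (intro sum.cong refl)
      fix \<pi>
      have "(\<Prod>j<N. wint (?G j0 \<sigma> \<pi> j)) = (\<Prod>j<N. mom 0 0 * (if j = j0 then ip (XX ^ p1 * hp (\<sigma> j)) (XX ^ p2 * hp (\<pi> j)) else ip (hp (\<sigma> j)) (hp (\<pi> j))))"
        unfolding wint_polys by (intro prod.cong refl) auto
      then show "of_int (sign \<sigma>) * of_int (sign \<pi>) * (\<Prod>j<N. wint (?G j0 \<sigma> \<pi> j))
        = mom 0 0 ^ N * (of_int (sign \<sigma>) * of_int (sign \<pi>) *
         (\<Prod>j<N. if j = j0 then ip (XX ^ p1 * hp (\<sigma> j)) (XX ^ p2 * hp (\<pi> j)) else ip (hp (\<sigma> j)) (hp (\<pi> j))))"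
        by (simp only: prod.distrib prod_constant card_lessThan mult_ac)
    qed
    also have "\<dots> = mom 0 0 ^ N * (\<Prod>j<N. if j = j0 then ip (XX ^ p1 * hp (\<sigma> j)) (XX ^ p2 * hp (\<sigma> j)) else ip (hp (\<sigma> j)) (hp (\<sigma> j)))"
      unfolding sum_distrib_left[symmetric]
      by (subst sum_permutes_orthogonal[OF \<sigma> j0]) (auto simp: ip_hp)
    also have "(\<Prod>j<N. if j = j0 then ip (XX ^ p1 * hp (\<sigma> j)) (XX ^ p2 * hp (\<sigma> j)) else ip (hp (\<sigma> j)) (hp (\<sigma> j)))
        = (\<Prod>j<N. (if j = j0 then level_moment p1 p2 (\<sigma> j) else 1) * fact (\<sigma> j))"
      by (intro prod.cong refl) (auto simp: level_moment_def ip_hp)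
    also have "\<dots> = level_moment p1 p2 (\<sigma> j0) * (\<Prod>k<N. fact k)"
      using prod_mult_indicator[OF j0, of "\<lambda>j. level_moment p1 p2 (\<sigma> j)" "\<lambda>j. fact (\<sigma> j)"] fact_perm[OF \<sigma>] by simp
    finally show ?thesis by (simp only: mult_ac)
  qed
  have "(\<integral>z. of_real (densC \<tau> N z) * (\<Sum>j<N. z j ^ p1 * cnj (z j) ^ p2) \<partial>PiM {..<N} (\<lambda>_. dA))
    = (\<Sum>j0<N. \<Sum>\<sigma> | \<sigma> permutes {..<N}. \<Sum>\<pi> | \<pi> permutes {..<N}. of_int (sign \<sigma>) * of_int (sign \<pi>) * (\<Prod>j<N. wint (?G j0 \<sigma> \<pi> j)))"
    unfolding densC_expansion
    by (subst integral_PiM_weight[symmetric], rule wintegrable_polys,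
        subst integral_mult_right_zero[symmetric],
        (subst Bochner_Integration.integral_sum[symmetric],
         intro Bochner_Integration.integrable_sum integrable_mult_right integrable_PiM_weight wintegrable_polys)+, rule refl)
  also have "\<dots> = (\<Sum>j0<N. \<Sum>\<sigma> | \<sigma> permutes {..<N}. level_moment p1 p2 (\<sigma> j0) * (mom 0 0 ^ N * (\<Prod>k<N. fact k)))"
    by (intro sum.cong refl inner) auto
  also have "\<dots> = (\<Sum>\<sigma> | \<sigma> permutes {..<N}. (\<Sum>j0<N. level_moment p1 p2 (\<sigma> j0)) * (mom 0 0 ^ N * (\<Prod>k<N. fact k)))"
    by (subst sum.swap) (simp add: sum_distrib_right)
  also have "\<dots> = (\<Sum>\<sigma> | \<sigma> permutes {..<N}. (\<Sum>k<N. level_moment p1 p2 k) * (mom 0 0 ^ N * (\<Prod>k<N. fact k)))"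
  proof (intro sum.cong refl)
    fix \<sigma> assume "\<sigma> \<in> {\<sigma>. \<sigma> permutes {..<N}}"
    then have "(\<Sum>j0<N. level_moment p1 p2 (\<sigma> j0)) = (\<Sum>k<N. level_moment p1 p2 k)"
      using sum.permute[of \<sigma> "{..<N}" "level_moment p1 p2"] by (simp add: comp_def)
    then show "(\<Sum>j0<N. level_moment p1 p2 (\<sigma> j0)) * (mom 0 0 ^ N * (\<Prod>k<N. fact k)) = (\<Sum>k<N. level_moment p1 p2 k) * (mom 0 0 ^ N * (\<Prod>k<N. fact k))"
      by simp
  qed
  also have "\<dots> = (\<Sum>k<N. level_moment p1 p2 k) * (fact N * mom 0 0 ^ N * (\<Prod>k<N. fact k))"
    by (simp add: card_permutations[of "{..<N}" N] mult_ac)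
  finally show ?thesis .
qed

text \<open>The case \<open>p1 = p2 = 0\<close> of the numerator identifies \<open>Z\<close> as the normalisation constant.\<close>

lemma moment_eq:
  assumes N: "N > 0"
    and num: "\<And>p1 p2. (\<integral>z. of_real (d z) * (\<Sum>j<N. z j ^ p1 * cnj (z j) ^ p2) \<partial>PiM {..<N} (\<lambda>_. dA)) = g p1 p2 * Z"
    and Z: "Z \<noteq> 0 \<or> (\<integral>z. d z \<partial>PiM {..<N} (\<lambda>_. dA)) \<noteq> 0" and g0: "g 0 0 = of_nat N"
  shows "moment d p1 p2 N = g p1 p2"
proof -
  have "(\<integral>z. of_real (d z) * of_nat N \<partial>PiM {..<N} (\<lambda>_. dA)) = of_nat N * Z"
    using num[of 0 0] g0 by simp
  then have "complex_of_real (\<integral>z. d z \<partial>PiM {..<N} (\<lambda>_. dA)) = Z"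
    using N by (simp add: integral_complex_of_real)
  then show ?thesis using Z unfolding moment_def num by auto
qed

text \<open>The normalisation constant is explicit here, so it is seen to be nonzero
  directly.\<close>

theorem MC_eq:
  assumes "N > 0" shows "MC \<tau> p1 p2 N = (\<Sum>k<N. level_moment p1 p2 k)"
  unfolding MC_def
proof (rule moment_eq[OF assms integral_densC])
  have "(\<Prod>k<N. fact k :: complex) \<noteq> 0" by (simp add: prod_zero_iff)
  then show "fact N * mom 0 0 ^ N * (\<Prod>k<N. fact k) \<noteq> 0 \<or> (\<integral>z. densC \<tau> N z \<partial>PiM {..<N} (\<lambda>_. dA)) \<noteq> 0"
    using mom_0_nonzero by simp
  show "(\<Sum>k<N. level_moment 0 0 k) = of_nat N" by (simp add: level_moment_def ip_hp)
qed

end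

text \<open>Two different conjugate pairs contribute four differences, which form the two squared
  moduli, whereas each pair contributes its own difference once. The density has the square of that
  modulus, so one factor \<open>z - cnj z\<close> per point remains for the weight.\<close>

lemma vandermonde_conjugate_pairs:
  fixes z :: "nat \<Rightarrow> complex"
  defines "w \<equiv> \<lambda>a. if even a then z (a div 2) else cnj (z (a div 2))"
  shows "(\<Prod>b<2 * N. \<Prod>a<b. w b - w a)
    = of_real (\<Prod>k<N. \<Prod>j<k. (cmod (z j - z k))\<^sup>2 * (cmod (z j - cnj (z k)))\<^sup>2) * (\<Prod>k<N. cnj (z k) - z k)"
proof -
  have sq: "complex_of_real ((cmod (x - y))\<^sup>2) * of_real ((cmod (x - cnj y))\<^sup>2)
     = ((y - x) * (y - cnj x)) * ((cnj y - x) * (cnj y - cnj x))" for x y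
    unfolding complex_norm_square by (simp add: algebra_simps)
  have "(\<Prod>b<2 * N. \<Prod>a<b. w b - w a)
     = (\<Prod>k<N. (\<Prod>a<2 * k. w (2 * k) - w a) * (\<Prod>a<Suc (2 * k). w (Suc (2 * k)) - w a))"
    by (rule prod_double)
  also have "\<dots> = (\<Prod>k<N. (\<Prod>j<k. ((z k - z j) * (z k - cnj (z j))) * ((cnj (z k) - z j) * (cnj (z k) - cnj (z j)))) * (cnj (z k) - z k))"
    by (simp only: prod.lessThan_Suc prod_double) (simp add: w_def prod.distrib mult_ac)
  finally show ?thesis unfolding of_real_prod of_real_mult sq by (simp add: prod.distrib)
qed

section \<open>The second density integrated term by term\<close>

context elliptic_weight
begin

lemma
  shows wint_bform: "wint (\<lambda>z. poly u z * poly v (cnj z) * (z - cnj z)) = - mom 0 0 * bform u v"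
    and wintegrable_bform: "wintegrable (\<lambda>z. poly u z * poly v (cnj z) * (z - cnj z))"
proof -
  have eq: "(\<lambda>z. poly u z * poly v (cnj z) * (z - cnj z))
      = (\<lambda>z. poly (XX * u) z * poly v (cnj z) + poly (- u) z * poly (XX * v) (cnj z))"
    by (simp add: fun_eq_iff algebra_simps)
  show "wintegrable (\<lambda>z. poly u z * poly v (cnj z) * (z - cnj z))"
    unfolding eq by (intro wintegrable_add wintegrable_polys)
  show "wint (\<lambda>z. poly u z * poly v (cnj z) * (z - cnj z)) = - mom 0 0 * bform u v"
    unfolding eq by (subst wint_add[OF wintegrable_polys wintegrable_polys])
      (simp only: wint_polys bform_def ip_linear, simp add: algebra_simps)
qed

text \<open>One Vandermonde product covers the points and their conjugates together, hence a single
  permutation of \<open>2 * N\<close> indices, with \<open>\<sigma> (2 * j)\<close> attached to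
  \<open>z j\<close> and \<open>\<sigma> (Suc (2 * j))\<close> to its conjugate.\<close>

lemma densH_expansion:
  "of_real (densH \<tau> N z) * (\<Sum>j<N. z j ^ p1 * cnj (z j) ^ p2)
   = (\<Sum>j0<N. \<Sum>\<sigma> | \<sigma> permutes {..<2 * N}. of_int (sign \<sigma>) *
       (\<Prod>j<N. (poly (XX ^ (if j = j0 then p1 else 0) * skq (\<sigma> (2 * j))) (z j)
          * poly (XX ^ (if j = j0 then p2 else 0) * skq (\<sigma> (Suc (2 * j)))) (cnj (z j)) * (z j - cnj (z j)))
          * of_real (omegaH \<tau> (z j))))"
proof -
  define w where "w = (\<lambda>a. if even a then z (a div 2) else cnj (z (a div 2)))"
  have V: "(\<Prod>b<2 * N. \<Prod>a<b. w b - w a)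
    = (\<Sum>\<sigma> | \<sigma> permutes {..<2 * N}. of_int (sign \<sigma>) *
        (\<Prod>j<N. poly (skq (\<sigma> (2 * j))) (z j) * poly (skq (\<sigma> (Suc (2 * j)))) (cnj (z j))))"
    by (subst vandermonde_monic[of skq, OF conjunct1[OF skq_monic] conjunct2[OF skq_monic]])
       (simp add: prod_double w_def)
  have sq: "complex_of_real ((cmod (x - cnj x))\<^sup>2) = (cnj x - x) * (x - cnj x)" for x
    unfolding complex_norm_square by (simp add: algebra_simps)
  have d: "complex_of_real (densH \<tau> N z) = (\<Prod>b<2 * N. \<Prod>a<b. w b - w a)
     * (\<Prod>j<N. (z j - cnj (z j)) * of_real (omegaH \<tau> (z j)))"
    unfolding w_def vandermonde_conjugate_pairs
    unfolding densH_def prod_triangle_swap of_real_mult of_real_prod sq prod.distrib by (simp only: mult_ac)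
  have t: "(\<Prod>j<N. (poly (XX ^ (if j = j0 then p1 else 0) * skq (\<sigma> (2 * j))) (z j)
          * poly (XX ^ (if j = j0 then p2 else 0) * skq (\<sigma> (Suc (2 * j)))) (cnj (z j)) * (z j - cnj (z j)))
          * complex_of_real (omegaH \<tau> (z j)))
      = (z j0 ^ p1 * cnj (z j0) ^ p2) * ((\<Prod>j<N. poly (skq (\<sigma> (2 * j))) (z j) * poly (skq (\<sigma> (Suc (2 * j)))) (cnj (z j)))
        * (\<Prod>j<N. (z j - cnj (z j)) * of_real (omegaH \<tau> (z j))))" if "j0 < N" for j0 \<sigma>
  proof -
    have "(\<Prod>j<N. (poly (XX ^ (if j = j0 then p1 else 0) * skq (\<sigma> (2 * j))) (z j)
          * poly (XX ^ (if j = j0 then p2 else 0) * skq (\<sigma> (Suc (2 * j)))) (cnj (z j)) * (z j - cnj (z j)))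
          * complex_of_real (omegaH \<tau> (z j)))
      = (\<Prod>j<N. (if j = j0 then z j ^ p1 * cnj (z j) ^ p2 else 1) *
         ((poly (skq (\<sigma> (2 * j))) (z j) * poly (skq (\<sigma> (Suc (2 * j)))) (cnj (z j))) * ((z j - cnj (z j)) * of_real (omegaH \<tau> (z j)))))"
      by (intro prod.cong refl) (auto simp: mult_ac)
    also have "\<dots> = (z j0 ^ p1 * cnj (z j0) ^ p2) *
       (\<Prod>j<N. (poly (skq (\<sigma> (2 * j))) (z j) * poly (skq (\<sigma> (Suc (2 * j)))) (cnj (z j))) * ((z j - cnj (z j)) * of_real (omegaH \<tau> (z j))))"
      by (rule prod_mult_indicator[OF that])
    finally show ?thesis by (simp only: prod.distrib)
  qed
  show ?thesis unfolding d sum_distrib_left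
  proof (intro sum.cong refl)
    fix j0 assume "j0 \<in> {..<N}"
    then have j0: "j0 < N" by simp
    show "(\<Prod>b<2 * N. \<Prod>a<b. w b - w a) * (\<Prod>j<N. (z j - cnj (z j)) * of_real (omegaH \<tau> (z j))) * (z j0 ^ p1 * cnj (z j0) ^ p2)
     = (\<Sum>\<sigma> | \<sigma> permutes {..<2 * N}. of_int (sign \<sigma>) *
       (\<Prod>j<N. (poly (XX ^ (if j = j0 then p1 else 0) * skq (\<sigma> (2 * j))) (z j)
          * poly (XX ^ (if j = j0 then p2 else 0) * skq (\<sigma> (Suc (2 * j)))) (cnj (z j)) * (z j - cnj (z j)))
          * complex_of_real (omegaH \<tau> (z j))))"
      unfolding t[OF j0] V sum_distrib_right
      by (intro sum.cong refl) (simp only: mult_ac)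
  qed
qed

lemma integral_densH:
  "(\<integral>z. of_real (densH \<tau> N z) * (\<Sum>j<N. z j ^ p1 * cnj (z j) ^ p2) \<partial>PiM {..<N} (\<lambda>_. dA))
   = skew_moment p1 p2 N * ((- mom 0 0) ^ N *
      (\<Sum>\<sigma> | \<sigma> permutes {..<2 * N}. of_int (sign \<sigma>) * (\<Prod>j<N. bform (skq (\<sigma> (2 * j))) (skq (\<sigma> (Suc (2 * j)))))))"
proof -
  let ?G = "\<lambda>j0 \<sigma> j x. poly (XX ^ (if j = j0 then p1 else 0) * skq (\<sigma> (2 * j))) x
          * poly (XX ^ (if j = j0 then p2 else 0) * skq (\<sigma> (Suc (2 * j)))) (cnj x) * (x - cnj x)"
  define F where "F a b = Fform p1 p2 (skq a) (skq b)" for a b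
  define B where "B a b = bform (skq a) (skq b)" for a b
  have "(\<integral>z. of_real (densH \<tau> N z) * (\<Sum>j<N. z j ^ p1 * cnj (z j) ^ p2) \<partial>PiM {..<N} (\<lambda>_. dA))
    = (\<Sum>j0<N. \<Sum>\<sigma> | \<sigma> permutes {..<2 * N}. of_int (sign \<sigma>) * (\<Prod>j<N. wint (?G j0 \<sigma> j)))"
    unfolding densH_expansion
    by (subst integral_PiM_weight[symmetric], rule wintegrable_bform,
        subst integral_mult_right_zero[symmetric],
        (subst Bochner_Integration.integral_sum[symmetric],
         intro Bochner_Integration.integrable_sum integrable_mult_right integrable_PiM_weight wintegrable_bform)+, rule refl)
  also have "\<dots> = (\<Sum>j0<N. \<Sum>\<sigma> | \<sigma> permutes {..<2 * N}. (- mom 0 0) ^ N * (of_int (sign \<sigma>) *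
      (\<Prod>j<N. if j = j0 then F (\<sigma> (2 * j)) (\<sigma> (Suc (2 * j))) else B (\<sigma> (2 * j)) (\<sigma> (Suc (2 * j))))))"
  proof (intro sum.cong refl)
    fix j0 \<sigma>
    have "(\<Prod>j<N. wint (?G j0 \<sigma> j)) = (\<Prod>j<N. - mom 0 0 * (if j = j0 then F (\<sigma> (2 * j)) (\<sigma> (Suc (2 * j))) else B (\<sigma> (2 * j)) (\<sigma> (Suc (2 * j)))))"
      unfolding wint_bform F_def B_def Fform_def by (intro prod.cong refl) auto
    then show "of_int (sign \<sigma>) * (\<Prod>j<N. wint (?G j0 \<sigma> j)) = (- mom 0 0) ^ N * (of_int (sign \<sigma>) *
      (\<Prod>j<N. if j = j0 then F (\<sigma> (2 * j)) (\<sigma> (Suc (2 * j))) else B (\<sigma> (2 * j)) (\<sigma> (Suc (2 * j)))))"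
      by (simp only: prod.distrib prod_constant card_lessThan mult_ac)
  qed
  also have "\<dots> = (- mom 0 0) ^ N * (\<Sum>j0<N. \<Sum>\<sigma> | \<sigma> permutes {..<2 * N}. of_int (sign \<sigma>) *
      (\<Prod>j<N. if j = j0 then F (\<sigma> (2 * j)) (\<sigma> (Suc (2 * j))) else B (\<sigma> (2 * j)) (\<sigma> (Suc (2 * j)))))"
    unfolding sum_distrib_left ..
  also have "(\<Sum>j0<N. \<Sum>\<sigma> | \<sigma> permutes {..<2 * N}. of_int (sign \<sigma>) *
      (\<Prod>j<N. if j = j0 then F (\<sigma> (2 * j)) (\<sigma> (Suc (2 * j))) else B (\<sigma> (2 * j)) (\<sigma> (Suc (2 * j)))))
    = (\<Sum>k<N. (F (2 * k) (Suc (2 * k)) - F (Suc (2 * k)) (2 * k)) / (2 * B (2 * k) (Suc (2 * k))))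
      * (\<Sum>\<sigma> | \<sigma> permutes {..<2 * N}. of_int (sign \<sigma>) * (\<Prod>j<N. B (\<sigma> (2 * j)) (\<sigma> (Suc (2 * j)))))"
    unfolding B_def
    by (intro sum_permutes_skew_orthogonal bform_antisym bform_skq_eq_0 bform_skq_nz)
  finally show ?thesis unfolding skew_moment_def F_def B_def by (simp only: mult_ac)
qed

lemma densH_nonneg: "densH \<tau> N z \<ge> 0"
  unfolding densH_def omegaH_def by (intro mult_nonneg_nonneg prod_nonneg) auto

text \<open>Read off the expansion at \<open>p1 = p2 = 0\<close>, where the sum over the points is
  the constant \<open>N\<close>.\<close>

lemma integrable_densH: "integrable (PiM {..<N} (\<lambda>_. dA)) (densH \<tau> N)" if "N > 0"
proof -
  have "integrable (PiM {..<N} (\<lambda>_. dA)) (\<lambda>z. of_real (densH \<tau> N z) * (\<Sum>j<N. z j ^ 0 * cnj (z j) ^ 0))"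
    unfolding densH_expansion
    by (intro Bochner_Integration.integrable_sum integrable_mult_right integrable_PiM_weight wintegrable_bform)
  then have "integrable (PiM {..<N} (\<lambda>_. dA)) (\<lambda>z. complex_of_real (densH \<tau> N z * real N))"
    by simp
  then show ?thesis using that unfolding complex_of_real_integrable_eq by simp
qed

lemma integral_densH_nonzero:
  assumes "N > 0" shows "(\<integral>z. densH \<tau> N z \<partial>PiM {..<N} (\<lambda>_. dA)) \<noteq> 0"
proof
  interpret P: product_sigma_finite "\<lambda>_::nat. dA"
    unfolding product_sigma_finite_def using sigma_finite_dA by blast
  \<comment> \<open>Unit boxes in the upper half plane, stacked with gaps: points from different
    boxes are distinct, and none of them is the conjugate of another or of itself, so the density
    vanishes nowhere on their product.\<close>
  define U where "U j = box (Complex 0 (2 * real j + 1)) (Complex 1 (2 * real j + 2))" for j :: nat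
  define S where "S = Pi\<^sub>E {..<N} U"
  have U: "x \<in> U j \<Longrightarrow> 2 * real j + 1 < Im x \<and> Im x < 2 * real j + 2" for x j
    by (auto simp: U_def box_def Basis_complex_def)
  have Us: "U j \<in> sets dA" for j by (simp add: U_def)
  have S: "S \<in> sets (PiM {..<N} (\<lambda>_. dA))"
    unfolding S_def by (intro sets_PiM_I_finite Us) auto
  have "emeasure (PiM {..<N} (\<lambda>_. dA)) S = (\<Prod>j<N. emeasure dA (U j))"
    unfolding S_def by (rule P.emeasure_PiM) (auto simp: U_def)
  moreover have "emeasure dA (U j) = ennreal (1 / pi)" for j
  proof -
    have "emeasure lborel (U j) = 1"
      unfolding U_def by (subst emeasure_lborel_box) (auto simp: Basis_complex_def)
    then show ?thesis unfolding dA_def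
      by (subst emeasure_density_const) (auto simp: U_def)
  qed
  ultimately have pos: "emeasure (PiM {..<N} (\<lambda>_. dA)) S \<noteq> 0" by simp
  have nz: "densH \<tau> N z \<noteq> 0" if "z \<in> S" for z
  proof -
    have im: "2 * real j + 1 < Im (z j)" "Im (z j) < 2 * real j + 2" if "j < N" for j
      using U[of "z j" j] \<open>z \<in> S\<close> that by (auto simp: S_def PiE_def Pi_def)
    have "z j \<noteq> z k" if "j < N" "k \<in> {j<..<N}" for j k
    proof -
      have "Im (z j) < Im (z k)" using im[of j] im[of k] that by auto
      then show ?thesis by auto
    qed
    moreover have "z j \<noteq> cnj (z k)" if "j < N" "k < N" for j k
    proof -
      have "Im (z j) > 0" "Im (cnj (z k)) < 0" using im[of j] im[of k] that by auto
      then show ?thesis by auto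
    qed
    ultimately show ?thesis unfolding densH_def omegaH_def
      by (auto simp: prod_zero_iff)
  qed
  assume "(\<integral>z. densH \<tau> N z \<partial>PiM {..<N} (\<lambda>_. dA)) = 0"
  then have "AE z in PiM {..<N} (\<lambda>_. dA). densH \<tau> N z = 0"
    using integral_nonneg_eq_0_iff_AE[OF integrable_densH[OF assms]] densH_nonneg by simp
  then have "AE z in PiM {..<N} (\<lambda>_. dA). z \<notin> S"
    by (rule AE_mp) (use nz in auto)
  then show False using pos AE_iff_null_sets[OF S] by auto
qed

lemma skew_moment_0_0: "skew_moment 0 0 N = of_nat N"
proof -
  have "(Fform 0 0 (skq (2 * k)) (skq (Suc (2 * k))) - Fform 0 0 (skq (Suc (2 * k))) (skq (2 * k)))
     / (2 * bform (skq (2 * k)) (skq (Suc (2 * k)))) = 1" for k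
    using bform_skq_nz[of k] bform_antisym[of "skq (Suc (2 * k))" "skq (2 * k)"]
    by (simp add: Fform_def del: skq_simps)
  then show "skew_moment 0 0 N = of_nat N" unfolding skew_moment_def by simp
qed

text \<open>The permutation sum in the normalisation is not evaluated; that the total mass is
  nonzero follows from the nonnegativity of the density.\<close>

theorem MH_eq:
  assumes "N > 0" shows "MH \<tau> p1 p2 N = skew_moment p1 p2 N"
  unfolding MH_def
proof (rule moment_eq[OF assms integral_densH])
  show "(- mom 0 0) ^ N * (\<Sum>\<sigma> | \<sigma> permutes {..<2 * N}. of_int (sign \<sigma>) * (\<Prod>j<N. bform (skq (\<sigma> (2 * j))) (skq (\<sigma> (Suc (2 * j))))))
    \<noteq> 0 \<or> (\<integral>z. densH \<tau> N z \<partial>PiM {..<N} (\<lambda>_. dA)) \<noteq> 0"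
    using integral_densH_nonzero[OF assms] by simp
  show "skew_moment 0 0 N = of_nat N" by (rule skew_moment_0_0)
qed

end

section \<open>Large-level expansions\<close>

text \<open>\<open>expn d A B f\<close>: for positive arguments \<open>f\<close> is a polynomial of degree at most \<open>d\<close> with leading
  coefficients \<open>A\<close> and \<open>B\<close>. Exactness matters for \<open>d = 1\<close>, where an error term \<open>O(1/x)\<close> would sum to a logarithm.\<close>

definition expn :: "nat \<Rightarrow> real \<Rightarrow> real \<Rightarrow> (real \<Rightarrow> real) \<Rightarrow> bool" where
  "expn d A B f \<longleftrightarrow> (\<exists>g. degree g \<le> d \<and> coeff g 0 = A \<and> coeff g 1 = B \<and> (\<forall>x>0. f x = x ^ d * poly g (1 / x)))"

lemma expn_const: "expn 0 A 0 (\<lambda>x. A)"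
  unfolding expn_def by (rule exI[of _ "[:A:]"]) auto

lemma expn_linear: "expn (Suc 0) a b (\<lambda>x. a * x + b)"
  unfolding expn_def by (rule exI[of _ "[:a, b:]"]) (auto simp: field_simps)

lemma expn_add:
  assumes "expn d A B f" "expn d A' B' f'"
  shows "expn d (A + A') (B + B') (\<lambda>x. f x + f' x)"
proof -
  from assms obtain g g' where "degree g \<le> d" "coeff g 0 = A" "coeff g 1 = B" "\<forall>x>0. f x = x ^ d * poly g (1 / x)"
    "degree g' \<le> d" "coeff g' 0 = A'" "coeff g' 1 = B'" "\<forall>x>0. f' x = x ^ d * poly g' (1 / x)"
    unfolding expn_def by blast
  then show ?thesis unfolding expn_def
    by (intro exI[of _ "g + g'"]) (auto simp: degree_add_le distrib_left)
qed

lemma expn_mult: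
  assumes "expn d A B f" "expn e A' B' f'"
  shows "expn (d + e) (A * A') (A * B' + B * A') (\<lambda>x. f x * f' x)"
proof -
  from assms obtain g g' where "degree g \<le> d" "coeff g 0 = A" "coeff g 1 = B" "\<forall>x>0. f x = x ^ d * poly g (1 / x)"
    "degree g' \<le> e" "coeff g' 0 = A'" "coeff g' 1 = B'" "\<forall>x>0. f' x = x ^ e * poly g' (1 / x)"
    unfolding expn_def by blast
  then show ?thesis unfolding expn_def
    by (intro exI[of _ "g * g'"])
       (auto simp: coeff_mult power_add intro: order_trans[OF degree_mult_le add_mono])
qed

lemma expn_linear_mult:
  "expn d A B f \<Longrightarrow> expn (Suc d) (a * A) (a * B + b * A) (\<lambda>x. (a * x + b) * f x)"
  using expn_mult[OF expn_linear[of a b], of d A B f] by simp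

lemma expn_cmult: "expn d A B f \<Longrightarrow> expn d (c * A) (c * B) (\<lambda>x. c * f x)"
  using expn_mult[OF expn_const[of c], of d A B f] by simp

lemma expn_sum:
  "(\<And>i. i \<in> I \<Longrightarrow> expn d (A i) (B i) (f i)) \<Longrightarrow> expn d (\<Sum>i\<in>I. A i) (\<Sum>i\<in>I. B i) (\<lambda>x. \<Sum>i\<in>I. f i x)"
proof (induction I rule: infinite_finite_induct)
  case (insert i I)
  then show ?case using expn_add[of d "A i" "B i" "f i"] by simp
qed (auto simp: expn_def intro!: exI[of _ 0])

lemma expn_cong: "expn d A B f \<Longrightarrow> A = A' \<Longrightarrow> B = B' \<Longrightarrow> (\<And>x. f x = f' x) \<Longrightarrow> expn d A' B' f'"
  unfolding expn_def by simp

lemma expn_Suc: "expn d A B f \<Longrightarrow> expn (Suc d) 0 A f"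
  unfolding expn_def by (elim exE, rule_tac x = "pCons 0 g" in exI) auto

lemma expn_power: "expn d 1 0 (\<lambda>x. x ^ d)"
  unfolding expn_def by (rule exI[of _ 1]) auto

text \<open>These differences sum to \<open>N ^ Suc d\<close> by telescoping and are the yardstick
  for \<open>expn_sum_lessThan\<close>.\<close>

lemma expn_power_diff: "expn d (real (Suc d)) (real (Suc d) * real d / 2) (\<lambda>x. (x + 1) ^ Suc d - x ^ Suc d)"
proof (induction d)
  case 0
  show ?case by (rule expn_cong[OF expn_const[of 1]]) auto
next
  case (Suc d)
  have "expn (Suc d) (real (Suc d) + 1) ((real (Suc d) * real d / 2) + real (Suc d) + 0)
      (\<lambda>x. (1 * x + 1) * ((x + 1) ^ Suc d - x ^ Suc d) + x ^ Suc d)"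
    using expn_add[OF expn_mult[OF expn_linear[of 1 1] Suc] expn_power] by simp
  then show ?case by (rule expn_cong) (simp_all add: field_simps)
qed

text \<open>With the two top coefficients gone, degree at most \<open>d - 2\<close> remains; for
  \<open>d < 2\<close> the function is zero.\<close>

lemma expn_bound:
  assumes "expn d 0 0 f"
  shows "\<exists>K\<ge>0. \<forall>x\<ge>1. \<bar>f x\<bar> \<le> (if d \<ge> 2 then K * x ^ (d - 2) else 0)"
proof -
  from assms obtain g where g: "degree g \<le> d" "coeff g 0 = 0" "coeff g 1 = 0" "\<And>x. x > 0 \<Longrightarrow> f x = x ^ d * poly g (1 / x)"
    unfolding expn_def by blast
  show ?thesis
  proof (cases "d \<ge> 2")
    case False
    have "coeff g i = 0" for i
      using g False coeff_eq_0[of g i] by (cases "i \<le> 1") (auto simp: le_Suc_eq)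
    then have "g = 0" by (simp add: poly_eq_iff)
    then show ?thesis using g(4) False by (intro exI[of _ 0]) auto
  next
    case True
    define K where "K = (\<Sum>i\<le>degree g. \<bar>coeff g i\<bar>)"
    have "\<bar>f x\<bar> \<le> K * x ^ (d - 2)" if x: "x \<ge> 1" for x
    proof -
      have "f x = (\<Sum>i\<le>degree g. coeff g i * (x ^ d * (1 / x) ^ i))"
        using g(4)[of x] x by (simp add: poly_altdef sum_distrib_left mult_ac)
      also have "\<bar>\<dots>\<bar> \<le> (\<Sum>i\<le>degree g. \<bar>coeff g i\<bar> * x ^ (d - 2))"
      proof (intro order_trans[OF sum_abs] sum_mono)
        fix i
        show "\<bar>coeff g i * (x ^ d * (1 / x) ^ i)\<bar> \<le> \<bar>coeff g i\<bar> * x ^ (d - 2)"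
        proof (cases "coeff g i = 0")
          case False
          then have "2 \<le> i" using g(2,3) by (metis One_nat_def less_2_cases not_le_imp_less)
          have "i \<le> d" using False g(1) le_degree[of g i] by simp
          have "x ^ d * (1 / x) ^ i = x ^ (d - i)"
            using x \<open>i \<le> d\<close> by (simp add: power_diff power_one_over field_simps)
          also have "\<dots> \<le> x ^ (d - 2)" using x \<open>2 \<le> i\<close> by (intro power_increasing) auto
          finally have "x ^ d * (1 / x) ^ i \<le> x ^ (d - 2)" .
          then show ?thesis using x by (simp add: abs_mult mult_left_mono)
        qed simp
      qed
      finally show ?thesis by (simp add: K_def sum_distrib_right)
    qed
    moreover have "K \<ge> 0" by (simp add: K_def sum_nonneg)
    ultimately show ?thesis using True by (intro exI[of _ K]) auto
  qed
qed

text \<open>Subtracting multiples of the telescoping differences of \<open>x ^ (e + 2)\<close> and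
  \<open>x ^ Suc e\<close> removes both leading coefficients of the summand.\<close>

lemma expn_sum_lessThan:
  assumes f: "expn (Suc e) A B f"
  shows "\<exists>K\<ge>0. \<forall>N\<ge>1. \<bar>(\<Sum>k<N. f (real k)) - A / (real e + 2) * real N ^ (e + 2)
      - (B / (real e + 1) - A / 2) * real N ^ Suc e\<bar> \<le> K * real N ^ e"
proof -
  \<comment> \<open>\<open>A'\<close> and \<open>B'\<close> solve \<open>A' * (e + 2) = A\<close>
    and \<open>A' * (e + 2) * (e + 1) / 2 + B' * (e + 1) = B\<close>. The \<open>- A / 2\<close> is
    the first Euler-Maclaurin correction for a sum over \<open>k < N\<close>.\<close>
  define A' where "A' = A / (real e + 2)"
  define B' where "B' = B / (real e + 1) - A / 2"
  define h where "h x = f x + (- A') * ((x + 1) ^ (e + 2) - x ^ (e + 2)) + (- B') * ((x + 1) ^ Suc e - x ^ Suc e)" for x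
  have "expn (Suc e) 0 0 h"
  proof -
    have "expn (Suc e) (A + (- A') * real (e + 2) + (- B') * 0) (B + (- A') * (real (e + 2) * real (Suc e) / 2) + (- B') * real (Suc e)) h"
      unfolding h_def using expn_power_diff[of "Suc e"] expn_Suc[OF expn_power_diff[of e]]
      by (intro expn_add expn_cmult f) simp_all
    then show ?thesis
      by (rule expn_cong) (simp_all add: A'_def B'_def field_simps)
  qed
  from expn_bound[OF this] obtain K where K: "K \<ge> 0"
    and K': "\<And>x. x \<ge> 1 \<Longrightarrow> \<bar>h x\<bar> \<le> (if Suc e \<ge> 2 then K * x ^ (Suc e - 2) else 0)"
    by blast
  have K'': "\<bar>h x\<bar> \<le> (if e = 0 then 0 else K * x ^ (e - 1))" if "x \<ge> 1" for x
    using K'[OF that] by (cases e) auto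
  have "\<bar>(\<Sum>k<N. f (real k)) - A' * real N ^ (e + 2) - B' * real N ^ Suc e\<bar> \<le> (\<bar>h 0\<bar> + K) * real N ^ e"
    if N: "N \<ge> 1" for N
  proof -
    have "(\<Sum>k<N. f (real k)) - A' * real N ^ (e + 2) - B' * real N ^ Suc e = (\<Sum>k<N. h (real k))"
      by (induction N) (simp_all add: h_def algebra_simps)
    \<comment> \<open>\<open>expn\<close> says nothing at 0, so \<open>k = 0\<close> gets its own
      term; for \<open>e = 0\<close> all other terms vanish.\<close>
    also have "\<bar>\<dots>\<bar> \<le> (\<Sum>k<N. (if k = 0 then \<bar>h 0\<bar> else 0) + (if e = 0 then 0 else K * real N ^ (e - 1)))"
    proof (intro order_trans[OF sum_abs] sum_mono)
      fix k assume k: "k \<in> {..<N}"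
      show "\<bar>h (real k)\<bar> \<le> (if k = 0 then \<bar>h 0\<bar> else 0) + (if e = 0 then 0 else K * real N ^ (e - 1))"
      proof (cases "k = 0")
        case False
        then have "\<bar>h (real k)\<bar> \<le> (if e = 0 then 0 else K * real k ^ (e - 1))"
          using K''[of "real k"] by simp
        also have "\<dots> \<le> (if e = 0 then 0 else K * real N ^ (e - 1))"
          using k K by (auto intro!: mult_left_mono power_mono)
        finally show ?thesis using False by simp
      qed (use K in auto)
    qed
    also have "\<dots> = \<bar>h 0\<bar> + real N * (if e = 0 then 0 else K * real N ^ (e - 1))"
      using N by (simp add: sum.distrib sum.delta)
    also have "\<dots> \<le> \<bar>h 0\<bar> * real N ^ e + K * real N ^ e"
    proof (intro add_mono)
      show "\<bar>h 0\<bar> \<le> \<bar>h 0\<bar> * real N ^ e" using N by (simp add: mult_le_cancel_left1 one_le_power)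
      show "real N * (if e = 0 then 0 else K * real N ^ (e - 1)) \<le> K * real N ^ e"
        using K by (cases e) (auto simp: mult_ac)
    qed
    finally show ?thesis by (simp add: distrib_right)
  qed
  then show ?thesis unfolding A'_def B'_def using K by (intro exI[of _ "\<bar>h 0\<bar> + K"]) auto
qed

text \<open>\<open>path_coeff a b u v x\<close> sums over lattice paths with \<open>u\<close> up steps and \<open>v\<close> down steps starting at
  height \<open>x\<close>; leaving height \<open>h\<close> upwards costs \<open>a h\<close> and downwards \<open>b h\<close>.\<close>

fun path_coeff :: "(real \<Rightarrow> real) \<Rightarrow> (real \<Rightarrow> real) \<Rightarrow> nat \<Rightarrow> nat \<Rightarrow> real \<Rightarrow> real" where
  "path_coeff a b 0 0 x = 1"
| "path_coeff a b (Suc u) 0 x = a (x + real u) * path_coeff a b u 0 x"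
| "path_coeff a b 0 (Suc v) x = b (x - real v) * path_coeff a b 0 v x"
| "path_coeff a b (Suc u) (Suc v) x = a (x + real u - real (Suc v)) * path_coeff a b u (Suc v) x
     + b (x + real (Suc u) - real v) * path_coeff a b (Suc u) v x"

lemma path_coeff_step:
  "u + v > 0 \<Longrightarrow> path_coeff a b u v x =
     (if u = 0 then 0 else a (x + real (u - 1) - real v) * path_coeff a b (u - 1) v x)
   + (if v = 0 then 0 else b (x + real u - real (v - 1)) * path_coeff a b u (v - 1) x)"
  by (cases u; cases v) auto

text \<open>The coefficient at height \<open>n + u - v\<close> collects all orders of
  \<open>u\<close> up and \<open>v\<close> down steps. \<open>n \<ge> p\<close> keeps every path
  with a step still to take at positive height, so \<open>rec\<close> applies and the truncated
  subtractions are exact.\<close>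

lemma XX_power_basis:
  fixes e :: "nat \<Rightarrow> complex poly" and a b :: "real \<Rightarrow> real"
  assumes rec: "\<And>m. m > 0 \<Longrightarrow> XX * e m = smult (of_real (a (real m))) (e (Suc m)) + smult (of_real (b (real m))) (e (m - 1))"
    and n: "n \<ge> p"
  shows "XX ^ p * e n = (\<Sum>u\<le>p. smult (of_real (path_coeff a b u (p - u) (real n))) (e (n + u - (p - u))))"
  using n
proof (induction p)
  case 0
  show ?case by simp
next
  case (Suc p)
  let ?c = "\<lambda>u v. path_coeff a b u v (real n)"
  let ?m = "\<lambda>u. n + u - (p - u)"
  have m: "real (?m u) = real n + real u - real (p - u)" if "u \<le> p" for u
    using Suc.prems that by simp
  have "XX ^ Suc p * e n = (\<Sum>u\<le>p. smult (of_real (?c u (p - u))) (XX * e (?m u)))"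
    using Suc by (simp add: sum_distrib_left mult.assoc)
  \<comment> \<open>Paths of length \<open>Suc p\<close> are sorted by their last step.\<close>
  also have "\<dots> = (\<Sum>u\<le>p. smult (of_real (a (real (?m u)) * ?c u (p - u))) (e (Suc (?m u))))
     + (\<Sum>u\<le>p. smult (of_real (b (real (?m u)) * ?c u (p - u))) (e (?m u - 1)))"
    unfolding sum.distrib[symmetric]
    using Suc.prems by (intro sum.cong refl) (subst rec, auto simp: smult_add_right mult_ac)
  also have "(\<Sum>u\<le>p. smult (of_real (a (real (?m u)) * ?c u (p - u))) (e (Suc (?m u))))
     = (\<Sum>u\<le>Suc p. smult (of_real (if u = 0 then 0 else a (real n + real (u - 1) - real (Suc p - u)) * ?c (u - 1) (Suc p - u))) (e (n + u - (Suc p - u))))"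
    unfolding sum.atMost_Suc_shift using Suc.prems m
    by (simp, intro sum.cong refl) (auto simp: Suc_diff_le add_diff_eq)
  also have "(\<Sum>u\<le>p. smult (of_real (b (real (?m u)) * ?c u (p - u))) (e (?m u - 1)))
     = (\<Sum>u\<le>Suc p. smult (of_real (if Suc p - u = 0 then 0 else b (real n + real u - real (Suc p - u - 1)) * ?c u (Suc p - u - 1))) (e (n + u - (Suc p - u))))"
    using Suc.prems m by (simp, intro sum.cong refl) (auto simp: Suc_diff_le add_diff_eq)
  also have "(\<Sum>u\<le>Suc p. smult (of_real (if u = 0 then 0 else a (real n + real (u - 1) - real (Suc p - u)) * ?c (u - 1) (Suc p - u))) (e (n + u - (Suc p - u))))
     + (\<Sum>u\<le>Suc p. smult (of_real (if Suc p - u = 0 then 0 else b (real n + real u - real (Suc p - u - 1)) * ?c u (Suc p - u - 1))) (e (n + u - (Suc p - u))))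
     = (\<Sum>u\<le>Suc p. smult (of_real (?c u (Suc p - u))) (e (n + u - (Suc p - u))))"
    unfolding sum.distrib[symmetric] smult_add_left[symmetric] of_real_add[symmetric]
    by (intro sum.cong refl) (subst path_coeff_step, auto)
  finally show ?case .
qed

section \<open>Path expansion of matrix elements in the Hermite basis\<close>

context elliptic_weight
begin

definition Pc :: "nat \<Rightarrow> nat \<Rightarrow> real \<Rightarrow> real" where
  "Pc = path_coeff (\<lambda>_. 1) (\<lambda>h. \<tau> * h)"

text \<open>Step costs in the dual basis \<open>hp m / fact m\<close>, where the height factor moves
  from the down steps to the up steps. With this basis in the second argument \<open>ip\<close> is a
  Kronecker delta.\<close>

definition Qc :: "nat \<Rightarrow> nat \<Rightarrow> real \<Rightarrow> real" where
  "Qc = path_coeff (\<lambda>h. h + 1) (\<lambda>_. \<tau>)"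

text \<open>Each path has leading term \<open>\<tau> ^ v * x ^ v\<close>. The next coefficient comes
  from the heights relative to \<open>x\<close>, averaged over paths: the \<open>i\<close>-th down
  step is preceded by \<open>u * i / (v + 1)\<close> up steps on average and by \<open>i - 1\<close>
  down steps, and summing over \<open>i\<close> gives \<open>v * (u - v + 1) / 2\<close>. The
  induction verifies this along the last step.\<close>

lemma expn_Pc:
  "expn v (real ((u + v) choose v) * \<tau> ^ v)
     (real ((u + v) choose v) * \<tau> ^ v * (real v * (real u - real v + 1) / 2)) (Pc u v)"
proof (induction u arbitrary: v)
  case 0
  show ?case
  proof (induction v)
    case 0
    show ?case by (rule expn_cong[OF expn_const[of 1]]) (auto simp: Pc_def)
  next
    case (Suc v)
    from expn_linear_mult[OF Suc, of \<tau> "- \<tau> * real v"] show ?case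
      by (rule expn_cong) (simp_all add: Pc_def field_simps)
  qed
next
  case (Suc u)
  note outer = Suc
  show ?case
  proof (induction v)
    case 0
    show ?case using outer[of 0] by (rule expn_cong) (auto simp: Pc_def)
  next
    case (Suc v)
    define c1 where "c1 = real ((u + Suc v) choose Suc v)"
    define c2 where "c2 = real ((Suc u + v) choose v)"
    have c: "real ((Suc u + Suc v) choose Suc v) = c1 + c2"
      by (simp add: c1_def c2_def)
    have "Suc v * (Suc (v + u) choose Suc v) = Suc u * (Suc (v + u) choose v)"
      by (rule Suc_times_binomial_add)
    then have "real (Suc v * (Suc (v + u) choose Suc v)) = real (Suc u * (Suc (v + u) choose v))"
      by (simp only:)
    moreover have "u + Suc v = Suc (v + u)" "Suc u + v = Suc (v + u)" by auto
    \<comment> \<open>The two binomials count the paths by their last step; this ratio is what makes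
      the two contributions add up to the claimed second coefficient.\<close>
    ultimately have c12: "(real v + 1) * c1 = (real u + 1) * c2"
      unfolding c1_def c2_def by (simp only: of_nat_mult of_nat_Suc add.commute[of 1])
    have "c1 * (real v + 1) * (real u - real v) + c2 * (2 * (real u + 1 - real v) + real v * (real u - real v + 2))
       - (c1 + c2) * ((real v + 1) * (real u - real v + 1)) = (real u + 1) * c2 - (real v + 1) * c1"
      by (simp add: algebra_simps)
    with c12 have eq: "c1 * (real v + 1) * (real u - real v) + c2 * (2 * (real u + 1 - real v) + real v * (real u - real v + 2))
       = (c1 + c2) * ((real v + 1) * (real u - real v + 1))"
      by simp
    have "expn (Suc v) (c1 * \<tau> ^ Suc v + \<tau> * (c2 * \<tau> ^ v))
       (c1 * \<tau> ^ Suc v * (real (Suc v) * (real u - real (Suc v) + 1) / 2)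
        + (\<tau> * (c2 * \<tau> ^ v * (real v * (real (Suc u) - real v + 1) / 2)) + \<tau> * (real (Suc u) - real v) * (c2 * \<tau> ^ v)))
       (\<lambda>x. Pc u (Suc v) x + (\<tau> * x + \<tau> * (real (Suc u) - real v)) * Pc (Suc u) v x)"
      using expn_add[OF outer[of "Suc v"] expn_linear_mult[OF Suc, of \<tau> "\<tau> * (real (Suc u) - real v)"]]
      unfolding c1_def c2_def .
    then show ?case
    proof (rule expn_cong)
      show "c1 * \<tau> ^ Suc v + \<tau> * (c2 * \<tau> ^ v) = real ((Suc u + Suc v) choose Suc v) * \<tau> ^ Suc v"
        unfolding c by (simp add: algebra_simps)
      have "c1 * \<tau> ^ Suc v * (real (Suc v) * (real u - real (Suc v) + 1) / 2)
        + (\<tau> * (c2 * \<tau> ^ v * (real v * (real (Suc u) - real v + 1) / 2)) + \<tau> * (real (Suc u) - real v) * (c2 * \<tau> ^ v))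
        = \<tau> ^ Suc v * (c1 * (real v + 1) * (real u - real v) + c2 * (2 * (real u + 1 - real v) + real v * (real u - real v + 2))) / 2"
        by (simp add: field_simps)
      also have "\<dots> = real ((Suc u + Suc v) choose Suc v) * \<tau> ^ Suc v * (real (Suc v) * (real (Suc u) - real (Suc v) + 1) / 2)"
        unfolding eq c by (simp add: algebra_simps)
      finally show "c1 * \<tau> ^ Suc v * (real (Suc v) * (real u - real (Suc v) + 1) / 2)
        + (\<tau> * (c2 * \<tau> ^ v * (real v * (real (Suc u) - real v + 1) / 2)) + \<tau> * (real (Suc u) - real v) * (c2 * \<tau> ^ v))
        = real ((Suc u + Suc v) choose Suc v) * \<tau> ^ Suc v * (real (Suc v) * (real (Suc u) - real (Suc v) + 1) / 2)" .
    qed (simp add: Pc_def algebra_simps)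
  qed
qed

text \<open>The same averaging with up and down exchanged; in addition each of the \<open>u\<close>
  up steps contributes \<open>1 + s\<close>, from the cost \<open>h + 1\<close> and the shifted
  start.\<close>

lemma expn_Qc:
  "expn u (real ((u + v) choose u) * \<tau> ^ v)
     (real ((u + v) choose u) * \<tau> ^ v * (real u * (real u - real v + 1 + 2 * s) / 2)) (\<lambda>x. Qc u v (x + s))"
proof (induction u arbitrary: v)
  case 0
  show ?case
  proof (induction v)
    case 0
    show ?case by (rule expn_cong[OF expn_const[of 1]]) (auto simp: Qc_def)
  next
    case (Suc v)
    show ?case using expn_cmult[OF Suc, of \<tau>] by (rule expn_cong) (auto simp: Qc_def)
  qed
next
  case (Suc u)
  note outer = Suc
  show ?case
  proof (induction v)
    case 0
    from expn_linear_mult[OF outer[of 0], of 1 "s + real u + 1"] show ?case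
      by (rule expn_cong) (simp_all add: Qc_def field_simps)
  next
    case (Suc v)
    define c1 where "c1 = real ((u + Suc v) choose u)"
    define c2 where "c2 = real ((Suc u + v) choose Suc u)"
    have c: "real ((Suc u + Suc v) choose Suc u) = c1 + c2"
      by (simp add: c1_def c2_def)
    have "Suc u * (Suc (u + v) choose Suc u) = Suc v * (Suc (u + v) choose u)"
      by (rule Suc_times_binomial_add)
    then have "real (Suc u * (Suc (u + v) choose Suc u)) = real (Suc v * (Suc (u + v) choose u))"
      by (simp only:)
    moreover have "u + Suc v = Suc (u + v)" "Suc u + v = Suc (u + v)" by auto
    ultimately have c12: "(real u + 1) * c2 = (real v + 1) * c1"
      unfolding c1_def c2_def by (simp only: of_nat_mult of_nat_Suc add.commute[of 1])
    have "c1 * (2 * (s + real u - real v) + real u * (real u - real v + 2 * s)) + c2 * ((real u + 1) * (real u - real v + 2 + 2 * s))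
       - (c1 + c2) * ((real u + 1) * (real u - real v + 1 + 2 * s)) = (real u + 1) * c2 - (real v + 1) * c1"
      by (simp add: algebra_simps)
    with c12 have eq: "c1 * (2 * (s + real u - real v) + real u * (real u - real v + 2 * s)) + c2 * ((real u + 1) * (real u - real v + 2 + 2 * s))
       = (c1 + c2) * ((real u + 1) * (real u - real v + 1 + 2 * s))"
      by simp
    have "expn (Suc u) (c1 * \<tau> ^ Suc v + \<tau> * (c2 * \<tau> ^ v))
       ((c1 * \<tau> ^ Suc v * (real u * (real u - real (Suc v) + 1 + 2 * s) / 2) + (s + real u - real v) * (c1 * \<tau> ^ Suc v))
        + \<tau> * (c2 * \<tau> ^ v * (real (Suc u) * (real (Suc u) - real v + 1 + 2 * s) / 2)))
       (\<lambda>x. (1 * x + (s + real u - real v)) * Qc u (Suc v) (x + s) + \<tau> * Qc (Suc u) v (x + s))"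
      using expn_add[OF expn_linear_mult[OF outer[of "Suc v"], of 1 "s + real u - real v"] expn_cmult[OF Suc, of \<tau>]]
      unfolding c1_def c2_def by (simp only: mult_1)
    then show ?case
    proof (rule expn_cong)
      show "c1 * \<tau> ^ Suc v + \<tau> * (c2 * \<tau> ^ v) = real ((Suc u + Suc v) choose Suc u) * \<tau> ^ Suc v"
        unfolding c by (simp add: algebra_simps)
      have "(c1 * \<tau> ^ Suc v * (real u * (real u - real (Suc v) + 1 + 2 * s) / 2) + (s + real u - real v) * (c1 * \<tau> ^ Suc v))
        + \<tau> * (c2 * \<tau> ^ v * (real (Suc u) * (real (Suc u) - real v + 1 + 2 * s) / 2))
        = \<tau> ^ Suc v * (c1 * (2 * (s + real u - real v) + real u * (real u - real v + 2 * s)) + c2 * ((real u + 1) * (real u - real v + 2 + 2 * s))) / 2"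
        by (simp add: field_simps)
      also have "\<dots> = real ((Suc u + Suc v) choose Suc u) * \<tau> ^ Suc v * (real (Suc u) * (real (Suc u) - real (Suc v) + 1 + 2 * s) / 2)"
        unfolding eq c by (simp add: algebra_simps)
      finally show "(c1 * \<tau> ^ Suc v * (real u * (real u - real (Suc v) + 1 + 2 * s) / 2) + (s + real u - real v) * (c1 * \<tau> ^ Suc v))
        + \<tau> * (c2 * \<tau> ^ v * (real (Suc u) * (real (Suc u) - real v + 1 + 2 * s) / 2))
        = real ((Suc u + Suc v) choose Suc u) * \<tau> ^ Suc v * (real (Suc u) * (real (Suc u) - real (Suc v) + 1 + 2 * s) / 2)" .
    qed (simp add: Qc_def algebra_simps)
  qed
qed

lemma ip_XX_power_hp:
  assumes "n \<ge> p1" "m \<ge> p2"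
  shows "ip (XX ^ p1 * hp n) (XX ^ p2 * hp m) = fact m *
    of_real (\<Sum>u\<le>p1. \<Sum>w\<le>p2. if n + u - (p1 - u) = m + w - (p2 - w) then Pc u (p1 - u) (real n) * Qc w (p2 - w) (real m) else 0)"
proof -
  define g where "g m = smult (1 / fact m) (hp m)" for m
  have P: "XX ^ p1 * hp n = (\<Sum>u\<le>p1. smult (of_real (Pc u (p1 - u) (real n))) (hp (n + u - (p1 - u))))"
    unfolding Pc_def by (rule XX_power_basis[OF _ assms(1)]) (subst XX_mult_hp, simp)
  have Q: "XX ^ p2 * g m = (\<Sum>w\<le>p2. smult (of_real (Qc w (p2 - w) (real m))) (g (m + w - (p2 - w))))"
    unfolding Qc_def
  proof (rule XX_power_basis[OF _ assms(2)])
    fix m :: nat assume "m > 0"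
    then obtain k where k: "m = Suc k" by (cases m) auto
    have "(2 + complex_of_nat k) \<noteq> 0" "(1 + complex_of_nat k) \<noteq> 0"
      using of_nat_neq_0[of "Suc k", where 'a = complex] of_nat_neq_0[of k, where 'a = complex] by simp_all
    then show "XX * g m = smult (of_real (real m + 1)) (g (Suc m)) + smult (of_real \<tau>) (g (m - 1))"
      unfolding g_def k mult_smult_right XX_mult_hp
      by (simp add: smult_add_right divide_simps del: hp.simps)
  qed
  have ipg: "ip (hp j) (g k) = (if j = k then 1 else 0)" for j k
    by (simp add: g_def ip_linear ip_hp)
  have "ip (XX ^ p1 * hp n) (XX ^ p2 * hp m) = fact m * ip (XX ^ p1 * hp n) (XX ^ p2 * g m)"
    by (simp add: g_def ip_linear)
  also have "ip (XX ^ p1 * hp n) (XX ^ p2 * g m)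
    = of_real (\<Sum>u\<le>p1. \<Sum>w\<le>p2. if n + u - (p1 - u) = m + w - (p2 - w) then Pc u (p1 - u) (real n) * Qc w (p2 - w) (real m) else 0)"
    unfolding P ip_sum_left ip_smult_left unfolding Q ip_sum_right ip_smult_right ipg of_real_sum sum_distrib_left
    by (intro sum.cong refl) auto
  finally show ?thesis .
qed

text \<open>Each factor \<open>XX\<close> moves the level by one, so levels too far apart never
  meet.\<close>

lemma ip_XX_power_hp_eq_0: "n > m + p1 + p2 \<Longrightarrow> ip (XX ^ p1 * hp n) (XX ^ p2 * hp m) = 0"
proof (induction p1 arbitrary: n)
  case 0
  then show ?case
  proof (induction p2 arbitrary: m)
    case 0
    then show ?case by (simp add: ip_hp)
  next
    case (Suc p2)
    have "XX ^ Suc p2 * hp m = XX ^ p2 * hp (Suc m) + smult (of_real \<tau> * of_nat m) (XX ^ p2 * hp (m - 1))"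
      unfolding power_Suc2 mult.assoc XX_mult_hp by (simp add: distrib_left)
    then show ?case using Suc.IH[of "Suc m"] Suc.IH[of "m - 1"] Suc.prems by (simp only: ip_linear) simp
  qed
next
  case (Suc p1)
  have "XX ^ Suc p1 * hp n = XX ^ p1 * hp (Suc n) + smult (of_real \<tau> * of_nat n) (XX ^ p1 * hp (n - 1))"
    unfolding power_Suc2 mult.assoc XX_mult_hp by (simp add: distrib_left)
  then show ?case using Suc.IH[of "Suc n"] Suc.IH[of "n - 1"] Suc.prems by (simp only: ip_linear) simp
qed

end

section \<open>Lattice path sums and the sums over \<open>Iset\<close>\<close>

lemma sum_Iset: "(\<Sum>r\<in>Iset p. f r) = (\<Sum>u\<le>p. f (int p - 2 * int u))"
  by (rule sum.reindex_bij_witness[of _ "\<lambda>u. int p - 2 * int u" "\<lambda>r. nat ((int p - r) div 2)"])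
     (auto simp: Iset_def elim!: evenE; presburger)+

text \<open>For starting heights \<open>n\<close> and \<open>n - 2 * t\<close>, a first path with
  \<open>u\<close> up steps out of \<open>p1\<close> ends where a second one with
  \<open>u + t + d - p1\<close> up and \<open>d - u - t\<close> down steps does, with
  \<open>d = (p1 + p2) div 2\<close>. The conditions say that these numbers are not
  negative.\<close>

definition path_index :: "nat \<Rightarrow> nat \<Rightarrow> nat \<Rightarrow> nat set" where
  "path_index p1 p2 t = {u. u \<le> p1 \<and> u + t \<le> (p1 + p2) div 2 \<and> p1 \<le> u + t + (p1 + p2) div 2}"

context elliptic_weight
begin

definition path_weight :: "nat \<Rightarrow> nat \<Rightarrow> nat \<Rightarrow> nat \<Rightarrow> real" where
  "path_weight p1 p2 t u = (let d = (p1 + p2) div 2 in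
     (real (p1 choose (p1 - u)) * \<tau> ^ (p1 - u)) * (real (p2 choose (u + t + d - p1)) * \<tau> ^ (d - u - t)))"

definition path_sum :: "nat \<Rightarrow> nat \<Rightarrow> nat \<Rightarrow> real" where
  "path_sum p1 p2 t = (\<Sum>u\<in>path_index p1 p2 t. path_weight p1 p2 t u)"

definition path_poly :: "nat \<Rightarrow> nat \<Rightarrow> nat \<Rightarrow> real \<Rightarrow> real" where
  "path_poly p1 p2 t x = (let d = (p1 + p2) div 2 in
     \<Sum>u\<in>path_index p1 p2 t. Pc u (p1 - u) x * Qc (u + t + d - p1) (d - u - t) (x + (- 2 * real t)))"

lemma ip_eq_path_poly:
  assumes ev: "even (p1 + p2)" and n: "n \<ge> p1" "n \<ge> p2 + 2 * t"
  shows "ip (XX ^ p1 * hp n) (XX ^ p2 * hp (n - 2 * t)) = fact (n - 2 * t) * of_real (path_poly p1 p2 t (real n))"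
proof -
  obtain d where d: "p1 + p2 = 2 * d" using ev by (elim evenE)
  have dd: "(p1 + p2) div 2 = d" using d by simp
  have inner: "(\<Sum>w\<le>p2. if n + u - (p1 - u) = n - 2 * t + w - (p2 - w) then Pc u (p1 - u) (real n) * Qc w (p2 - w) (real (n - 2 * t)) else 0)
     = (if u \<in> path_index p1 p2 t then Pc u (p1 - u) (real n) * Qc (u + t + d - p1) (d - u - t) (real n + (- 2 * real t)) else 0)"
    if u: "u \<le> p1" for u
  proof -
    have r: "real (n - 2 * t) = real n + (- 2 * real t)" using n by simp
    have "(n + u - (p1 - u) = n - 2 * t + w - (p2 - w)) \<longleftrightarrow> (w = u + t + d - p1 \<and> p1 \<le> u + t + d)" if "w \<le> p2" for w
      using that u n d by auto
    then have "(\<Sum>w\<le>p2. if n + u - (p1 - u) = n - 2 * t + w - (p2 - w) then Pc u (p1 - u) (real n) * Qc w (p2 - w) (real (n - 2 * t)) else 0)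
      = (\<Sum>w\<le>p2. if w = u + t + d - p1 then (if p1 \<le> u + t + d then Pc u (p1 - u) (real n) * Qc w (p2 - w) (real (n - 2 * t)) else 0) else 0)"
      by (intro sum.cong refl) auto
    also have "\<dots> = (if u + t + d - p1 \<le> p2 \<and> p1 \<le> u + t + d then Pc u (p1 - u) (real n) * Qc (u + t + d - p1) (p2 - (u + t + d - p1)) (real (n - 2 * t)) else 0)"
      by (simp add: sum.delta)
    also have "\<dots> = (if u \<in> path_index p1 p2 t then Pc u (p1 - u) (real n) * Qc (u + t + d - p1) (d - u - t) (real n + (- 2 * real t)) else 0)"
    proof -
      have "(u + t + d - p1 \<le> p2 \<and> p1 \<le> u + t + d) \<longleftrightarrow> u \<in> path_index p1 p2 t"
        using u d by (auto simp: path_index_def dd)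
      moreover have "p2 - (u + t + d - p1) = d - u - t" if "u \<in> path_index p1 p2 t"
        using that d by (auto simp: path_index_def dd)
      ultimately show ?thesis unfolding r by auto
    qed
    finally show ?thesis .
  qed
  have "path_index p1 p2 t = {u \<in> {..p1}. u \<in> path_index p1 p2 t}"
    by (auto simp: path_index_def)
  then have "path_poly p1 p2 t (real n) = (\<Sum>u\<le>p1. if u \<in> path_index p1 p2 t then Pc u (p1 - u) (real n) * Qc (u + t + d - p1) (d - u - t) (real n + (- 2 * real t)) else 0)"
    unfolding path_poly_def Let_def dd by (subst sum.inter_filter[symmetric]) auto
  also have "\<dots> = (\<Sum>u\<le>p1. \<Sum>w\<le>p2. if n + u - (p1 - u) = n - 2 * t + w - (p2 - w) then Pc u (p1 - u) (real n) * Qc w (p2 - w) (real (n - 2 * t)) else 0)"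
    by (intro sum.cong refl) (subst inner, auto)
  finally show ?thesis using n by (subst ip_XX_power_hp) auto
qed

text \<open>Cost grows with height on the \<open>p1 - u\<close> down steps of the first path and the
  \<open>u + t + d - p1\<close> up steps of the second. These number \<open>d + t\<close> for every
  \<open>u\<close>, so all pairs of paths share one degree bound.\<close>

lemma expn_path_poly:
  assumes ev: "even (p1 + p2)"
  shows "expn ((p1 + p2) div 2 + t) (path_sum p1 p2 t)
     (\<Sum>u\<in>path_index p1 p2 t. path_weight p1 p2 t u * ((real (p1 - u) * (real u - real (p1 - u) + 1)
        + real (u + t + (p1 + p2) div 2 - p1) * (real u + real t - real (p1 - u) + real t + 1 - 4 * real t)) / 2))
     (path_poly p1 p2 t)"
proof -
  obtain d where d: "p1 + p2 = 2 * d" using ev by (elim evenE)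
  have dd: "(p1 + p2) div 2 = d" using d by simp
  show ?thesis unfolding path_sum_def path_poly_def[abs_def] Let_def dd
  proof (intro expn_sum)
    fix u assume u: "u \<in> path_index p1 p2 t"
    define w where "w = u + t + d - p1"
    have e: "p1 - u + w = d + t" "u + (p1 - u) = p1" "w + (d - u - t) = p2"
      "real w - real (d - u - t) = real u + real t - real (p1 - u) + real t"
      using u d by (auto simp: path_index_def dd w_def)
    have pt: "path_weight p1 p2 t u = real (p1 choose (p1 - u)) * \<tau> ^ (p1 - u) * (real (p2 choose w) * \<tau> ^ (d - u - t))"
      unfolding path_weight_def Let_def dd w_def ..
    have "expn (p1 - u + w) (path_weight p1 p2 t u)
       ((real (p1 choose (p1 - u)) * \<tau> ^ (p1 - u)) * (real (p2 choose w) * \<tau> ^ (d - u - t) * (real w * (real w - real (d - u - t) + 1 + 2 * (- 2 * real t)) / 2))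
        + (real (p1 choose (p1 - u)) * \<tau> ^ (p1 - u) * (real (p1 - u) * (real u - real (p1 - u) + 1) / 2)) * (real (p2 choose w) * \<tau> ^ (d - u - t)))
       (\<lambda>x. Pc u (p1 - u) x * Qc w (d - u - t) (x + (- 2 * real t)))"
      using expn_mult[OF expn_Pc[of "p1 - u" u] expn_Qc[of w "d - u - t" "- 2 * real t"]]
      unfolding e(2,3) pt .
    then show "expn (d + t) (path_weight p1 p2 t u) (path_weight p1 p2 t u * ((real (p1 - u) * (real u - real (p1 - u) + 1)
        + real (u + t + d - p1) * (real u + real t - real (p1 - u) + real t + 1 - 4 * real t)) / 2))
        (\<lambda>x. Pc u (p1 - u) x * Qc (u + t + d - p1) (d - u - t) (x + (- 2 * real t)))"
      unfolding e(1,4) w_def[symmetric]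
      by (rule expn_cong) (simp_all add: pt field_simps)
  qed
qed

text \<open>The substitution is \<open>r = p1 - 2 * u\<close>. Changing the range of
  \<open>r\<close> between \<open>Iset m\<close> and \<open>Iset p1\<close> only adds or drops terms
  with a vanishing binomial, and a negative power of \<open>\<tau>\<close> also occurs only next to
  such a binomial.\<close>

lemma Iset_sum_eq_path_sum:
  assumes ev: "even (p1 + p2)" and m: "m = max p1 p2 \<or> m = min p1 p2 \<and> t = 0"
  shows "(\<Sum>r\<in>Iset m. \<tau> powi ((int p1 + int p2) div 2 + r - int t) * binomZ p1 ((int p1 + r) div 2)
        * binomZ p2 ((int p2 + r) div 2 - int t) * g r)
    = (\<Sum>u\<in>path_index p1 p2 t. path_weight p1 p2 t u * g (int p1 - 2 * int u))"
proof -
  obtain d where d: "p1 + p2 = 2 * d" using ev by (elim evenE)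
  have dd: "(p1 + p2) div 2 = d" using d by simp
  have di: "int p1 + int p2 = 2 * int d" using d by presburger
  let ?F = "\<lambda>r. \<tau> powi ((int p1 + int p2) div 2 + r - int t) * binomZ p1 ((int p1 + r) div 2)
        * binomZ p2 ((int p2 + r) div 2 - int t) * g r"
  have fin: "finite (Iset p)" for p
    by (rule finite_subset[of _ "{- int p..int p}"]) (auto simp: Iset_def)
  have "(\<Sum>r\<in>Iset m. ?F r) = (\<Sum>r\<in>Iset p1. ?F r)"
  proof (cases "m = max p1 p2")
    case True
    have "?F r = 0" if "r \<in> Iset m - Iset p1" for r
    proof -
      have par: "even (r + int p1)" using that True ev by (auto simp: Iset_def max_def)
      then have "r < - int p1 \<or> r > int p1" using that by (auto simp: Iset_def)
      then have "\<not> (0 \<le> (int p1 + r) div 2 \<and> (int p1 + r) div 2 \<le> int p1)" using par by presburger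
      then have "binomZ p1 ((int p1 + r) div 2) = 0" unfolding binomZ_def by (rule if_not_P)
      then show ?thesis by simp
    qed
    moreover have "Iset p1 \<subseteq> Iset m" using True ev by (auto simp: Iset_def max_def)
    ultimately show ?thesis by (intro sum.mono_neutral_right fin) auto
  next
    case False
    then have mn: "m = min p1 p2" and t: "t = 0" using m by auto
    have "?F r = 0" if "r \<in> Iset p1 - Iset m" for r
    proof -
      have par: "even (r + int p2)" using that ev by (auto simp: Iset_def)
      then have "r < - int p2 \<or> r > int p2" using that mn by (auto simp: Iset_def min_def split: if_splits)
      then have "\<not> (0 \<le> (int p2 + r) div 2 - int t \<and> (int p2 + r) div 2 - int t \<le> int p2)" using par t by presburger
      then have "binomZ p2 ((int p2 + r) div 2 - int t) = 0" unfolding binomZ_def by (rule if_not_P)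
      then show ?thesis by simp
    qed
    moreover have "Iset m \<subseteq> Iset p1" using mn ev by (auto simp: Iset_def min_def)
    ultimately show ?thesis by (intro sum.mono_neutral_left fin) auto
  qed
  also have "\<dots> = (\<Sum>u\<le>p1. ?F (int p1 - 2 * int u))" by (rule sum_Iset)
  also have "\<dots> = (\<Sum>u\<le>p1. if u \<in> path_index p1 p2 t then path_weight p1 p2 t u * g (int p1 - 2 * int u) else 0)"
  proof (intro sum.cong refl)
    fix u assume "u \<in> {..p1}"
    then have u: "u \<le> p1" by simp
    have e1: "(int p1 + (int p1 - 2 * int u)) div 2 = int (p1 - u)" using u by presburger
    have e2: "(int p2 + (int p1 - 2 * int u)) div 2 - int t = int d - int u - int t" using di by presburger
    have b1: "binomZ p1 (int (p1 - u)) = real (p1 choose (p1 - u))" by (simp add: binomZ_def)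
    show "?F (int p1 - 2 * int u) = (if u \<in> path_index p1 p2 t then path_weight p1 p2 t u * g (int p1 - 2 * int u) else 0)"
    proof (cases "u \<in> path_index p1 p2 t")
      case True
      then have le: "u + t \<le> d" "p1 \<le> u + t + d" by (auto simp: path_index_def dd)
      have e3: "int d - int u - int t = int (d - u - t)" using le by simp
      have le2: "d - u - t \<le> p2" using le d by simp
      have e4: "(int p1 + int p2) div 2 + (int p1 - 2 * int u) - int t = int ((p1 - u) + (d - u - t))"
        using di le u by simp
      have "p2 choose (d - u - t) = p2 choose (u + t + d - p1)"
        using binomial_symmetric[OF le2] d le by (auto intro!: arg_cong2[of _ _ _ _ "(choose)"])
      then have b2: "binomZ p2 (int (d - u - t)) = real (p2 choose (u + t + d - p1))"
        using le2 by (simp add: binomZ_def)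
      show ?thesis unfolding e1 e2 e3 e4 b1 b2 power_int_of_nat power_add
        using True by (simp add: path_weight_def Let_def dd)
    next
      case False
      then have "\<not> (0 \<le> int d - int u - int t \<and> int d - int u - int t \<le> int p2)"
        using u d by (auto simp: path_index_def dd)
      then have "binomZ p2 (int d - int u - int t) = 0" unfolding binomZ_def by (rule if_not_P)
      then show ?thesis unfolding e2 using False by simp
    qed
  qed
  also have "\<dots> = (\<Sum>u\<in>path_index p1 p2 t. path_weight p1 p2 t u * g (int p1 - 2 * int u))"
  proof -
    have "path_index p1 p2 t = {u \<in> {..p1}. u \<in> path_index p1 p2 t}" by (auto simp: path_index_def)
    then show ?thesis by (subst sum.inter_filter[symmetric]) auto
  qed
  finally show ?thesis .
qed

lemma C1_eq:
  assumes "even (p1 + p2)" shows "C1 \<tau> p1 p2 = path_sum p1 p2 0 / (real ((p1 + p2) div 2) + 1)"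
proof -
  have "real (p1 + p2) / 2 = real ((p1 + p2) div 2)"
    using assms by (simp add: real_of_nat_div)
  then show ?thesis
    using Iset_sum_eq_path_sum[of p1 p2 "min p1 p2" 0 "\<lambda>_. 1"] assms by (simp add: C1_def path_sum_def)
qed

lemma C2_eq: "even (p1 + p2) \<Longrightarrow> C2 \<tau> p1 p2 = - (\<Sum>u\<in>path_index p1 p2 0. path_weight p1 p2 0 u * ((real p1 - 2 * real u) / 2))"
  using Iset_sum_eq_path_sum[of p1 p2 "min p1 p2" 0 "\<lambda>r. real_of_int r / 2"]
  by (simp add: C2_def)

lemma level_moment_eq_path_poly: "even (p1 + p2) \<Longrightarrow> k \<ge> max p1 p2 \<Longrightarrow> level_moment p1 p2 k = of_real (path_poly p1 p2 0 (real k))"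
  using ip_eq_path_poly[of p1 p2 k 0] by (simp add: level_moment_def)

text \<open>For \<open>k \<ge> max p1 p2\<close> the summand is a polynomial in \<open>k\<close>, so
  \<open>expn_sum_lessThan\<close> applies up to a constant \<open>c\<close> from the lower levels;
  after division by \<open>N ^ (d + 1)\<close> with \<open>d \<ge> 1\<close> this constant is of
  order \<open>N ^ (- 2)\<close>. For \<open>p1 = p2 = 0\<close> the expansion is exact.\<close>

lemma sum_level_moment_expansion:
  assumes ev: "even (p1 + p2)"
  shows "(\<lambda>N. (\<Sum>k<N. level_moment p1 p2 k) / of_nat N ^ ((p1 + p2) div 2 + 1) - of_real (C1 \<tau> p1 p2) - of_real (C2 \<tau> p1 p2) / of_nat N)
     \<in> O(\<lambda>N. 1 / of_nat N ^ 2)"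
proof (cases "p1 + p2 = 0")
  case True
  then have p: "p1 = 0" "p2 = 0" by auto
  have level_moment: "level_moment 0 0 k = 1" for k by (simp add: level_moment_def ip_hp)
  have I: "Iset 0 = {0}" by (auto simp: Iset_def)
  have C: "C1 \<tau> 0 0 = 1" "C2 \<tau> 0 0 = 0" by (simp_all add: C1_def C2_def I binomZ_def)
  have "\<forall>\<^sub>F N in sequentially. (\<Sum>k<N. level_moment p1 p2 k) / of_nat N ^ ((p1 + p2) div 2 + 1) - of_real (C1 \<tau> p1 p2) - of_real (C2 \<tau> p1 p2) / of_nat N = 0"
    using eventually_gt_at_top[of 0] by eventually_elim (simp add: p level_moment C)
  then show ?thesis by (intro bigoI[where c = 0]) (auto elim: eventually_mono)
next
  case False
  obtain d where d: "p1 + p2 = 2 * d" using ev by (elim evenE)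
  with False obtain e where e: "d = Suc e" by (cases d) auto
  have dd: "(p1 + p2) div 2 = Suc e" using d e by simp
  \<comment> \<open>At \<open>t = 0\<close> both paths have the same average
    \<open>(2 * u - p1 + 1) / 2\<close> per growing step, and there are \<open>d\<close> such steps.
    Dividing by \<open>d\<close> and subtracting half of \<open>path_sum\<close> leaves
    \<open>(2 * u - p1) / 2\<close>, that is \<open>- r / 2\<close> as in \<open>C2\<close>.\<close>
  define B where "B = real d * (\<Sum>u\<in>path_index p1 p2 0. path_weight p1 p2 0 u * ((2 * real u - real p1 + 1) / 2))"
  have ex: "expn (Suc e) (path_sum p1 p2 0) B (path_poly p1 p2 0)"
    unfolding dd[symmetric]
  proof (rule expn_cong[OF expn_path_poly[OF ev, of 0, simplified add_0_right]])
    show "(\<Sum>u\<in>path_index p1 p2 0. path_weight p1 p2 0 u * ((real (p1 - u) * (real u - real (p1 - u) + 1)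
        + real (u + (p1 + p2) div 2 - p1) * (real u + real 0 - real (p1 - u) + real 0 + 1 - 4 * real 0)) / 2)) = B"
      unfolding B_def sum_distrib_left
    proof (intro sum.cong refl)
      fix u assume u: "u \<in> path_index p1 p2 0"
      have q: "real (p1 - u) = real p1 - real u" "real (u + (p1 + p2) div 2 - p1) = real u + real d - real p1"
        using u dd e by (auto simp: path_index_def)
      show "path_weight p1 p2 0 u * ((real (p1 - u) * (real u - real (p1 - u) + 1)
        + real (u + (p1 + p2) div 2 - p1) * (real u + real 0 - real (p1 - u) + real 0 + 1 - 4 * real 0)) / 2)
        = real d * (path_weight p1 p2 0 u * ((2 * real u - real p1 + 1) / 2))"
        unfolding q by (simp add: field_simps)
    qed
  qed auto
  have CC1: "path_sum p1 p2 0 / (real e + 2) = C1 \<tau> p1 p2" by (simp add: C1_eq[OF ev] dd)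
  have CC2: "B / (real e + 1) - path_sum p1 p2 0 / 2 = C2 \<tau> p1 p2"
  proof -
    have Be: "B / (real e + 1) = (\<Sum>u\<in>path_index p1 p2 0. path_weight p1 p2 0 u * ((2 * real u - real p1 + 1) / 2))"
      by (simp add: B_def e add.commute)
    show ?thesis unfolding Be path_sum_def C2_eq[OF ev] sum_divide_distrib sum_subtractf[symmetric] sum_negf[symmetric]
      by (intro sum.cong refl) (simp add: field_simps)
  qed
  from expn_sum_lessThan[OF ex, unfolded CC1 CC2] obtain K where K: "K \<ge> 0"
    "\<And>N. N \<ge> 1 \<Longrightarrow> \<bar>(\<Sum>k<N. path_poly p1 p2 0 (real k)) - C1 \<tau> p1 p2 * real N ^ (e + 2) - C2 \<tau> p1 p2 * real N ^ Suc e\<bar> \<le> K * real N ^ e"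
    by blast
  define M where "M = max p1 p2"
  define c where "c = (\<Sum>k<M. level_moment p1 p2 k - of_real (path_poly p1 p2 0 (real k)))"
  have S: "(\<Sum>k<N. level_moment p1 p2 k) = of_real (\<Sum>k<N. path_poly p1 p2 0 (real k)) + c" if "N \<ge> M" for N
  proof -
    have "(\<Sum>k<N. level_moment p1 p2 k - of_real (path_poly p1 p2 0 (real k))) = c" unfolding c_def
      using that level_moment_eq_path_poly[OF ev] by (intro sum.mono_neutral_right) (auto simp: M_def)
    then show ?thesis by (simp add: sum_subtractf algebra_simps)
  qed
  show ?thesis
  proof (rule bigoI)
    show "\<forall>\<^sub>F N in sequentially. norm ((\<Sum>k<N. level_moment p1 p2 k) / of_nat N ^ ((p1 + p2) div 2 + 1) - of_real (C1 \<tau> p1 p2) - of_real (C2 \<tau> p1 p2) / of_nat N)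
       \<le> (K + cmod c) * norm (1 / of_nat N ^ 2 :: complex)"
      using eventually_ge_at_top[of "max M 1"]
    proof eventually_elim
      fix N assume N: "N \<ge> max M 1"
      define s where "s = (\<Sum>k<N. path_poly p1 p2 0 (real k)) - C1 \<tau> p1 p2 * real N ^ (e + 2) - C2 \<tau> p1 p2 * real N ^ Suc e"
      have nz: "of_nat N \<noteq> (0::complex)" using N by simp
      have "(\<Sum>k<N. level_moment p1 p2 k) / of_nat N ^ ((p1 + p2) div 2 + 1) - of_real (C1 \<tau> p1 p2) - of_real (C2 \<tau> p1 p2) / of_nat N
         = (of_real s + c) / of_nat N ^ (e + 2)"
        using nz N by (subst S) (simp_all add: dd s_def field_simps)
      also have "norm \<dots> \<le> (\<bar>s\<bar> + cmod c) / real N ^ (e + 2)"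
      proof -
        have "norm (of_nat N ^ (e + 2) :: complex) = real N ^ (e + 2)"
          by (simp add: norm_power norm_mult)
        then show ?thesis unfolding norm_divide
          using norm_triangle_ineq[of "of_real s" c] by (simp only:) (intro divide_right_mono, auto)
      qed
      also have "\<dots> \<le> (K * real N ^ e + cmod c * real N ^ e) / real N ^ (e + 2)"
        using K(2)[of N] N unfolding s_def[symmetric]
        by (intro divide_right_mono add_mono) (auto simp: mult_le_cancel_left1 one_le_power)
      also have "\<dots> = (K + cmod c) * norm (1 / of_nat N ^ 2 :: complex)"
        using N by (simp add: norm_divide norm_power norm_mult power_add field_simps power2_eq_square)
      finally show "norm ((\<Sum>k<N. level_moment p1 p2 k) / of_nat N ^ ((p1 + p2) div 2 + 1) - of_real (C1 \<tau> p1 p2) - of_real (C2 \<tau> p1 p2) / of_nat N)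
       \<le> (K + cmod c) * norm (1 / of_nat N ^ 2 :: complex)" .
    qed
  qed
qed

end

text \<open>One term suffices for the boundary term, which enters the recursion one power of
  \<open>N\<close> below the main sum; its weights are rational functions, which \<open>expn\<close>
  does not cover.\<close>

definition approaches :: "real \<Rightarrow> (real \<Rightarrow> real) \<Rightarrow> bool" where
  "approaches A f \<longleftrightarrow> (\<lambda>x. f x - A) \<in> O[at_top](\<lambda>x. 1 / x)"

lemma approaches_const: "approaches A (\<lambda>x. A)"
  by (simp add: approaches_def)

lemma approaches_add: "approaches A f \<Longrightarrow> approaches B g \<Longrightarrow> approaches (A + B) (\<lambda>x. f x + g x)"
  unfolding approaches_def by (drule (1) sum_in_bigo(1)) (simp add: algebra_simps)

lemma approaches_sum:
  "(\<And>i. i \<in> I \<Longrightarrow> approaches (A i) (f i)) \<Longrightarrow> approaches (\<Sum>i\<in>I. A i) (\<lambda>x. \<Sum>i\<in>I. f i x)"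
  by (induction I rule: infinite_finite_induct) (auto intro: approaches_const approaches_add)

lemma inverse_bigo_1: "(\<lambda>x::real. 1 / x) \<in> O[at_top](\<lambda>_. 1)"
  by (rule bigoI[where c = 1]) (auto intro: eventually_mono[OF eventually_ge_at_top[of 1]])

lemma approaches_mult:
  assumes "approaches A f" "approaches B g"
  shows "approaches (A * B) (\<lambda>x. f x * g x)"
proof -
  have f: "(\<lambda>x. f x - A) \<in> O[at_top](\<lambda>x. 1 / x)" and g: "(\<lambda>x. g x - B) \<in> O[at_top](\<lambda>x. 1 / x)"
    using assms by (auto simp: approaches_def)
  have "(\<lambda>x. (f x - A) * (g x - B)) \<in> O[at_top](\<lambda>x. 1 / x * 1)"
    by (rule landau_o.big.mult[OF f landau_o.big_trans[OF g inverse_bigo_1]])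
  moreover have "(\<lambda>x. A * (g x - B)) \<in> O[at_top](\<lambda>x. 1 / x)" "(\<lambda>x. B * (f x - A)) \<in> O[at_top](\<lambda>x. 1 / x)"
    using f g by simp_all
  ultimately have "(\<lambda>x. (f x - A) * (g x - B) + (A * (g x - B) + B * (f x - A))) \<in> O[at_top](\<lambda>x. 1 / x)"
    by (intro sum_in_bigo) simp_all
  then show ?thesis by (simp add: approaches_def algebra_simps)
qed

lemma approaches_prod_1:
  "(\<And>i. i \<in> I \<Longrightarrow> approaches 1 (f i)) \<Longrightarrow> approaches 1 (\<lambda>x. \<Prod>i\<in>I. f i x)"
proof (induction I rule: infinite_finite_induct)
  case (insert i I)
  then show ?case using approaches_mult[of 1 "f i" 1] by simp
qed (auto intro: approaches_const)

lemma approaches_cong: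
  "approaches A f \<Longrightarrow> \<forall>\<^sub>F x in at_top. f x = g x \<Longrightarrow> approaches A g"
  unfolding approaches_def by (erule landau_o.big.in_cong[THEN iffD1, rotated]) (auto elim: eventually_mono)

lemma approaches_shift_ratio: "approaches 1 (\<lambda>x. (x - c) / x)"
  unfolding approaches_def
proof (rule bigoI[where c = "\<bar>c\<bar>"])
  show "\<forall>\<^sub>F x in at_top. norm ((x - c) / x - 1) \<le> \<bar>c\<bar> * norm (1 / x)"
    using eventually_gt_at_top[of 0] by eventually_elim (simp add: diff_divide_distrib abs_divide)
qed

lemma approaches_inverse_shift_ratio: "approaches 1 (\<lambda>x. x / (x - c))"
  unfolding approaches_def
proof (rule bigoI[where c = "2 * \<bar>c\<bar>"])
  show "\<forall>\<^sub>F x in at_top. norm (x / (x - c) - 1) \<le> 2 * \<bar>c\<bar> * norm (1 / x)"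
    using eventually_gt_at_top[of "2 * \<bar>c\<bar> + 1"]
  proof eventually_elim
    fix x assume x: "x > 2 * \<bar>c\<bar> + 1"
    then have p: "x - c > 0" "x > 0" "x - c \<ge> x / 2" by auto
    have "x / (x - c) - 1 = c / (x - c)" using p by (simp add: field_simps)
    then have "norm (x / (x - c) - 1) = \<bar>c\<bar> / (x - c)" using p by (simp add: abs_divide)
    also have "\<dots> \<le> \<bar>c\<bar> / (x / 2)" using p by (intro divide_left_mono) auto
    finally show "norm (x / (x - c) - 1) \<le> 2 * \<bar>c\<bar> * norm (1 / x)" using p by (simp add: mult.commute)
  qed
qed

lemma expn_approaches: "expn d A B f \<Longrightarrow> approaches A (\<lambda>x. f x / x ^ d)"
proof -
  assume "expn d A B f"
  then obtain g where g: "coeff g 0 = A" "\<And>x. x > 0 \<Longrightarrow> f x = x ^ d * poly g (1 / x)"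
    unfolding expn_def by blast
  define K where "K = (\<Sum>i\<le>degree g. \<bar>coeff g i\<bar>)"
  show ?thesis unfolding approaches_def
  proof (rule bigoI[where c = K])
    show "\<forall>\<^sub>F x in at_top. norm (f x / x ^ d - A) \<le> K * norm (1 / x)"
      using eventually_ge_at_top[of 1]
    proof eventually_elim
      fix x :: real assume x: "x \<ge> 1"
      have "f x / x ^ d - A = (\<Sum>i\<le>degree g. coeff g i * (1 / x) ^ i) - A"
        using g(2)[of x] x by (simp add: poly_altdef)
      also have "A = (\<Sum>i\<le>degree g. if i = 0 then coeff g i else 0)"
        by (simp add: g(1))
      also have "(\<Sum>i\<le>degree g. coeff g i * (1 / x) ^ i) - \<dots>
          = (\<Sum>i\<le>degree g. coeff g i * ((1 / x) ^ i - (if i = 0 then 1 else 0)))"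
        unfolding sum_subtractf[symmetric] by (intro sum.cong refl) (simp add: right_diff_distrib)
      also have "norm \<dots> \<le> (\<Sum>i\<le>degree g. \<bar>coeff g i\<bar> * (1 / x))"
      proof (intro order_trans[OF norm_sum] sum_mono)
        fix i
        have "\<bar>(1 / x) ^ i - (if i = 0 then 1 else 0)\<bar> \<le> 1 / x"
        proof (cases i)
          case (Suc j)
          have "(1 / x) ^ j \<le> 1" using x by (intro power_le_one) auto
          then have "(1 / x) ^ i \<le> 1 / x" unfolding Suc power_Suc using x by (intro mult_left_le) auto
          then show ?thesis using x Suc by simp
        qed (use x in auto)
        then show "norm (coeff g i * ((1 / x) ^ i - (if i = 0 then 1 else 0))) \<le> \<bar>coeff g i\<bar> * (1 / x)"
          unfolding real_norm_def abs_mult by (intro mult_left_mono) auto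
      qed
      finally show "norm (f x / x ^ d - A) \<le> K * norm (1 / x)"
        using x by (simp add: K_def sum_divide_distrib g(1))
    qed
  qed
qed

lemma fact_eq_prod_diff:
  "s \<le> n \<Longrightarrow> fact n = fact (n - s) * (\<Prod>j<s. real n - real j)"
proof (induction s)
  case (Suc s)
  then have "n - s = Suc (n - Suc s)" by simp
  then have "fact (n - s) = (real n - real s) * fact (n - Suc s)"
    using Suc.prems by (simp add: of_nat_diff)
  then show ?case using Suc by simp
qed simp

section \<open>Asymptotics of the boundary term\<close>

context elliptic_weight
begin

lemma skp_eq_sum:
  "skp k = (\<Sum>i\<le>k. smult (of_nat (\<Prod>j<i. 2 * (k - j))) (hp (2 * (k - i))))"
proof (induction k)
  case (Suc k)
  have e: "(\<Prod>j<Suc i. 2 * (Suc k - j)) = (2 * Suc k) * (\<Prod>j<i. 2 * (k - j))" for i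
    by (subst prod.lessThan_Suc_shift) simp
  have "(\<Sum>i\<le>Suc k. smult (of_nat (\<Prod>j<i. 2 * (Suc k - j))) (hp (2 * (Suc k - i))))
     = hp (2 * Suc k) + (\<Sum>i\<le>k. smult (of_nat (\<Prod>j<Suc i. 2 * (Suc k - j))) (hp (2 * (k - i))))"
    by (subst sum.atMost_Suc_shift) simp
  also have "\<dots> = hp (2 * Suc k) + (\<Sum>i\<le>k. smult (of_nat ((2 * Suc k) * (\<Prod>j<i. 2 * (k - j)))) (hp (2 * (k - i))))"
    unfolding e ..
  also have "hp (2 * Suc k) + (\<Sum>i\<le>k. smult (of_nat ((2 * Suc k) * (\<Prod>j<i. 2 * (k - j)))) (hp (2 * (k - i))))
     = hp (2 * Suc k) + smult (of_nat (2 * Suc k)) (\<Sum>i\<le>k. smult (of_nat (\<Prod>j<i. 2 * (k - j))) (hp (2 * (k - i))))"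
  proof -
    have "smult c (\<Sum>i\<in>A. f i) = (\<Sum>i\<in>A. smult c (f i))" for c :: complex and A :: "nat set" and f
      by (induction A rule: infinite_finite_induct) (auto simp: smult_add_right)
    then show ?thesis by (simp only: of_nat_mult smult_smult)
  qed
  finally show ?case using Suc
    by (simp del: hp.simps of_nat_Suc mult_Suc_right)
qed simp

text \<open>At \<open>x = 2 * Suc k\<close>: the coefficient of \<open>hp (2 * (k - i))\<close> in
  \<open>skp k\<close>, times \<open>fact (x - 2 * Suc i) / fact (x - 1)\<close>.\<close>

definition boundary_weight :: "nat \<Rightarrow> real \<Rightarrow> real" where
  "boundary_weight i x = (\<Prod>j<i. x - 2 - 2 * real j) / (\<Prod>j<2 * i + 1. x - 1 - real j)"

definition boundary_fun :: "nat \<Rightarrow> nat \<Rightarrow> real \<Rightarrow> real" where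
  "boundary_fun p1 p2 x = (\<Sum>i<(p1 + p2) div 2. boundary_weight i x * path_poly p1 p2 (Suc i) x)"

text \<open>\<open>skp k\<close> involves all even levels up to \<open>2 * k\<close>, but from level
  \<open>2 * Suc k\<close> only those at distance \<open>2 * Suc i \<le> p1 + p2\<close> can be
  reached.\<close>

lemma boundary_term_eq:
  assumes ev: "even (p1 + p2)" and k: "k \<ge> p1 + p2"
  shows "boundary_term p1 p2 k = of_real (boundary_fun p1 p2 (real (2 * Suc k)))"
proof -
  obtain d where d: "p1 + p2 = 2 * d" using ev by (elim evenE)
  have dd: "(p1 + p2) div 2 = d" using d by simp
  define n where "n = 2 * Suc k"
  define S where "S i = of_nat (\<Prod>j<i. 2 * (k - j)) * ip (XX ^ p1 * hp n) (XX ^ p2 * hp (2 * (k - i))) / fact (n - 1)" for i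
  have "boundary_term p1 p2 k = (\<Sum>i\<le>k. S i)"
    unfolding boundary_term_def S_def n_def[symmetric]
    by (subst skp_eq_sum) (simp add: sum_distrib_left ip_sum_right ip_linear sum_divide_distrib n_def del: hp.simps fact_Suc)
  also have "\<dots> = (\<Sum>i<d. S i)"
  proof (rule sum.mono_neutral_right)
    show "\<forall>i\<in>{..k} - {..<d}. S i = 0"
    proof
      fix i assume i: "i \<in> {..k} - {..<d}"
      then have "i \<le> k" "d \<le> i" by auto
      then have "2 * (k - i) + 2 * d \<le> 2 * k" by (simp add: diff_mult_distrib2)
      then have "n > 2 * (k - i) + p1 + p2" using d by (simp add: n_def add.assoc)
      then show "S i = 0" by (simp add: S_def ip_XX_power_hp_eq_0)
    qed
  qed (use k d in auto)
  also have "\<dots> = (\<Sum>i<d. of_real (boundary_weight i (real n) * path_poly p1 p2 (Suc i) (real n)))"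
  proof (intro sum.cong refl)
    fix i assume "i \<in> {..<d}"
    then have i: "i < d" by simp
    have ki: "2 * (k - i) = n - 2 * Suc i" using k d i by (simp add: n_def)
    have ip: "ip (XX ^ p1 * hp n) (XX ^ p2 * hp (2 * (k - i))) = fact (n - 2 * Suc i) * of_real (path_poly p1 p2 (Suc i) (real n))"
      unfolding ki using k d i by (intro ip_eq_path_poly ev) (auto simp: n_def)
    have c: "real (\<Prod>j<i. 2 * (k - j)) = (\<Prod>j<i. real n - 2 - 2 * real j)"
      unfolding of_nat_prod using k d i by (intro prod.cong refl) (auto simp: n_def of_nat_diff)
    have f: "fact (n - 1) = fact (n - 2 * Suc i) * (\<Prod>j<2 * i + 1. real n - 1 - real j)"
      using fact_eq_prod_diff[of "2 * i + 1" "n - 1"] k d i by (simp add: n_def algebra_simps)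
    have nz: "fact (n - 2 * Suc i) \<noteq> (0::real)" by simp
    have "S i = of_real (real (\<Prod>j<i. 2 * (k - j)) * (fact (n - 2 * Suc i) * path_poly p1 p2 (Suc i) (real n)) / fact (n - 1))"
      unfolding S_def ip by (simp del: fact_Suc)
    also have "real (\<Prod>j<i. 2 * (k - j)) * (fact (n - 2 * Suc i) * path_poly p1 p2 (Suc i) (real n)) / fact (n - 1)
       = boundary_weight i (real n) * path_poly p1 p2 (Suc i) (real n)"
      unfolding c f boundary_weight_def using nz by (simp del: fact_Suc prod.lessThan_Suc)
    finally show "S i = of_real (boundary_weight i (real n) * path_poly p1 p2 (Suc i) (real n))" .
  qed
  finally show ?thesis by (simp add: boundary_fun_def dd n_def)
qed

lemma boundary_weight_approaches: "approaches 1 (\<lambda>x. boundary_weight i x * x ^ Suc i)"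
proof (rule approaches_cong)
  have "approaches (1 * 1) (\<lambda>x. (\<Prod>j<i. (x - (2 + 2 * real j)) / x) * (\<Prod>j<2 * i + 1. x / (x - (1 + real j))))"
    by (intro approaches_mult approaches_prod_1 approaches_shift_ratio approaches_inverse_shift_ratio)
  then show "approaches 1 (\<lambda>x. (\<Prod>j<i. (x - (2 + 2 * real j)) / x) * (\<Prod>j<2 * i + 1. x / (x - (1 + real j))))"
    by (simp only: mult_1)
  show "\<forall>\<^sub>F x in at_top. (\<Prod>j<i. (x - (2 + 2 * real j)) / x) * (\<Prod>j<2 * i + 1. x / (x - (1 + real j))) = boundary_weight i x * x ^ Suc i"
    using eventually_gt_at_top[of 0]
  proof eventually_elim
    fix x :: real assume x: "x > 0"
    have "x ^ (2 * i + 1) = x ^ i * x ^ Suc i" by (simp flip: power_add add: mult_2)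
    then show "(\<Prod>j<i. (x - (2 + 2 * real j)) / x) * (\<Prod>j<2 * i + 1. x / (x - (1 + real j))) = boundary_weight i x * x ^ Suc i"
      using x unfolding boundary_weight_def prod_dividef prod_constant card_lessThan
      by (simp add: diff_diff_eq del: power_Suc prod.lessThan_Suc)
  qed
qed

text \<open>The decay of \<open>boundary_weight i\<close> like \<open>x ^ (- Suc i)\<close> offsets
  the surplus degree \<open>Suc i\<close> of \<open>path_poly\<close>, so every \<open>i\<close>
  contributes at leading order.\<close>

lemma boundary_fun_approaches:
  assumes ev: "even (p1 + p2)"
  shows "approaches (\<Sum>i<(p1 + p2) div 2. path_sum p1 p2 (Suc i)) (\<lambda>x. boundary_fun p1 p2 x / x ^ ((p1 + p2) div 2))"
proof (rule approaches_cong)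
  define d where "d = (p1 + p2) div 2"
  have "approaches (1 * path_sum p1 p2 (Suc i)) (\<lambda>x. (boundary_weight i x * x ^ Suc i) * (path_poly p1 p2 (Suc i) x / x ^ (d + Suc i)))" for i
    by (intro approaches_mult boundary_weight_approaches) (rule expn_approaches[OF expn_path_poly[OF ev, of "Suc i", folded d_def]])
  then show "approaches (\<Sum>i<(p1 + p2) div 2. path_sum p1 p2 (Suc i)) (\<lambda>x. \<Sum>i<d. (boundary_weight i x * x ^ Suc i) * (path_poly p1 p2 (Suc i) x / x ^ (d + Suc i)))"
    unfolding d_def[symmetric] by (intro approaches_sum) simp
  show "\<forall>\<^sub>F x in at_top. (\<Sum>i<d. (boundary_weight i x * x ^ Suc i) * (path_poly p1 p2 (Suc i) x / x ^ (d + Suc i))) = boundary_fun p1 p2 x / x ^ ((p1 + p2) div 2)"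
    using eventually_gt_at_top[of 0]
    by eventually_elim (simp add: boundary_fun_def d_def[symmetric] sum_divide_distrib power_add field_simps)
qed

lemma boundary_term_expansion:
  assumes ev: "even (p1 + p2)"
  shows "(\<lambda>N. boundary_term p1 p2 (N - 1) / of_nat (2 * N) ^ ((p1 + p2) div 2) - of_real (\<Sum>i<(p1 + p2) div 2. path_sum p1 p2 (Suc i)))
    \<in> O(\<lambda>N. 1 / of_nat N)"
proof -
  define L where "L = (\<Sum>i<(p1 + p2) div 2. path_sum p1 p2 (Suc i))"
  define d where "d = (p1 + p2) div 2"
  have "(\<lambda>x. boundary_fun p1 p2 x / x ^ d - L) \<in> O[at_top](\<lambda>x. 1 / x)"
    using boundary_fun_approaches[OF ev] by (simp add: approaches_def L_def d_def)
  then obtain c where c: "\<forall>\<^sub>F x in at_top. norm (boundary_fun p1 p2 x / x ^ d - L) \<le> c * norm (1 / x)"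
    by (elim landau_o.bigE)
  have "filterlim (\<lambda>N. real (2 * N)) at_top sequentially"
    by (rule filterlim_compose[OF filterlim_real_sequentially filterlim_subseq]) (auto simp: strict_mono_def)
  from eventually_compose_filterlim[OF c this]
  have ev2: "\<forall>\<^sub>F N in sequentially. norm (boundary_fun p1 p2 (real (2 * N)) / real (2 * N) ^ d - L) \<le> c * norm (1 / real (2 * N))" .
  show ?thesis unfolding L_def[symmetric] unfolding d_def[symmetric]
  proof (rule bigoI[where c = "c / 2"])
    show "\<forall>\<^sub>F N in sequentially. norm (boundary_term p1 p2 (N - 1) / of_nat (2 * N) ^ d - of_real L) \<le> c / 2 * norm (1 / of_nat N :: complex)"
    proof (rule eventually_mono[OF eventually_conj[OF ev2 eventually_ge_at_top[of "p1 + p2 + 1"]]], goal_cases)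
      case (1 N)
      then have b: "norm (boundary_fun p1 p2 (real (2 * N)) / real (2 * N) ^ d - L) \<le> c * norm (1 / real (2 * N))" and N: "N \<ge> p1 + p2 + 1"
        by auto
      have "boundary_term p1 p2 (N - 1) = of_real (boundary_fun p1 p2 (real (2 * N)))"
        using boundary_term_eq[OF ev, of "N - 1"] N by simp
      then have "boundary_term p1 p2 (N - 1) / of_nat (2 * N) ^ d - of_real L = of_real (boundary_fun p1 p2 (real (2 * N)) / real (2 * N) ^ d - L)"
        by simp
      then have "norm (boundary_term p1 p2 (N - 1) / of_nat (2 * N) ^ d - of_real L) = norm (boundary_fun p1 p2 (real (2 * N)) / real (2 * N) ^ d - L)"
        by (simp only: norm_of_real real_norm_def)
      with b show ?case
        by (simp add: norm_divide)
    qed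
  qed
qed

section \<open>The constant \<open>C2'\<close> and the expansion for the second density\<close>

lemma path_sum_eq_0: "t > (p1 + p2) div 2 \<Longrightarrow> path_sum p1 p2 t = 0"
  by (auto simp: path_sum_def path_index_def)

text \<open>The terms with the shift in the first binomial form \<open>path_sum p2 p1 s\<close>,
  those with the shift in the second \<open>path_sum p1 p2 s\<close>. Both vanish for
  \<open>s\<close> beyond \<open>(p1 + p2) div 2\<close>, and \<open>s = Suc i\<close> matches the
  index of \<open>boundary_fun\<close>.\<close>

lemma C2'_eq:
  assumes ev: "even (p1 + p2)" and pos: "p1 + p2 > 0"
  shows "C2' \<tau> p1 p2 = C2 \<tau> p1 p2 / 2
     + (if p1 * p2 = 0 then 0 else (1 - \<tau>\<^sup>2) / 2 * (real (p1 * p2) / real (p1 + p2)) * C1 \<tau> (p1 - 1) (p2 - 1))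
     - (real p2 * (\<Sum>i<(p1 + p2) div 2. path_sum p1 p2 (Suc i)) + real p1 * (\<Sum>i<(p1 + p2) div 2. path_sum p2 p1 (Suc i))) / (2 * real (p1 + p2))"
proof -
  have ev': "even (p2 + p1)" using ev by (simp add: add.commute)
  have Tsum: "(\<Sum>s\<in>{1..max p1 p2}. path_sum p1 p2 s) = (\<Sum>i<(p1 + p2) div 2. path_sum p1 p2 (Suc i))"
    if "even (p1 + p2)" for p1 p2
  proof -
    have "(\<Sum>s\<in>{1..max p1 p2}. path_sum p1 p2 s) = (\<Sum>s\<in>{1..(p1 + p2) div 2}. path_sum p1 p2 s)"
      by (rule sum.mono_neutral_right) (auto intro!: path_sum_eq_0)
    also have "\<dots> = (\<Sum>i<(p1 + p2) div 2. path_sum p1 p2 (Suc i))"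
      by (rule sum.reindex_bij_witness[of _ Suc "\<lambda>s. s - 1"]) auto
    finally show ?thesis .
  qed
  let ?e = "\<lambda>r s. \<tau> powi ((int p1 + int p2) div 2 + r - int s)"
  have A: "(\<Sum>r\<in>Iset (max p1 p2). ?e r s * binomZ p1 ((int p1 + r) div 2) * binomZ p2 ((int p2 + r) div 2 - int s)) = path_sum p1 p2 s" for s
    using Iset_sum_eq_path_sum[OF ev, of "max p1 p2" s "\<lambda>_. 1"] by (simp add: path_sum_def)
  have B: "(\<Sum>r\<in>Iset (max p1 p2). ?e r s * binomZ p1 ((int p1 + r) div 2 - int s) * binomZ p2 ((int p2 + r) div 2)) = path_sum p2 p1 s" for s
    using Iset_sum_eq_path_sum[OF ev', of "max p2 p1" s "\<lambda>_. 1"] by (simp add: path_sum_def max.commute mult_ac add.commute)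
  have "(\<Sum>r\<in>Iset (max p1 p2). \<Sum>s\<in>{1..max p1 p2}. ?e r s *
             (real p1 / real (p1 + p2) * binomZ p1 ((int p1 + r) div 2 - int s) * binomZ p2 ((int p2 + r) div 2)
              + real p2 / real (p1 + p2) * binomZ p1 ((int p1 + r) div 2) * binomZ p2 ((int p2 + r) div 2 - int s)))
     = (\<Sum>s\<in>{1..max p1 p2}. real p1 / real (p1 + p2) * (\<Sum>r\<in>Iset (max p1 p2). ?e r s * binomZ p1 ((int p1 + r) div 2 - int s) * binomZ p2 ((int p2 + r) div 2))
         + real p2 / real (p1 + p2) * (\<Sum>r\<in>Iset (max p1 p2). ?e r s * binomZ p1 ((int p1 + r) div 2) * binomZ p2 ((int p2 + r) div 2 - int s)))"
    by (subst sum.swap) (simp only: sum_distrib_left sum.distrib[symmetric] distrib_left mult_ac)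
  also have "\<dots> = real p1 / real (p1 + p2) * (\<Sum>i<(p1 + p2) div 2. path_sum p2 p1 (Suc i)) + real p2 / real (p1 + p2) * (\<Sum>i<(p1 + p2) div 2. path_sum p1 p2 (Suc i))"
    unfolding A B sum.distrib sum_distrib_left[symmetric] Tsum[OF ev]
    using Tsum[OF ev'] by (simp add: max.commute add.commute)
  finally have S: "(\<Sum>r\<in>Iset (max p1 p2). \<Sum>s\<in>{1..max p1 p2}. ?e r s *
             (real p1 / real (p1 + p2) * binomZ p1 ((int p1 + r) div 2 - int s) * binomZ p2 ((int p2 + r) div 2)
              + real p2 / real (p1 + p2) * binomZ p1 ((int p1 + r) div 2) * binomZ p2 ((int p2 + r) div 2 - int s))) = \<dots>" .
  have half: "1 / 2 * (real p1 / P * B + real p2 / P * A) = (real p2 * A + real p1 * B) / (2 * P)" for P A B :: real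
    by (simp add: add_divide_distrib)
  show ?thesis unfolding C2'_def S half using pos by simp
qed

lemma O_compose_double:
  fixes f :: "nat \<Rightarrow> complex"
  assumes "f \<in> O(\<lambda>N. 1 / of_nat N ^ 2)" shows "(\<lambda>N. f (2 * N)) \<in> O(\<lambda>N. 1 / of_nat N ^ 2)"
proof -
  from assms obtain c where "\<forall>\<^sub>F N in sequentially. norm (f N) \<le> c * norm (1 / of_nat N ^ 2 :: complex)"
    by (elim landau_o.bigE)
  moreover have "filterlim (\<lambda>N::nat. 2 * N) sequentially sequentially"
    by (rule filterlim_subseq) (auto simp: strict_mono_def)
  ultimately have "\<forall>\<^sub>F N in sequentially. norm (f (2 * N)) \<le> c * norm (1 / of_nat (2 * N) ^ 2 :: complex)"
    by (rule eventually_compose_filterlim)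
  then show ?thesis
    by (intro bigoI[where c = "c / 4"]) (simp add: norm_divide norm_power power_mult_distrib norm_mult)
qed

text \<open>The recursion lowers both exponents, hence induction on \<open>p1\<close> with
  \<open>p2\<close> arbitrary. Of the lower moment and of the boundary terms only the leading order
  is needed, since both are one power of \<open>N\<close> smaller than the level sum.\<close>

lemma skew_moment_expansion:
  assumes "even (p1 + p2)"
  shows "(\<lambda>N. skew_moment p1 p2 N / (2 ^ ((p1 + p2) div 2) * of_nat N ^ ((p1 + p2) div 2 + 1)) - of_real (C1 \<tau> p1 p2) - of_real (C2' \<tau> p1 p2) / of_nat N)
     \<in> O(\<lambda>N. 1 / of_nat N ^ 2)"
  using assms
proof (induction p1 arbitrary: p2 rule: less_induct)
  case (less p1)
  note ev = less.prems
  show ?case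
  proof (cases "p1 + p2 = 0")
    case True
    then have p: "p1 = 0" "p2 = 0" by auto
    have I: "Iset 0 = {0}" by (auto simp: Iset_def)
    have C: "C1 \<tau> 0 0 = 1" "C2' \<tau> 0 0 = 0" by (simp_all add: C1_def C2_def C2'_def I binomZ_def)
    have "\<forall>\<^sub>F N in sequentially. skew_moment p1 p2 N / (2 ^ ((p1 + p2) div 2) * of_nat N ^ ((p1 + p2) div 2 + 1)) - of_real (C1 \<tau> p1 p2) - of_real (C2' \<tau> p1 p2) / of_nat N = 0"
      using eventually_gt_at_top[of 0] by eventually_elim (simp add: p skew_moment_0_0 C)
    then show ?thesis by (intro bigoI[where c = 0]) (auto elim: eventually_mono)
  next
    case False
    define d where "d = (p1 + p2) div 2"
    have d2: "p1 + p2 = 2 * d" using ev by (simp add: d_def)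
    then have dpos: "d > 0" using False by linarith
    define P where "P = (of_nat (p1 + p2) :: complex)"
    have P: "P \<noteq> 0" using False unfolding P_def of_nat_eq_0_iff by simp
    define c where "c = complex_of_real (1 - \<tau>\<^sup>2) * (of_nat (p1 * p2) / P)"
    define L where "L = complex_of_real (\<Sum>i<d. path_sum p1 p2 (Suc i))"
    define L' where "L' = complex_of_real (\<Sum>i<d. path_sum p2 p1 (Suc i))"
    define C' where "C' = (if p1 * p2 = 0 then 0 else complex_of_real (C1 \<tau> (p1 - 1) (p2 - 1)))"
    \<comment> \<open>\<open>a\<close>, \<open>b\<close>, \<open>b'\<close> and \<open>h\<close> are
      the normalised errors of the level sum, the two boundary terms and the lower moment. When
      \<open>p1 * p2 = 0\<close> the factor \<open>c\<close> vanishes, so the truncated indices in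
      \<open>h\<close> do no harm.\<close>
    define a where "a N = (\<Sum>k<N. level_moment p1 p2 k) / of_nat N ^ (d + 1) - of_real (C1 \<tau> p1 p2) - of_real (C2 \<tau> p1 p2) / of_nat N" for N
    define b where "b N = boundary_term p1 p2 (N - 1) / of_nat (2 * N) ^ d - L" for N
    define b' where "b' N = boundary_term p2 p1 (N - 1) / of_nat (2 * N) ^ d - L'" for N
    define h where "h N = c * skew_moment (p1 - 1) (p2 - 1) N / (2 ^ (d - 1) * of_nat N ^ d) - c * C'" for N
    have inv: "(\<lambda>N. 1 / of_nat N ^ 2 :: complex) = (\<lambda>N. 1 / of_nat N * (1 / of_nat N))"
      by (simp add: power2_eq_square)
    have Oa: "(\<lambda>N. a (2 * N)) \<in> O(\<lambda>N. 1 / of_nat N ^ 2)"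
      using O_compose_double[OF sum_level_moment_expansion[OF ev]] unfolding a_def d_def .
    have Ob: "b \<in> O(\<lambda>N. 1 / of_nat N)"
      using boundary_term_expansion[OF ev] unfolding b_def[abs_def] L_def d_def .
    have Ob': "b' \<in> O(\<lambda>N. 1 / of_nat N)"
      using boundary_term_expansion[of p2 p1] ev unfolding b'_def[abs_def] L'_def d_def by (simp add: add.commute)
    have Oh: "h \<in> O(\<lambda>N. 1 / of_nat N)"
    proof (cases "p1 * p2 = 0")
      case True
      then have "c = 0" by (simp add: c_def)
      then show ?thesis by (simp add: h_def[abs_def])
    next
      case nz: False
      then have "p1 - 1 < p1" "even ((p1 - 1) + (p2 - 1))" using ev by auto
      note IH = less.IH[OF this]
      have e: "(p1 - 1 + (p2 - 1)) div 2 = d - 1" using d2 nz by simp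
      have e': "d - 1 + 1 = d" using dpos by simp
      define q where "q N = skew_moment (p1 - 1) (p2 - 1) N / (2 ^ (d - 1) * of_nat N ^ d) - of_real (C1 \<tau> (p1 - 1) (p2 - 1)) - of_real (C2' \<tau> (p1 - 1) (p2 - 1)) / of_nat N" for N
      have "q \<in> O(\<lambda>N. 1 / of_nat N ^ 2)" using IH unfolding e e' q_def[abs_def] .
      moreover have "(\<lambda>N. 1 / of_nat N ^ 2 :: complex) \<in> O(\<lambda>N. 1 / of_nat N)"
        by (rule bigoI[where c = 1])
           (auto intro!: eventually_mono[OF eventually_ge_at_top[of 1]] simp: norm_divide norm_mult power2_eq_square field_simps mult_le_cancel_left1)
      ultimately have "q \<in> O(\<lambda>N. 1 / of_nat N)" by (rule landau_o.big_trans)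
      moreover have "(\<lambda>N. of_real (C2' \<tau> (p1 - 1) (p2 - 1)) * (1 / of_nat N :: complex)) \<in> O(\<lambda>N. 1 / of_nat N)"
        by (rule bigoI[where c = "\<bar>C2' \<tau> (p1 - 1) (p2 - 1)\<bar>"]) (simp add: norm_mult norm_divide)
      ultimately have "(\<lambda>N. c * (q N + of_real (C2' \<tau> (p1 - 1) (p2 - 1)) * (1 / of_nat N))) \<in> O(\<lambda>N. 1 / of_nat N)"
        by (cases "c = 0") (auto intro: sum_in_bigo)
      then show ?thesis using nz by (simp add: h_def[abs_def] q_def C'_def algebra_simps)
    qed
    have eq: "\<forall>\<^sub>F N in sequentially. skew_moment p1 p2 N / (2 ^ d * of_nat N ^ (d + 1)) - of_real (C1 \<tau> p1 p2) - of_real (C2' \<tau> p1 p2) / of_nat N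
       = a (2 * N) + 1 / of_nat N * ((1 / 2) * h N - (of_nat p2 / (2 * P)) * b N - (of_nat p1 / (2 * P)) * b' N)"
      using eventually_gt_at_top[of 0]
    proof eventually_elim
      fix N :: nat assume N: "N > 0"
      have nz: "of_nat N \<noteq> (0::complex)" using N by simp
      have C2': "complex_of_real (C2' \<tau> p1 p2) = of_real (C2 \<tau> p1 p2) / 2 + c / 2 * C' - (of_nat p2 * L + of_nat p1 * L') / (2 * P)"
        using False unfolding L_def L'_def d_def
        by (subst C2'_eq[OF ev]) (auto simp: c_def C'_def P_def)
      have r: "skew_moment p1 p2 N = (\<Sum>k<2 * N. level_moment p1 p2 k) / 2 - (of_nat p2 * boundary_term p1 p2 (N - 1) + of_nat p1 * boundary_term p2 p1 (N - 1)) / (2 * P) + c * skew_moment (p1 - 1) (p2 - 1) N"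
        using skew_moment_recursion[OF N, of p1 p2] False unfolding c_def P_def by simp
      have w: "(\<Sum>k<2 * N. level_moment p1 p2 k) = (a (2 * N) + of_real (C1 \<tau> p1 p2) + of_real (C2 \<tau> p1 p2) / (2 * of_nat N)) * (2 ^ d * of_nat N ^ d * (2 * of_nat N))"
        using nz by (simp add: a_def power_mult_distrib)
      have y: "boundary_term p1 p2 (N - 1) = (b N + L) * (2 ^ d * of_nat N ^ d)" "boundary_term p2 p1 (N - 1) = (b' N + L') * (2 ^ d * of_nat N ^ d)"
        using nz by (simp_all add: b_def b'_def power_mult_distrib)
      \<comment> \<open>The lower moment is normalised by \<open>2 ^ (d - 1)\<close>; the missing
        factor 2 is the origin of the half in \<open>(1 - \<tau>\<^sup>2) / 2\<close>.\<close>
      have "2 ^ d = (2 * 2 ^ (d - 1) :: complex)" using dpos by (cases d) auto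
      then have m: "c * skew_moment (p1 - 1) (p2 - 1) N = (h N + c * C') / 2 * (2 ^ d * of_nat N ^ d)"
        using nz by (simp add: h_def)
      show "skew_moment p1 p2 N / (2 ^ d * of_nat N ^ (d + 1)) - of_real (C1 \<tau> p1 p2) - of_real (C2' \<tau> p1 p2) / of_nat N
       = a (2 * N) + 1 / of_nat N * ((1 / 2) * h N - (of_nat p2 / (2 * P)) * b N - (of_nat p1 / (2 * P)) * b' N)"
        unfolding r w y m C2' using nz P by (simp add: field_simps)
    qed
    have "(\<lambda>N. a (2 * N) + 1 / of_nat N * ((1 / 2) * h N - (of_nat p2 / (2 * P)) * b N - (of_nat p1 / (2 * P)) * b' N)) \<in> O(\<lambda>N. 1 / of_nat N ^ 2)"
      unfolding inv
    proof (intro sum_in_bigo landau_o.big.mult landau_o.big_refl)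
      have cm: "(\<lambda>N. k * g N) \<in> O(\<lambda>N. 1 / of_nat N)" if "g \<in> O(\<lambda>N. 1 / of_nat N)" for g :: "nat \<Rightarrow> complex" and k
        using that by (cases "k = 0") auto
      show "(\<lambda>N. 1 / 2 * h N) \<in> O(\<lambda>N. 1 / of_nat N)" by (rule cm[OF Oh])
      show "(\<lambda>N. of_nat p2 / (2 * P) * b N) \<in> O(\<lambda>N. 1 / of_nat N)" by (rule cm[OF Ob])
      show "(\<lambda>N. of_nat p1 / (2 * P) * b' N) \<in> O(\<lambda>N. 1 / of_nat N)" by (rule cm[OF Ob'])
    qed (use Oa in \<open>simp add: inv\<close>)
    then show ?thesis using landau_o.big.in_cong[OF eq] unfolding d_def by blast
  qed
qed

end

theorem mainTheorem8:
  fixes \<tau> :: real and p1 p2 :: nat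
  assumes "0 \<le> \<tau>" and "\<tau> < 1" and "even (p1 + p2)"
  shows "(\<exists>K. \<forall>\<^sub>F N in sequentially.
            cmod (MC \<tau> p1 p2 N / of_nat N ^ ((p1 + p2) div 2 + 1)
                  - of_real (C1 \<tau> p1 p2) - of_real (C2 \<tau> p1 p2) / of_nat N)
            \<le> K / (real N)\<^sup>2)
       \<and> (\<exists>K. \<forall>\<^sub>F N in sequentially.
            cmod (MH \<tau> p1 p2 N / (2 ^ ((p1 + p2) div 2) * of_nat N ^ ((p1 + p2) div 2 + 1))
                  - of_real (C1 \<tau> p1 p2) - of_real (C2' \<tau> p1 p2) / of_nat N)
            \<le> K / (real N)\<^sup>2)"
proof -
  interpret elliptic_weight \<tau> using assms by unfold_locales
  \<comment> \<open>\<open>MC_eq\<close> and \<open>MH_eq\<close> speak of at least one point, hence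
    the comparison of \<open>g\<close> with \<open>f\<close> for positive \<open>N\<close>
    only.\<close>
  have K: "\<exists>K. \<forall>\<^sub>F N in sequentially. cmod (g N) \<le> K / (real N)\<^sup>2"
    if "f \<in> O(\<lambda>N. 1 / of_nat N ^ 2)" "\<And>N. N > 0 \<Longrightarrow> g N = f N" for f g :: "nat \<Rightarrow> complex"
  proof -
    from that(1) obtain c where "\<forall>\<^sub>F N in sequentially. cmod (f N) \<le> c * norm (1 / of_nat N ^ 2 :: complex)"
      by (elim landau_o.bigE)
    then have "\<forall>\<^sub>F N in sequentially. cmod (g N) \<le> c / (real N)\<^sup>2"
      using eventually_gt_at_top[of 0]
      by eventually_elim (simp add: that(2) norm_divide norm_power)
    then show ?thesis ..
  qed
  show ?thesis
    by (intro conjI K[OF sum_level_moment_expansion[OF assms(3)]] K[OF skew_moment_expansion[OF assms(3)]])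
       (simp_all add: MC_eq MH_eq)
qed

end
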